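(* Let $d\ge1$ and $n\ge 2$ be integers. Let $\rho:T_{d,n}^{LM}\to(\mathbb{P}^d)^{n-1}/\!\!/_{Ch}\mathbb{C}^*$ be the unique morphism extending $\rho^\circ:T_{d,n}^\circ\to(\mathbb{P}^d)^{n-1}/\!\!/_{Ch}\mathbb{C}^*$, let $\pi:N\to(\mathbb{P}^d)^{n-1}/\!\!/_{Ch}\mathbb{C}^*$ be the normalization of the Chow quotient, and let $\tilde\rho:T_{d,n}^{LM}\to N$ be the morphism with $\rho=\pi\circ\tilde\rho$ given by the universal property of the normalization. Then $\tilde\rho$ is an isomorphism.
   Context: We work over $\mathbb{C}$. **The space $T_{d,n}^{LM}$.** Let $\mathbb{P}^{d(n-1)-1}$ have homogeneous coordinates $[x_{ik}]$, $1\le i\le n-1$, $1\le k\le d$; write $x_i=(x_{i1},\dots,x_{id})$. For $I\subsetneq\{1,\dots,n\}$ with $n\in I$ and $2\le |I|\le n-1$ let $\delta_{d,I}$ be the linear subspace $\{x_i=0 \ \forall i\in I\setminus\{n\}\}$. $T_{d,n}^{LM}$ is the blow-up of $\mathbb{P}^{d(n-1)-1}$ along the product of the ideal sheaves of these $\delta_{d,I}$; it is a smooth projective toric variety. **The open moduli space.** Let $H=V(x_0)\subset\mathbb{P}^d$, $e_0=[1:0:\dots:0]$, $G_d=\{g\in \mathrm{SL}_{d+1}: g|_H=\mathrm{id}_H\}$, $\mathcal{U}_{d,m}=\{(q_1,\dots,q_m)\in(\mathbb{P}^d)^m: q_i\ne q_j\text{ for }i\ne j,\ q_i\notin H\}$,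 and $T_{d,n}^{\circ}=\mathcal{U}_{d,n}/G_d$ (geometric quotient for the diagonal action). There is an open embedding $T_{d,n}^\circ\subseteq\mathbb{P}^{d(n-1)-1}$ under which $[x_{ik}]$ corresponds to the class of $([1:x_1],\dots,[1:x_{n-1}],e_0)$; its image is disjoint from the blown-up loci, so $T_{d,n}^\circ$ is an open dense subset of $T_{d,n}^{LM}$. **The Chow quotient.** Let $\mathbb{C}^*=\{\operatorname{diag}(t^{-d},t,\dots,t)\}\subset G_d$ act diagonally on $(\mathbb{P}^d)^{n-1}$. Let $\mathcal{V}=\{(p_1,\dots,p_{n-1})\in\mathcal{U}_{d,n-1}: p_i\ne e_0\ \forall i\}$ and $\psi:\mathcal{V}\to T_{d,n}^\circ$, $\psi(p_1,\dots,p_{n-1})=[(p_1,\dots,p_{n-1},e_0)]_{G_d}$, whose fibers are $\mathbb{C}^*$-orbits; the closures in $(\mathbb{P}^d)^{n-1}$ of these orbits all have the same class $\gamma\in H_2((\mathbb{P}^d)^{n-1},\mathbb{Z})$. Let $\operatorname{Chow}((\mathbb{P}^d)^{n-1},\gamma)$ be the Chow variety of effective cycles of class $\gamma$. The map $\rho^\circ:T_{d,n}^\circ\to\operatorname{Chow}((\mathbb{P}^d)^{n-1},\gamma)$, $x\mapsto\overline{\psi^{-1}(x)}$, is a morphism, and $(\mathbb{P}^d)^{n-1}/\!\!/_{Ch}\mathbb{C}^*$ is the closure of its image (with reduced structure). It is known that $\rho^\circ$ extends (uniquely) to a morphism $\rho$ on $T_{d,n}^{LM}$. *)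

theory Defs
  imports
    "HOL-Analysis.Abstract_Topology"
    "HOL-Library.Poly_Mapping"
    "HOL-Library.Extended_Nat"
    "HOL-Computational_Algebra.Factorial_Ring"
    "Jordan_Normal_Form.Determinant"
begin

no_notation eq_closure_of (\<open>closure'_of\<index>\<close>)

section \<open>Polynomials in arbitrary families of variables\<close>

type_synonym 'v cpoly = "('v \<Rightarrow>\<^sub>0 nat) \<Rightarrow>\<^sub>0 complex"

definition Var :: "'v \<Rightarrow> 'v cpoly" where
  "Var v = Poly_Mapping.single (Poly_Mapping.single v 1) 1"

definition mon_eval :: "('v \<Rightarrow>\<^sub>0 nat) \<Rightarrow> ('v \<Rightarrow> complex) \<Rightarrow> complex" where
  "mon_eval m x = (\<Prod>v\<in>Poly_Mapping.keys m. x v ^ Poly_Mapping.lookup m v)"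

definition peval :: "'v cpoly \<Rightarrow> ('v \<Rightarrow> complex) \<Rightarrow> complex" where
  "peval F x = (\<Sum>m\<in>Poly_Mapping.keys F. Poly_Mapping.lookup F m * mon_eval m x)"

definition mon_degree :: "('v \<Rightarrow>\<^sub>0 nat) \<Rightarrow> nat" where
  "mon_degree m = (\<Sum>v\<in>Poly_Mapping.keys m. Poly_Mapping.lookup m v)"

definition homogeneous :: "nat \<Rightarrow> 'v cpoly \<Rightarrow> bool" where
  "homogeneous e F \<longleftrightarrow> (\<forall>m\<in>Poly_Mapping.keys F. mon_degree m = e)"

definition poly_vars :: "'v cpoly \<Rightarrow> 'v set" where
  "poly_vars F = (\<Union>m\<in>Poly_Mapping.keys F. Poly_Mapping.keys m)"


section \<open>Projective spaces and the Zariski topology\<close>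

text \<open>A point of projective space is a punctured line, i.e. the set of all its homogeneous
  coordinate vectors. For a finite set \<open>A\<close> of indices, \<open>pspace A\<close> is the projective space of
  dimension \<open>card A - 1\<close> with homogeneous coordinates indexed by \<open>A\<close>; the coordinates outside
  \<open>A\<close> are zero.\<close>

type_synonym 'i ppoint = "('i \<Rightarrow> complex) set"

definition hclass :: "('i \<Rightarrow> complex) \<Rightarrow> 'i ppoint" where
  "hclass x = {(\<lambda>i. c * x i) | c. c \<noteq> 0}"

definition supported :: "'i set \<Rightarrow> ('i \<Rightarrow> complex) \<Rightarrow> bool" where
  "supported A x \<longleftrightarrow> (\<forall>i. i \<notin> A \<longrightarrow> x i = 0)"

definition pspace :: "'i set \<Rightarrow> 'i ppoint set" where
  "pspace A = {hclass x | x. x \<noteq> (\<lambda>_. 0) \<and> supported A x}"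

definition pvanish :: "'i cpoly \<Rightarrow> 'i ppoint \<Rightarrow> bool" where
  "pvanish F p \<longleftrightarrow> (\<forall>x\<in>p. peval F x = 0)"

text \<open>The Zariski topology is put on all points with coordinates of a given index type at once.
  Each \<open>pspace A\<close> is closed in it (cut out by the coordinates outside \<open>A\<close>), and for finite \<open>A\<close>
  the induced topology is the usual Zariski topology of projective space.\<close>

definition zariski :: "'i ppoint topology" where
  "zariski = topology (\<lambda>U. \<exists>S. (\<forall>F\<in>S. \<exists>e. homogeneous e F) \<and>
                U = pspace UNIV - {p. \<forall>F\<in>S. pvanish F p})"

text \<open>The zero loci of families of homogeneous polynomials are the closed sets of a topology, so
  that \<open>zariski\<close> is indeed given by its defining predicate.\<close>

lemma mon_eval_superset:
  assumes "finite S" "Poly_Mapping.keys m \<subseteq> S"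
  shows "mon_eval m x = (\<Prod>v\<in>S. x v ^ Poly_Mapping.lookup m v)"
  unfolding mon_eval_def
  by (rule prod.mono_neutral_left) (use assms in \<open>auto simp: in_keys_iff\<close>)

lemma mon_eval_add: "mon_eval (m + m') x = mon_eval m x * mon_eval m' x"
proof -
  define S where "S = Poly_Mapping.keys m \<union> Poly_Mapping.keys m'"
  have S: "finite S" "Poly_Mapping.keys m \<subseteq> S" "Poly_Mapping.keys m' \<subseteq> S"
    "Poly_Mapping.keys (m + m') \<subseteq> S"
    using keys_add[of m m'] by (auto simp: S_def)
  show ?thesis
    by (simp add: mon_eval_superset[OF S(1) S(2)] mon_eval_superset[OF S(1) S(3)]
        mon_eval_superset[OF S(1) S(4)] lookup_add power_add prod.distrib)
qed

lemma mon_degree_add: "mon_degree (m + m') = mon_degree m + mon_degree m'"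
proof -
  have *: "mon_degree k = (\<Sum>v\<in>S. Poly_Mapping.lookup k v)"
    if "finite S" "Poly_Mapping.keys k \<subseteq> S" for k :: "'a \<Rightarrow>\<^sub>0 nat" and S
    unfolding mon_degree_def
    by (rule sum.mono_neutral_left) (use that in \<open>auto simp: in_keys_iff\<close>)
  define S where "S = Poly_Mapping.keys m \<union> Poly_Mapping.keys m'"
  have S: "finite S" "Poly_Mapping.keys m \<subseteq> S" "Poly_Mapping.keys m' \<subseteq> S"
    "Poly_Mapping.keys (m + m') \<subseteq> S"
    using keys_add[of m m'] by (auto simp: S_def)
  show ?thesis
    by (simp add: *[OF S(1) S(2)] *[OF S(1) S(3)] *[OF S(1) S(4)] lookup_add sum.distrib)
qed

lemma peval_superset:
  assumes "finite S" "Poly_Mapping.keys F \<subseteq> S"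
  shows "peval F x = (\<Sum>m\<in>S. Poly_Mapping.lookup F m * mon_eval m x)"
  unfolding peval_def
  by (rule sum.mono_neutral_left) (use assms in \<open>auto simp: in_keys_iff\<close>)

lemma peval_zero [simp]: "peval 0 x = 0"
  by (simp add: peval_def)

lemma peval_add: "peval (F + G) x = peval F x + peval G x"
proof -
  define S where "S = Poly_Mapping.keys F \<union> Poly_Mapping.keys G"
  have S: "finite S" "Poly_Mapping.keys F \<subseteq> S" "Poly_Mapping.keys G \<subseteq> S"
    "Poly_Mapping.keys (F + G) \<subseteq> S"
    using keys_add[of F G] by (auto simp: S_def)
  show ?thesis
    by (simp add: peval_superset[OF S(1) S(2)] peval_superset[OF S(1) S(3)]
        peval_superset[OF S(1) S(4)] lookup_add sum.distrib distrib_right)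
qed

lemma peval_sum: "peval (\<Sum>i\<in>I. F i) x = (\<Sum>i\<in>I. peval (F i) x)"
  by (induction I rule: infinite_finite_induct) (simp_all add: peval_add)

lemma peval_single: "peval (Poly_Mapping.single m c) x = c * mon_eval m x"
  by (cases "c = 0") (simp_all add: peval_def)

lemma cpoly_eq_sum:
  fixes F :: "'v cpoly"
  shows "F = (\<Sum>m\<in>Poly_Mapping.keys F. Poly_Mapping.single m (Poly_Mapping.lookup F m))"
proof (rule poly_mapping_eqI)
  fix k
  have "(\<Sum>m\<in>Poly_Mapping.keys F. Poly_Mapping.lookup F m when m = k) = Poly_Mapping.lookup F k"
    by (cases "k \<in> Poly_Mapping.keys F")
       (auto simp: when_def in_keys_iff sum.delta' cong: if_cong)
  thus "Poly_Mapping.lookup F k = Poly_Mapping.lookup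
     (\<Sum>m\<in>Poly_Mapping.keys F. Poly_Mapping.single m (Poly_Mapping.lookup F m)) k"
    by (simp add: lookup_sum lookup_single)
qed

lemma peval_mult: "peval (F * G) x = peval F x * peval G x"
proof -
  have "F * G = (\<Sum>m\<in>Poly_Mapping.keys F. \<Sum>m'\<in>Poly_Mapping.keys G.
      Poly_Mapping.single (m + m') (Poly_Mapping.lookup F m * Poly_Mapping.lookup G m'))"
    by (subst (1) cpoly_eq_sum[of F], subst (1) cpoly_eq_sum[of G])
       (simp add: sum_product mult_single)
  hence "peval (F * G) x = (\<Sum>m\<in>Poly_Mapping.keys F. \<Sum>m'\<in>Poly_Mapping.keys G.
      (Poly_Mapping.lookup F m * Poly_Mapping.lookup G m') * (mon_eval m x * mon_eval m' x))"
    by (simp add: peval_sum peval_single mon_eval_add)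
  also have "\<dots> = peval F x * peval G x"
    by (simp add: peval_def sum_product mult_ac)
  finally show ?thesis .
qed

lemma homogeneous_mult:
  assumes "homogeneous e F" "homogeneous e' G"
  shows "homogeneous (e + e') (F * G)"
  using assms keys_mult[of F G] by (fastforce simp: homogeneous_def mon_degree_add)

lemma mon_eval_scale: "mon_eval m (\<lambda>i. c * x i) = c ^ mon_degree m * mon_eval m x"
  by (simp add: mon_eval_def mon_degree_def power_mult_distrib prod.distrib power_sum)

lemma peval_scale:
  assumes "homogeneous e F"
  shows "peval F (\<lambda>i. c * x i) = c ^ e * peval F x"
proof -
  have "peval F (\<lambda>i. c * x i) =
      (\<Sum>m\<in>Poly_Mapping.keys F. c ^ e * (Poly_Mapping.lookup F m * mon_eval m x))"
    unfolding peval_def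
    by (rule sum.cong) (use assms in \<open>auto simp: mon_eval_scale homogeneous_def mult_ac\<close>)
  thus ?thesis by (simp add: peval_def sum_distrib_left)
qed

lemma pvanish_hclass:
  assumes "homogeneous e F"
  shows "pvanish F (hclass x) \<longleftrightarrow> peval F x = 0"
proof
  assume "pvanish F (hclass x)"
  moreover have "x \<in> hclass x" by (auto simp: hclass_def intro: exI[of _ 1])
  ultimately show "peval F x = 0" by (auto simp: pvanish_def)
qed (use peval_scale[OF assms] in \<open>auto simp: pvanish_def hclass_def\<close>)

lemma pvanish_mult:
  assumes "homogeneous e F" "homogeneous e' G" "p \<in> pspace UNIV"
  shows "pvanish (F * G) p \<longleftrightarrow> pvanish F p \<or> pvanish G p"
proof -
  obtain x where p: "p = hclass x" using assms(3) unfolding pspace_def by blast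
  show ?thesis
    unfolding p pvanish_hclass[OF assms(1)] pvanish_hclass[OF assms(2)]
      pvanish_hclass[OF homogeneous_mult[OF assms(1,2)]] peval_mult
    by (rule mult_eq_0_iff)
qed

definition zar_open :: "'i ppoint set \<Rightarrow> bool" where
  "zar_open U \<longleftrightarrow> (\<exists>S. (\<forall>F\<in>S. \<exists>e. homogeneous e F) \<and>
                U = pspace UNIV - {p. \<forall>F\<in>S. pvanish F p})"

lemma istopology_zar_open: "istopology (zar_open :: 'i ppoint set \<Rightarrow> bool)"
  unfolding istopology_def
proof (intro conjI allI impI)
  fix U V :: "'i ppoint set"
  assume "zar_open U" "zar_open V"
  then obtain S S' where S: "\<forall>F\<in>S. \<exists>e. homogeneous e F" "\<forall>F\<in>S'. \<exists>e. homogeneous e F"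
    and U: "U = pspace UNIV - {p. \<forall>F\<in>S. pvanish F p}"
    and V: "V = pspace UNIV - {p. \<forall>F\<in>S'. pvanish F p}"
    unfolding zar_open_def by blast
  define Q where "Q = {F * G | F G. F \<in> S \<and> G \<in> S'}"
  have "\<forall>F\<in>Q. \<exists>e. homogeneous e F"
  proof
    fix H assume "H \<in> Q"
    then obtain F G where H: "H = F * G" "F \<in> S" "G \<in> S'" unfolding Q_def by blast
    obtain e e' where "homogeneous e F" "homogeneous e' G" using S H(2,3) by meson
    hence "homogeneous (e + e') H" unfolding H(1) by (rule homogeneous_mult)
    thus "\<exists>e. homogeneous e H" ..
  qed
  moreover have "U \<inter> V = pspace UNIV - {p. \<forall>F\<in>Q. pvanish F p}"
  proof -
    have "(\<forall>H\<in>Q. pvanish H p) \<longleftrightarrow> (\<forall>F\<in>S. pvanish F p) \<or> (\<forall>F\<in>S'. pvanish F p)"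
      if p: "p \<in> pspace UNIV" for p
    proof -
      have *: "pvanish (F * G) p \<longleftrightarrow> pvanish F p \<or> pvanish G p" if FG: "F \<in> S" "G \<in> S'" for F G
      proof -
        obtain e e' where "homogeneous e F" "homogeneous e' G" using S FG by meson
        thus ?thesis using p by (rule pvanish_mult)
      qed
      have "(\<forall>H\<in>Q. pvanish H p) \<longleftrightarrow> (\<forall>F\<in>S. \<forall>G\<in>S'. pvanish (F * G) p)"
        unfolding Q_def by auto
      also have "\<dots> \<longleftrightarrow> (\<forall>F\<in>S. \<forall>G\<in>S'. pvanish F p \<or> pvanish G p)"
        using * by simp
      finally show ?thesis by metis
    qed
    thus ?thesis unfolding U V set_eq_iff Int_iff Diff_iff mem_Collect_eq by metis
  qed
  ultimately show "zar_open (U \<inter> V)"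
    unfolding zar_open_def by (intro exI[of _ Q] conjI)
next
  fix K :: "'i ppoint set set"
  assume "\<forall>U\<in>K. zar_open U"
  hence "\<forall>U\<in>K. \<exists>S. (\<forall>F\<in>S. \<exists>e. homogeneous e F) \<and>
      U = pspace UNIV - {p. \<forall>F\<in>S. pvanish F p}"
    by (simp only: zar_open_def)
  from bchoice[OF this] obtain S where S: "\<forall>U\<in>K. (\<forall>F\<in>S U. \<exists>e. homogeneous e F) \<and>
      U = pspace UNIV - {p. \<forall>F\<in>S U. pvanish F p}" ..
  have "(\<forall>F\<in>\<Union>(S ` K). \<exists>e. homogeneous e F)"
  proof
    fix F assume "F \<in> \<Union>(S ` K)"
    then obtain U where "U \<in> K" "F \<in> S U" by (elim UN_E)
    thus "\<exists>e. homogeneous e F" using bspec[OF S] by simp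
  qed
  moreover have "\<Union>K = pspace UNIV - {p. \<forall>F\<in>\<Union>(S ` K). pvanish F p}"
  proof -
    have "\<Union>K = (\<Union>U\<in>K. pspace UNIV - {p. \<forall>F\<in>S U. pvanish F p})"
      by (subst image_ident[symmetric], intro SUP_cong refl) (use S in simp)
    also have "\<dots> = pspace UNIV - {p. \<forall>F\<in>\<Union>(S ` K). pvanish F p}"
      by auto
    finally show ?thesis .
  qed
  ultimately show "zar_open (\<Union>K)"
    unfolding zar_open_def by (intro exI[of _ "\<Union>(S ` K)"] conjI)
qed

lemma openin_zariski:
  fixes U :: "'i ppoint set"
  shows "openin zariski U \<longleftrightarrow> (\<exists>S. (\<forall>F\<in>S. \<exists>e. homogeneous e F) \<and>
                U = pspace UNIV - {p. \<forall>F\<in>S. pvanish F p})"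
proof -
  have "(zariski :: 'i ppoint topology) = topology zar_open"
    unfolding zariski_def zar_open_def by (rule refl)
  moreover have "openin (topology zar_open) = (zar_open :: 'i ppoint set \<Rightarrow> bool)"
    by (rule topology_inverse'[OF istopology_zar_open])
  ultimately have "openin zariski U = zar_open U" by (simp only:)
  thus ?thesis by (simp add: zar_open_def)
qed

lemma topspace_zariski: "topspace zariski = (pspace UNIV :: 'i ppoint set)"
proof
  have h: "homogeneous 0 (1 :: 'i cpoly)"
    by (simp add: homogeneous_def mon_degree_def)
  have "\<not> pvanish 1 p" if p: "p \<in> pspace UNIV" for p :: "'i ppoint"
  proof -
    obtain x where "p = hclass x" using p unfolding pspace_def by blast
    moreover have "peval 1 x = 1" by (simp add: peval_def mon_eval_def)
    ultimately show ?thesis by (simp add: pvanish_hclass[OF h])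
  qed
  hence "pspace UNIV = pspace UNIV - {p :: 'i ppoint. \<forall>F\<in>{1}. pvanish F p}" by auto
  hence "openin zariski (pspace UNIV :: 'i ppoint set)"
    unfolding openin_zariski using h by (intro exI[of _ "{1}"]) auto
  thus "(pspace UNIV :: 'i ppoint set) \<subseteq> topspace zariski" by (rule openin_subset)
  have "openin zariski (topspace zariski :: 'i ppoint set)" by (rule openin_topspace)
  then obtain S :: "'i cpoly set"
    where "topspace zariski = pspace UNIV - {p. \<forall>F\<in>S. pvanish F p}"
    unfolding openin_zariski by (elim exE conjE)
  thus "topspace zariski \<subseteq> (pspace UNIV :: 'i ppoint set)" by (simp only: Diff_subset)
qed

definition irreducible_in :: "'a topology \<Rightarrow> 'a set \<Rightarrow> bool" where
  "irreducible_in T S \<longleftrightarrow> S \<subseteq> topspace T \<and> S \<noteq> {} \<and>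
     (\<forall>A B. closedin T A \<longrightarrow> closedin T B \<longrightarrow> S \<subseteq> A \<union> B \<longrightarrow> S \<subseteq> A \<or> S \<subseteq> B)"

definition krull_dim :: "'a topology \<Rightarrow> enat" where
  "krull_dim T = Sup {enat k | k. \<exists>Z. (\<forall>i\<le>k. closedin T (Z i) \<and> irreducible_in T (Z i)) \<and>
                                     (\<forall>i<k. Z i \<subset> Z (Suc i))}"


section \<open>Quasi-projective varieties, morphisms, normalization\<close>

abbreviation zar :: "'i ppoint set \<Rightarrow> 'i ppoint topology" where
  "zar X \<equiv> subtopology zariski X"

definition variety :: "'i ppoint set \<Rightarrow> bool" where
  "variety X \<longleftrightarrow> (\<exists>A. finite A \<and> X \<subseteq> pspace A) \<and>
     (\<exists>U C. openin zariski U \<and> closedin zariski C \<and> X = U \<inter> C) \<and>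
     irreducible_in zariski X"

definition regular_on :: "'i ppoint set \<Rightarrow> ('i ppoint \<Rightarrow> complex) \<Rightarrow> bool" where
  "regular_on U f \<longleftrightarrow> (\<forall>p\<in>U. \<exists>W e F G. openin zariski W \<and> p \<in> W \<and>
     homogeneous e F \<and> homogeneous e G \<and>
     (\<forall>q\<in>W \<inter> U. \<forall>x\<in>q. peval G x \<noteq> 0 \<and> f q = peval F x / peval G x))"

definition morphism :: "'i ppoint set \<Rightarrow> 'j ppoint set \<Rightarrow> ('i ppoint \<Rightarrow> 'j ppoint) \<Rightarrow> bool" where
  "morphism X Y f \<longleftrightarrow> continuous_map (zar X) (zar Y) f \<and>
     (\<forall>V g. openin (zar Y) V \<longrightarrow> regular_on V g \<longrightarrow> regular_on (X \<inter> f -` V) (g \<circ> f))"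

definition isomorphism :: "'i ppoint set \<Rightarrow> 'j ppoint set \<Rightarrow> ('i ppoint \<Rightarrow> 'j ppoint) \<Rightarrow> bool" where
  "isomorphism X Y f \<longleftrightarrow> morphism X Y f \<and>
     (\<exists>g. morphism Y X g \<and> (\<forall>p\<in>X. g (f p) = p) \<and> (\<forall>q\<in>Y. f (g q) = q))"

text \<open>\<open>affine_chart k\<close> is affine \<open>k\<close>-space, the complement of the hyperplane where the
  zeroth coordinate vanishes.\<close>

definition affine_chart :: "nat \<Rightarrow> nat ppoint set" where
  "affine_chart k = {p \<in> pspace {0..k}. \<forall>x\<in>p. x 0 \<noteq> 0}"

definition affine :: "'i ppoint set \<Rightarrow> bool" where
  "affine X \<longleftrightarrow> (\<exists>k Z f. closedin (zar (affine_chart k)) Z \<and> isomorphism X Z f)"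

definition finite_morphism ::
  "'i ppoint set \<Rightarrow> 'j ppoint set \<Rightarrow> ('i ppoint \<Rightarrow> 'j ppoint) \<Rightarrow> bool" where
  "finite_morphism X Y f \<longleftrightarrow> morphism X Y f \<and>
     (\<forall>q\<in>Y. \<exists>V. openin (zar Y) V \<and> q \<in> V \<and> affine V \<and> affine (X \<inter> f -` V) \<and>
        (\<exists>S. finite S \<and> (\<forall>s\<in>S. regular_on (X \<inter> f -` V) s) \<and>
           (\<forall>g. regular_on (X \<inter> f -` V) g \<longrightarrow>
              (\<exists>c. (\<forall>s\<in>S. regular_on V (c s)) \<and>
                   (\<forall>p\<in>X \<inter> f -` V. g p = (\<Sum>s\<in>S. c s (f p) * s p))))))"

definition birational_morphism ::
  "'i ppoint set \<Rightarrow> 'j ppoint set \<Rightarrow> ('i ppoint \<Rightarrow> 'j ppoint) \<Rightarrow> bool" where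
  "birational_morphism X Y f \<longleftrightarrow> morphism X Y f \<and>
     (\<exists>U V. openin (zar X) U \<and> U \<noteq> {} \<and> openin (zar Y) V \<and> V \<noteq> {} \<and> isomorphism U V f)"

text \<open>All local rings are integrally closed in the function field: a rational function, regular
  on the nonempty open set \<open>U\<close>, that satisfies a monic equation with coefficients in the local
  ring at \<open>p\<close> is itself in that local ring. Elements of the local ring at \<open>p\<close> are represented by
  regular functions on open neighbourhoods \<open>W\<close>, \<open>W'\<close> of \<open>p\<close>.\<close>

definition normal_variety :: "'i ppoint set \<Rightarrow> bool" where
  "normal_variety X \<longleftrightarrow> variety X \<and>
     (\<forall>p\<in>X. \<forall>U f W k a.
        openin (zar X) U \<longrightarrow> U \<noteq> {} \<longrightarrow> regular_on U f \<longrightarrow>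
        openin (zar X) W \<longrightarrow> p \<in> W \<longrightarrow> (\<forall>j<k. regular_on W (a j)) \<longrightarrow>
        (\<forall>q\<in>U \<inter> W. f q ^ k + (\<Sum>j<k. a j q * f q ^ j) = 0) \<longrightarrow>
        (\<exists>W' g. openin (zar X) W' \<and> p \<in> W' \<and> regular_on W' g \<and> (\<forall>q\<in>U \<inter> W'. g q = f q)))"

definition normalization ::
  "'i ppoint set \<Rightarrow> 'j ppoint set \<Rightarrow> ('i ppoint \<Rightarrow> 'j ppoint) \<Rightarrow> bool" where
  "normalization N Y \<pi> \<longleftrightarrow> normal_variety N \<and> finite_morphism N Y \<pi> \<and> birational_morphism N Y \<pi>"


section \<open>Blow-ups of projective spaces\<close>

text \<open>Let \<open>F j\<close>, for \<open>j\<close> in the finite set \<open>J\<close>, be homogeneous of the same degree and generate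
  the ideal sheaf \<open>\<I>\<close> on \<open>pspace A\<close>. Then the blow-up along \<open>\<I>\<close>, i.e. Proj of the Rees
  algebra of \<open>\<I>\<close>, is the closure in \<open>pspace A \<times> pspace J\<close> of the graph of the rational map
  \<open>[F j]\<close>. The product of projective spaces is taken in its Segre embedding.\<close>

definition blowup_point :: "'j set \<Rightarrow> ('j \<Rightarrow> 'i cpoly) \<Rightarrow> ('i \<Rightarrow> complex) \<Rightarrow> ('i \<times> 'j) ppoint" where
  "blowup_point J F x = hclass (\<lambda>(i, j). if j \<in> J then x i * peval (F j) x else 0)"

definition blowup :: "'i set \<Rightarrow> 'j set \<Rightarrow> ('j \<Rightarrow> 'i cpoly) \<Rightarrow> ('i \<times> 'j) ppoint set" where
  "blowup A J F = zariski closure_of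
     {blowup_point J F x | x. x \<noteq> (\<lambda>_. 0) \<and> supported A x \<and> (\<exists>j\<in>J. peval (F j) x \<noteq> 0)}"

definition LM_coords :: "nat \<Rightarrow> nat \<Rightarrow> (nat \<times> nat) set" where
  "LM_coords d n = {1..n-1} \<times> {1..d}"

definition LM_index_sets :: "nat \<Rightarrow> nat set set" where
  "LM_index_sets n = {I. I \<subset> {1..n} \<and> n \<in> I \<and> 2 \<le> card I \<and> card I \<le> n - 1}"

text \<open>The ideal sheaf of \<open>\<delta>\<close> for \<open>I\<close> is generated by the coordinates \<open>x\<^sub>i\<^sub>k\<close> with
  \<open>i \<in> I - {n}\<close>. Hence the product of all these ideal sheaves is generated by the products
  \<open>LM_gen n s\<close> formed by choosing one such coordinate \<open>s I\<close> for every \<open>I\<close>.\<close>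

definition LM_choices :: "nat \<Rightarrow> nat \<Rightarrow> (nat set \<Rightarrow> nat \<times> nat) set" where
  "LM_choices d n = Pi\<^sub>E (LM_index_sets n) (\<lambda>I. (I - {n}) \<times> {1..d})"

definition LM_gen :: "nat \<Rightarrow> (nat set \<Rightarrow> nat \<times> nat) \<Rightarrow> (nat \<times> nat) cpoly" where
  "LM_gen n s = (\<Prod>I\<in>LM_index_sets n. Var (s I))"

type_synonym LM_point = "((nat \<times> nat) \<times> (nat set \<Rightarrow> nat \<times> nat)) ppoint"

definition T_LM :: "nat \<Rightarrow> nat \<Rightarrow> LM_point set" where
  "T_LM d n = blowup (LM_coords d n) (LM_choices d n) (LM_gen n)"

text \<open>The point of the blow-up over \<open>[x]\<close>, for \<open>[x]\<close> outside the blown-up loci.\<close>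

definition LM_over :: "nat \<Rightarrow> nat \<Rightarrow> (nat \<times> nat \<Rightarrow> complex) \<Rightarrow> LM_point" where
  "LM_over d n x = blowup_point (LM_choices d n) (LM_gen n) x"


section \<open>Products of projective spaces\<close>

text \<open>Points of \<open>(\<P>\<^sup>d)\<^sup>m\<close> are extensional functions on \<open>{1..m}\<close>; the Zariski topology is
  induced by the Segre embedding, whose coordinates are indexed by the multi-indices
  \<open>{1..m} \<rightarrow>\<^sub>E {0..d}\<close>.\<close>

type_synonym ptuple = "nat \<Rightarrow> nat ppoint"

definition prod_space :: "nat \<Rightarrow> nat \<Rightarrow> ptuple set" where
  "prod_space d m = {1..m} \<rightarrow>\<^sub>E pspace {0..d}"

definition multi_idx :: "nat \<Rightarrow> nat \<Rightarrow> (nat \<Rightarrow> nat) set" where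
  "multi_idx d m = {1..m} \<rightarrow>\<^sub>E {0..d}"

definition segre :: "nat \<Rightarrow> nat \<Rightarrow> ptuple \<Rightarrow> (nat \<Rightarrow> nat) ppoint" where
  "segre d m p =
     hclass (\<lambda>k. if k \<in> multi_idx d m then \<Prod>i\<in>{1..m}. (SOME x. x \<in> p i) (k i) else 0)"

definition prod_zariski :: "nat \<Rightarrow> nat \<Rightarrow> ptuple topology" where
  "prod_zariski d m = pullback_topology (prod_space d m) (segre d m) zariski"


section \<open>The open moduli space\<close>

definition hyp_H :: "nat \<Rightarrow> nat ppoint set" where
  "hyp_H d = {p \<in> pspace {0..d}. \<forall>x\<in>p. x 0 = 0}"

definition e_zero :: "nat ppoint" where
  "e_zero = hclass (\<lambda>i. if i = 0 then 1 else 0)"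

definition mat_act :: "nat \<Rightarrow> complex mat \<Rightarrow> nat ppoint \<Rightarrow> nat ppoint" where
  "mat_act d g p = (\<lambda>x i. if i \<le> d then \<Sum>j\<in>{0..d}. g $$ (i, j) * x j else 0) ` p"

definition G_group :: "nat \<Rightarrow> complex mat set" where
  "G_group d = {g \<in> carrier_mat (d + 1) (d + 1). det g = 1 \<and> (\<forall>p\<in>hyp_H d. mat_act d g p = p)}"

definition U_space :: "nat \<Rightarrow> nat \<Rightarrow> ptuple set" where
  "U_space d m = {q \<in> prod_space d m. inj_on q {1..m} \<and> (\<forall>i\<in>{1..m}. q i \<notin> hyp_H d)}"

definition G_orbit :: "nat \<Rightarrow> nat \<Rightarrow> ptuple \<Rightarrow> ptuple set" where
  "G_orbit d m q = {(\<lambda>i\<in>{1..m}. mat_act d g (q i)) | g. g \<in> G_group d}"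

definition T_open :: "nat \<Rightarrow> nat \<Rightarrow> ptuple set set" where
  "T_open d n = G_orbit d n ` U_space d n"

text \<open>The configuration \<open>([1:x\<^sub>1], \<dots>, [1:x\<^sub>n\<^sub>-\<^sub>1], e\<^sub>0)\<close>. The open embedding of \<open>T_open d n\<close>
  into projective space corresponds to \<open>[x] \<mapsto> G_orbit d n (configuration d n x)\<close>, on the set
  of those \<open>x\<close> for which the configuration lies in \<open>U_space d n\<close>.\<close>

definition configuration :: "nat \<Rightarrow> nat \<Rightarrow> (nat \<times> nat \<Rightarrow> complex) \<Rightarrow> ptuple" where
  "configuration d n x = (\<lambda>i\<in>{1..n}. if i = n then e_zero
     else hclass (\<lambda>k. if k = 0 then 1 else if k \<le> d then x (i, k) else 0))"

definition V_space :: "nat \<Rightarrow> nat \<Rightarrow> ptuple set" where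
  "V_space d n = {p \<in> U_space d (n - 1). \<forall>i\<in>{1..n-1}. p i \<noteq> e_zero}"

definition psi :: "nat \<Rightarrow> nat \<Rightarrow> ptuple \<Rightarrow> ptuple set" where
  "psi d n p = G_orbit d n (p(n := e_zero))"

definition orbit_closure :: "nat \<Rightarrow> nat \<Rightarrow> ptuple set \<Rightarrow> ptuple set" where
  "orbit_closure d n \<omega> = prod_zariski d (n - 1) closure_of {p \<in> V_space d n. psi d n p = \<omega>}"


section \<open>The Chow variety and the Chow quotient\<close>

definition curves :: "nat \<Rightarrow> nat \<Rightarrow> ptuple set set" where
  "curves d m = {C. closedin (prod_zariski d m) C \<and> irreducible_in (prod_zariski d m) C \<and>
                    krull_dim (subtopology (prod_zariski d m) C) = 1}"

type_synonym cycle = "ptuple set \<Rightarrow>\<^sub>0 nat"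

definition effective_cycles :: "nat \<Rightarrow> nat \<Rightarrow> cycle set" where
  "effective_cycles d m = {Z. Poly_Mapping.keys Z \<subseteq> curves d m}"

text \<open>The degree of the \<open>i\<close>-th hyperplane class on a curve: its number of intersection points
  with the preimage of a general hyperplane of the \<open>i\<close>-th factor.\<close>

definition curve_degree :: "nat \<Rightarrow> ptuple set \<Rightarrow> nat \<Rightarrow> nat" where
  "curve_degree d C i = (THE k. \<exists>W. openin (zar (pspace {0..d})) W \<and> W \<noteq> {} \<and>
     (\<forall>h\<in>W. let S = {p \<in> C. \<forall>u\<in>h. \<forall>x\<in>p i. (\<Sum>j\<in>{0..d}. u j * x j) = 0}
             in finite S \<and> card S = k))"

text \<open>By the Kuenneth formula, \<open>H\<^sub>2((\<P>\<^sup>d)\<^sup>m, \<int>) = \<int>\<^sup>m\<close> by pairing with the hyperplane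
  classes of the \<open>m\<close> factors. The class of a cycle is recorded through this isomorphism.\<close>

definition cycle_class :: "nat \<Rightarrow> nat \<Rightarrow> cycle \<Rightarrow> nat \<Rightarrow> nat" where
  "cycle_class d m Z = (\<lambda>i. if i \<in> {1..m}
     then \<Sum>C\<in>Poly_Mapping.keys Z. Poly_Mapping.lookup Z C * curve_degree d C i else 0)"

text \<open>The Chow form of an irreducible curve \<open>C\<close> in \<open>pspace A\<close>: the irreducible polynomial,
  unique up to a scalar, in the coefficients of two linear forms (tagged by \<open>False\<close> and \<open>True\<close>)
  that vanishes iff the two hyperplanes have a common point on \<open>C\<close>.\<close>

definition is_chow_form :: "'i set \<Rightarrow> 'i ppoint set \<Rightarrow> (bool \<times> 'i) cpoly \<Rightarrow> bool" where
  "is_chow_form A C R \<longleftrightarrow> irreducible R \<and> poly_vars R \<subseteq> UNIV \<times> A \<and>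
     (\<forall>u. supported (UNIV \<times> A) u \<longrightarrow>
        (peval R u = 0 \<longleftrightarrow> (\<exists>p\<in>C. \<forall>x\<in>p. \<forall>b. (\<Sum>a\<in>A. u (b, a) * x a) = 0)))"

definition chow_form :: "'i set \<Rightarrow> 'i ppoint set \<Rightarrow> (bool \<times> 'i) cpoly" where
  "chow_form A C = (SOME R. is_chow_form A C R)"

text \<open>The Chow point of a cycle is its Chow form, a polynomial up to scalar, viewed as a point of
  the projective space whose coordinates are the coefficients.\<close>

type_synonym chow_pt = "((bool \<times> (nat \<Rightarrow> nat)) \<Rightarrow>\<^sub>0 nat) ppoint"

definition chow_point :: "nat \<Rightarrow> nat \<Rightarrow> cycle \<Rightarrow> chow_pt" where
  "chow_point d m Z = hclass (Poly_Mapping.lookup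
     (\<Prod>C\<in>Poly_Mapping.keys Z.
        chow_form (multi_idx d m) (segre d m ` C) ^ Poly_Mapping.lookup Z C))"

definition chow_variety :: "nat \<Rightarrow> nat \<Rightarrow> (nat \<Rightarrow> nat) \<Rightarrow> chow_pt set" where
  "chow_variety d m \<gamma> = {chow_point d m Z | Z. Z \<in> effective_cycles d m \<and> cycle_class d m Z = \<gamma>}"

definition orbit_class :: "nat \<Rightarrow> nat \<Rightarrow> nat \<Rightarrow> nat" where
  "orbit_class d n = (THE \<gamma>. \<forall>\<omega>\<in>T_open d n.
     cycle_class d (n - 1) (Poly_Mapping.single (orbit_closure d n \<omega>) 1) = \<gamma>)"

definition rho_open :: "nat \<Rightarrow> nat \<Rightarrow> ptuple set \<Rightarrow> chow_pt" where
  "rho_open d n \<omega> = chow_point d (n - 1) (Poly_Mapping.single (orbit_closure d n \<omega>) 1)"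

definition chow_quotient :: "nat \<Rightarrow> nat \<Rightarrow> chow_pt set" where
  "chow_quotient d n =
     zar (chow_variety d (n - 1) (orbit_class d n)) closure_of (rho_open d n ` T_open d n)"

definition extends_rho_open :: "nat \<Rightarrow> nat \<Rightarrow> (LM_point \<Rightarrow> chow_pt) \<Rightarrow> bool" where
  "extends_rho_open d n \<rho> \<longleftrightarrow>
     (\<forall>x. supported (LM_coords d n) x \<longrightarrow> configuration d n x \<in> U_space d n \<longrightarrow>
        \<rho> (LM_over d n x) = rho_open d n (G_orbit d n (configuration d n x)))"

end

theory Submission
  imports
    Defs
    "HOL-Computational_Algebra.Computational_Algebra"
    "HOL-Computational_Algebra.Field_as_Ring"
begin

text \<open>The morphism \<open>\<rho>\<close> has a left inverse on the Chow quotient. The closure of a generic orbit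
  is, in Segre coordinates, a rational normal curve spanned by vectors that depend monomially on
  the configuration \<open>x\<close>. Its Chow form is the resultant of two binary forms of degree
  \<open>n - 1\<close>, and the coefficients of that resultant are integers times monomials in \<open>x\<close>. Those on
  the staircase of the Sylvester matrix have integer factor \<open>\<plusminus>1\<close>; ratios of two of them recover the
  ratios of the coordinates of \<open>x\<close>, and, at every limit point, those of the coordinates with
  \<open>i \<in> I - {n}\<close> for each blown-up locus \<open>\<delta>\<close> of \<open>I\<close>. Hence the coordinates of the point of the
  blow-up are, locally on the Chow quotient, given by homogeneous polynomials in the Chow
  coordinates. Since the normalization is birational, the left inverse of \<open>\<rho>\<close> composed with it is
  inverse to the lifted morphism.\<close>

text \<open>Nothing is known about the cycle behind a limit point; only homogeneous polynomial
  relations between the Chow coordinates of generic orbit closures survive in the limit, so the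
  argument at the boundary is carried by such relations alone. Linear ones, between coordinates with
  the same monomial in \<open>x\<close>, show that some staircase coordinate is nonzero at every
  limit. Quadratic binomials then lead to a nonzero coordinate of maximal exponent norm, whose rows
  form a flag of partial labellings of \<open>{1..n-1}\<close>. Each flag gives a chart of the left
  inverse, and vanishing cross products glue the charts. The other obstacle is that
  \<open>chow_form\<close> is chosen among all irreducible polynomials with the right zeros. To pin
  it down up to a scalar, the resultant is shown to divide every polynomial that vanishes on the
  pairs of sections with a common root, by pseudo-division in a single constant term. The
  irreducibility of the resultant rests on the same divisibility.\<close>

lemma peval_one [simp]: "peval 1 x = 1"
  by (simp add: peval_def mon_eval_def)

lemma peval_const [simp]: "peval (Poly_Mapping.single 0 c) x = c"
  by (simp add: peval_single mon_eval_def)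

lemma peval_Var [simp]: "peval (Var v) x = x v"
  by (simp add: Var_def peval_single mon_eval_def)

lemma peval_uminus: "peval (- F) x = - peval F x"
proof -
  have "peval (- F) x + peval F x = 0" by (simp flip: peval_add)
  thus ?thesis by (simp add: eq_neg_iff_add_eq_0)
qed

lemma peval_diff: "peval (F - G) x = peval F x - peval G x"
  using peval_add[of F "- G" x] by (simp add: peval_uminus)

lemma peval_prod: "peval (\<Prod>i\<in>I. F i) x = (\<Prod>i\<in>I. peval (F i) x)"
  by (induction I rule: infinite_finite_induct) (simp_all add: peval_mult)

lemma peval_power: "peval (F ^ k) x = peval F x ^ k"
  by (induction k) (simp_all add: peval_mult)

lemma peval_cong:
  assumes "\<And>v. v \<in> poly_vars F \<Longrightarrow> x v = y v"
  shows "peval F x = peval F y"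
proof -
  have "x v = y v" if "m \<in> Poly_Mapping.keys F" "v \<in> Poly_Mapping.keys m" for m v
    using assms that by (auto simp: poly_vars_def)
  thus ?thesis unfolding peval_def mon_eval_def by (auto intro!: sum.cong prod.cong)
qed

lemma homogeneous_0 [simp]: "homogeneous e 0"
  by (simp add: homogeneous_def)

lemma homogeneous_add:
  assumes "homogeneous e F" "homogeneous e G"
  shows "homogeneous e (F + G)"
  using assms keys_add[of F G] by (auto simp: homogeneous_def)

lemma homogeneous_uminus: "homogeneous e F \<Longrightarrow> homogeneous e (- F)"
  by (auto simp: homogeneous_def in_keys_iff)

lemma homogeneous_diff:
  assumes "homogeneous e F" "homogeneous e G"
  shows "homogeneous e (F - G)"
  using homogeneous_add[OF assms(1) homogeneous_uminus[OF assms(2)]] by simp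

lemma homogeneous_sum: "(\<And>i. i \<in> I \<Longrightarrow> homogeneous e (F i)) \<Longrightarrow> homogeneous e (\<Sum>i\<in>I. F i)"
  by (induction I rule: infinite_finite_induct) (auto intro: homogeneous_add)

lemma homogeneous_const: "homogeneous 0 (Poly_Mapping.single 0 c)"
  by (simp add: homogeneous_def mon_degree_def)

lemma homogeneous_1: "homogeneous 0 1"
  using homogeneous_const[of 1] by simp

lemma homogeneous_Var: "homogeneous 1 (Var v)"
  by (simp add: homogeneous_def mon_degree_def Var_def)

lemma homogeneous_prod:
  "(\<And>i. i \<in> I \<Longrightarrow> homogeneous (e i) (F i)) \<Longrightarrow> homogeneous (\<Sum>i\<in>I. e i) (\<Prod>i\<in>I. F i)"
  by (induction I rule: infinite_finite_induct) (auto intro: homogeneous_mult homogeneous_1)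

lemma homogeneous_power: "homogeneous e F \<Longrightarrow> homogeneous (e * k) (F ^ k)"
  by (induction k) (auto intro: homogeneous_mult homogeneous_1)

lemma homogeneous_const_mult: "homogeneous e F \<Longrightarrow> homogeneous e (Poly_Mapping.single 0 c * F)"
  using homogeneous_mult[OF homogeneous_const] by fastforce

text \<open>Composition with a polynomial map; it pulls homogeneous conditions on the target of such
  a map back to its source.\<close>

definition psubst :: "'v cpoly \<Rightarrow> ('v \<Rightarrow> 'w cpoly) \<Rightarrow> 'w cpoly" where
  "psubst F G = (\<Sum>m\<in>Poly_Mapping.keys F. Poly_Mapping.single 0 (Poly_Mapping.lookup F m) *
     (\<Prod>v\<in>Poly_Mapping.keys m. G v ^ Poly_Mapping.lookup m v))"

lemma peval_psubst: "peval (psubst F G) y = peval F (\<lambda>v. peval (G v) y)"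
  by (simp add: psubst_def peval_sum peval_mult peval_prod peval_power)
     (simp add: peval_def mon_eval_def)

lemma homogeneous_psubst:
  assumes "homogeneous e F" "\<And>v. homogeneous e' (G v)"
  shows "homogeneous (e' * e) (psubst F G)"
  unfolding psubst_def
proof (intro homogeneous_sum homogeneous_const_mult)
  fix m assume "m \<in> Poly_Mapping.keys F"
  hence "e = mon_degree m" using assms(1) by (auto simp: homogeneous_def)
  thus "homogeneous (e' * e) (\<Prod>v\<in>Poly_Mapping.keys m. G v ^ Poly_Mapping.lookup m v)"
    unfolding mon_degree_def sum_distrib_left \<open>e = mon_degree m\<close>
    by (intro homogeneous_prod homogeneous_power assms)
qed

section \<open>Functions that are polynomial along lines\<close>

text \<open>Stands in for polynomial functions of arbitrarily many variables. It is stable under all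
  algebraic operations used below, and restriction to one well-chosen line reduces zero-product and
  density arguments to polynomials in a single variable.\<close>

definition line_poly :: "(('i \<Rightarrow> complex) \<Rightarrow> complex) \<Rightarrow> bool" where
  "line_poly f \<longleftrightarrow> (\<forall>p w. \<exists>g. \<forall>s. f (\<lambda>i. p i + s * w i) = poly g s)"

lemma line_polyI:
  assumes "\<And>p w. \<exists>g. \<forall>s. f (\<lambda>i. p i + s * w i) = poly g s"
  shows "line_poly f"
  using assms by (simp add: line_poly_def)

lemma line_polyE:
  assumes "line_poly f"
  obtains g where "\<And>s. f (\<lambda>i. p i + s * w i) = poly g s"
  using assms unfolding line_poly_def by meson

lemma line_polyD:
  assumes "line_poly f"
  shows "\<exists>g. \<forall>s. f (\<lambda>i. p i + s * w i) = poly g s"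
  using assms by (simp add: line_poly_def)

lemma line_poly_const: "line_poly (\<lambda>_. c)"
  by (rule line_polyI, rule exI[of _ "[:c:]"]) simp

lemma line_poly_coord: "line_poly (\<lambda>x. x i)"
proof (rule line_polyI)
  fix p w :: "'a \<Rightarrow> complex"
  show "\<exists>g. \<forall>s. p i + s * w i = poly g s" by (rule exI[of _ "[:p i, w i:]"]) simp
qed

lemma line_poly_add:
  assumes "line_poly f" "line_poly g" shows "line_poly (\<lambda>x. f x + g x)"
proof (rule line_polyI)
  fix p w
  obtain a where "\<And>s. f (\<lambda>i. p i + s * w i) = poly a s" using line_polyE[OF assms(1)] by blast
  moreover obtain b where "\<And>s. g (\<lambda>i. p i + s * w i) = poly b s" using line_polyE[OF assms(2)] by blast
  ultimately show "\<exists>h. \<forall>s. f (\<lambda>i. p i + s * w i) + g (\<lambda>i. p i + s * w i) = poly h s"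
    by (intro exI[of _ "a + b"]) simp
qed

lemma line_poly_mult:
  assumes "line_poly f" "line_poly g" shows "line_poly (\<lambda>x. f x * g x)"
proof (rule line_polyI)
  fix p w
  obtain a where "\<And>s. f (\<lambda>i. p i + s * w i) = poly a s" using line_polyE[OF assms(1)] by blast
  moreover obtain b where "\<And>s. g (\<lambda>i. p i + s * w i) = poly b s" using line_polyE[OF assms(2)] by blast
  ultimately show "\<exists>h. \<forall>s. f (\<lambda>i. p i + s * w i) * g (\<lambda>i. p i + s * w i) = poly h s"
    by (intro exI[of _ "a * b"]) simp
qed

lemma line_poly_uminus: "line_poly f \<Longrightarrow> line_poly (\<lambda>x. - f x)"
  using line_poly_mult[OF line_poly_const[of "-1"], of f] by simp

lemma line_poly_diff:
  "line_poly f \<Longrightarrow> line_poly g \<Longrightarrow> line_poly (\<lambda>x. f x - g x)"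
  using line_poly_add[OF _ line_poly_uminus, of f g] by simp

lemma line_poly_sum: "(\<And>i. i \<in> I \<Longrightarrow> line_poly (f i)) \<Longrightarrow> line_poly (\<lambda>x. \<Sum>i\<in>I. f i x)"
  by (induction I rule: infinite_finite_induct) (simp_all add: line_poly_const line_poly_add)

lemma line_poly_prod: "(\<And>i. i \<in> I \<Longrightarrow> line_poly (f i)) \<Longrightarrow> line_poly (\<lambda>x. \<Prod>i\<in>I. f i x)"
  by (induction I rule: infinite_finite_induct) (simp_all add: line_poly_const line_poly_mult)

lemma line_poly_power: "line_poly f \<Longrightarrow> line_poly (\<lambda>x. f x ^ k)"
  by (induction k) (simp_all add: line_poly_const line_poly_mult)

lemma line_poly_if: "line_poly f \<Longrightarrow> line_poly g \<Longrightarrow> line_poly (\<lambda>x. if b then f x else g x)"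
  by (cases b) simp_all

lemma line_poly_peval:
  "(\<And>v. line_poly (\<lambda>x. h v x)) \<Longrightarrow> line_poly (\<lambda>x. peval F (\<lambda>v. h v x))"
  unfolding peval_def mon_eval_def
  by (intro line_poly_sum line_poly_prod line_poly_mult line_poly_power line_poly_const)

text \<open>Join a point where \<open>f\<close> does not vanish to a point where \<open>g\<close>
  does not: on this line two nonzero one-variable polynomials would have product zero.\<close>

lemma line_poly_domain:
  assumes "line_poly f" "line_poly g" "\<And>x. f x = 0 \<or> g x = 0"
  shows "(\<forall>x. f x = 0) \<or> (\<forall>x. g x = 0)"
proof (rule ccontr)
  assume "\<not> ?thesis"
  then obtain p q where pq: "f p \<noteq> 0" "g q \<noteq> 0" by blast
  define w where "w = (\<lambda>i. q i - p i)"
  obtain a where a: "\<And>s. f (\<lambda>i. p i + s * w i) = poly a s" using line_polyE[OF assms(1)] by blast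
  obtain b where b: "\<And>s. g (\<lambda>i. p i + s * w i) = poly b s" using line_polyE[OF assms(2)] by blast
  have "poly (a * b) s = 0" for s
    using assms(3)[of "\<lambda>i. p i + s * w i"] by (simp flip: a b)
  hence "a * b = 0" using poly_all_0_iff_0 by blast
  moreover have "a \<noteq> 0" using a[of 0] pq by auto
  moreover have "b \<noteq> 0" using b[of 1] pq by (auto simp: w_def)
  ultimately show False by simp
qed

text \<open>The form in which density of a nonempty open set is used: \<open>\<delta>\<close> cuts
  out the bad locus, and \<open>x0\<close> shows that the locus is proper.\<close>

lemma line_poly_dense:
  assumes "line_poly f" "line_poly \<delta>" "\<delta> x0 \<noteq> 0" "\<And>x. \<delta> x \<noteq> 0 \<Longrightarrow> f x = 0"
  shows "f x = 0"
  using line_poly_domain[OF assms(1,2)] assms(3,4) by blast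

section \<open>Polynomials determined by their values, and their expansion in one variable\<close>

lemma base_digits_unique:
  fixes a b :: "nat \<Rightarrow> nat"
  assumes "\<And>i. i < n \<Longrightarrow> a i < B" "\<And>i. i < n \<Longrightarrow> b i < B"
    and "(\<Sum>i<n. a i * B ^ i) = (\<Sum>i<n. b i * B ^ i)" and "i < n"
  shows "a i = b i"
  using assms
proof (induction n arbitrary: a b i)
  case (Suc n)
  have split: "(\<Sum>i<Suc n. c i * B ^ i) = c 0 + B * (\<Sum>i<n. c (Suc i) * B ^ i)" for c
    by (simp add: sum.lessThan_Suc_shift sum_distrib_left algebra_simps del: sum.lessThan_Suc)
  have eq: "a 0 + B * (\<Sum>i<n. a (Suc i) * B ^ i) = b 0 + B * (\<Sum>i<n. b (Suc i) * B ^ i)"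
    using Suc.prems(3) unfolding split .
  have "a 0 = (a 0 + B * (\<Sum>i<n. a (Suc i) * B ^ i)) mod B" using Suc.prems(1)[of 0] by simp
  also have "\<dots> = b 0" unfolding eq using Suc.prems(2)[of 0] by simp
  finally have 0: "a 0 = b 0" .
  have "B > 0" using Suc.prems(1)[of 0] by simp
  hence "(\<Sum>i<n. a (Suc i) * B ^ i) = (\<Sum>i<n. b (Suc i) * B ^ i)" using eq 0 by simp
  from Suc.IH[of "\<lambda>i. a (Suc i)" "\<lambda>i. b (Suc i)", OF _ _ this] Suc.prems(1,2)
  have "a (Suc j) = b (Suc j)" if "j < n" for j using that by auto
  with 0 Suc.prems(4) show ?case by (cases i) auto
qed simp

text \<open>Kronecker substitution: the variables are replaced by powers of one indeterminate whose
  exponents are the powers of a base exceeding all degrees, so distinct monomials stay distinct.\<close>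

lemma peval_zero_imp_zero:
  assumes "\<And>x. peval F x = 0"
  shows "F = 0"
proof (rule ccontr)
  assume "F \<noteq> 0"
  then obtain m0 where m0: "m0 \<in> Poly_Mapping.keys F" by fastforce
  have "finite (poly_vars F)" by (simp add: poly_vars_def)
  then obtain idx n where idx: "bij_betw idx (poly_vars F) {..<n::nat}"
    using ex_bij_betw_finite_nat[of "poly_vars F"] atLeast0LessThan by metis
  define B where "B = Suc (\<Sum>m\<in>Poly_Mapping.keys F. \<Sum>v\<in>poly_vars F. Poly_Mapping.lookup m v)"
  have B: "Poly_Mapping.lookup m v < B" if "m \<in> Poly_Mapping.keys F" "v \<in> poly_vars F" for m v
  proof -
    have "Poly_Mapping.lookup m v \<le> (\<Sum>v\<in>poly_vars F. Poly_Mapping.lookup m v)"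
      using \<open>finite (poly_vars F)\<close> that by (intro member_le_sum) auto
    also have "\<dots> \<le> (\<Sum>m\<in>Poly_Mapping.keys F. \<Sum>v\<in>poly_vars F. Poly_Mapping.lookup m v)"
      using that by (intro member_le_sum[where f = "\<lambda>m. \<Sum>v\<in>poly_vars F. Poly_Mapping.lookup m v"]) auto
    finally show ?thesis by (simp add: B_def)
  qed
  define e where "e = (\<lambda>m. \<Sum>v\<in>poly_vars F. Poly_Mapping.lookup m v * B ^ idx v)"
  define nv where "nv = the_inv_into (poly_vars F) idx"
  have bij: "bij_betw nv {..<n} (poly_vars F)" unfolding nv_def by (rule bij_betw_the_inv_into[OF idx])
  have e_alt: "e m = (\<Sum>i<n. Poly_Mapping.lookup m (nv i) * B ^ i)" for m
    unfolding e_def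
    by (rule sum.reindex_bij_betw[OF bij, symmetric, THEN trans])
       (intro sum.cong refl, simp add: nv_def f_the_inv_into_f_bij_betw[OF idx])
  have inj: "m = m0" if m: "m \<in> Poly_Mapping.keys F" and "e m = e m0" for m
  proof (rule poly_mapping_eqI)
    fix v
    show "Poly_Mapping.lookup m v = Poly_Mapping.lookup m0 v"
    proof (cases "v \<in> poly_vars F")
      case True
      hence "v \<in> nv ` {..<n}" using bij unfolding bij_betw_def by blast
      then obtain i where i: "i < n" "nv i = v" by blast
      have "Poly_Mapping.lookup m (nv i) = Poly_Mapping.lookup m0 (nv i)"
        by (rule base_digits_unique[OF _ _ _ i(1)])
           (use B m m0 bij that in \<open>auto simp: bij_betw_def e_alt\<close>)
      thus ?thesis by (simp add: i)
    next
      case False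
      thus ?thesis using m m0 by (auto simp: poly_vars_def in_keys_iff)
    qed
  qed
  define g :: "complex poly" where "g = (\<Sum>m\<in>Poly_Mapping.keys F. monom (Poly_Mapping.lookup F m) (e m))"
  have "poly g s = 0" for s
  proof -
    have "mon_eval m (\<lambda>v. s ^ (B ^ idx v)) = s ^ e m" if "m \<in> Poly_Mapping.keys F" for m
    proof -
      have "mon_eval m (\<lambda>v. s ^ (B ^ idx v)) = (\<Prod>v\<in>poly_vars F. (s ^ (B ^ idx v)) ^ Poly_Mapping.lookup m v)"
        by (rule mon_eval_superset) (use that \<open>finite (poly_vars F)\<close> in \<open>auto simp: poly_vars_def\<close>)
      thus ?thesis by (simp add: e_def power_sum mult.commute flip: power_mult)
    qed
    hence "poly g s = peval F (\<lambda>v. s ^ (B ^ idx v))"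
      by (simp add: g_def poly_sum poly_monom peval_def)
    thus ?thesis using assms by simp
  qed
  hence "g = 0" using poly_all_0_iff_0 by blast
  hence "coeff g (e m0) = 0" by simp
  moreover have "coeff g (e m0) = (\<Sum>m\<in>Poly_Mapping.keys F. if m = m0 then Poly_Mapping.lookup F m else 0)"
  proof -
    have "coeff (monom (Poly_Mapping.lookup F m) (e m)) (e m0) = (if m = m0 then Poly_Mapping.lookup F m else 0)"
      if "m \<in> Poly_Mapping.keys F" for m
      using inj[OF that] by (cases "m = m0") auto
    thus ?thesis unfolding g_def coeff_sum by (rule sum.cong[OF refl])
  qed
  moreover have "\<dots> = Poly_Mapping.lookup F m0" using m0 by (subst sum.delta) auto
  ultimately show False using m0 by (simp add: in_keys_iff)
qed

lemma cpoly_eqI: "(\<And>x. peval F x = peval G x) \<Longrightarrow> F = G"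
  using peval_zero_imp_zero[of "F - G"] by (simp add: peval_diff)

text \<open>Group the monomials by their exponent at \<open>v\<close> and delete \<open>v\<close>
  from them. Independence of \<open>v\<close> is expressed by values at updated points, the form
  needed when \<open>v\<close> is later moved with all other variables frozen.\<close>

lemma ex_decomposition_in_variable:
  fixes F :: "'v cpoly"
  shows "\<exists>k C. (\<forall>x. peval F x = (\<Sum>i\<le>k. peval (C i) x * x v ^ i)) \<and>
           (\<forall>i x c. peval (C i) (x(v := c)) = peval (C i) x)"
proof -
  define k where "k = (\<Sum>m\<in>Poly_Mapping.keys F. Poly_Mapping.lookup m v)"
  define D where "D i = {m \<in> Poly_Mapping.keys F. Poly_Mapping.lookup m v = i}" for i
  define C where "C i = (\<Sum>m\<in>D i. Poly_Mapping.single (Poly_Mapping.update v 0 m) (Poly_Mapping.lookup F m))" for i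
  have upd: "mon_eval (Poly_Mapping.update v 0 m) x = (\<Prod>w\<in>Poly_Mapping.keys m - {v}. x w ^ Poly_Mapping.lookup m w)" for m x
    unfolding mon_eval_def by (intro prod.cong) (auto simp: in_keys_iff lookup_update split: if_splits)
  have upd': "mon_eval (Poly_Mapping.update v 0 m) x * x v ^ Poly_Mapping.lookup m v = mon_eval m x" for m x
  proof -
    have "mon_eval m x = (\<Prod>w\<in>insert v (Poly_Mapping.keys m). x w ^ Poly_Mapping.lookup m w)"
      by (rule mon_eval_superset) auto
    thus ?thesis by (simp add: prod.insert_remove upd mult.commute)
  qed
  have "peval F x = (\<Sum>i\<le>k. peval (C i) x * x v ^ i)" for x
  proof -
    have "(\<lambda>m. Poly_Mapping.lookup m v) ` Poly_Mapping.keys F \<subseteq> {..k}"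
      unfolding k_def by (auto intro: member_le_sum)
    hence "peval F x = (\<Sum>i\<le>k. \<Sum>m\<in>D i. Poly_Mapping.lookup F m * mon_eval m x)"
      unfolding peval_def D_def by (intro sum.group[symmetric]) auto
    also have "\<dots> = (\<Sum>i\<le>k. peval (C i) x * x v ^ i)"
    proof (intro sum.cong refl)
      fix i
      have "Poly_Mapping.lookup F m * mon_eval m x =
          Poly_Mapping.lookup F m * mon_eval (Poly_Mapping.update v 0 m) x * x v ^ i" if "m \<in> D i" for m
        using upd'[of m x] that by (simp add: D_def)
      thus "(\<Sum>m\<in>D i. Poly_Mapping.lookup F m * mon_eval m x) = peval (C i) x * x v ^ i"
        unfolding C_def peval_sum peval_single sum_distrib_right by (rule sum.cong[OF refl])
    qed
    finally show ?thesis .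
  qed
  moreover have "peval (C i) (x(v := c)) = peval (C i) x" for i x c
  proof -
    have "mon_eval (Poly_Mapping.update v 0 m) (x(v := c)) = mon_eval (Poly_Mapping.update v 0 m) x" for m
      unfolding upd by (rule prod.cong) auto
    thus ?thesis unfolding C_def peval_sum peval_single by simp
  qed
  ultimately show ?thesis by (intro exI[of _ k] exI[of _ C]) simp
qed

lemma not_dvd_one_if_root: "peval F x = 0 \<Longrightarrow> \<not> F dvd 1"
proof
  assume "peval F x = 0" "F dvd 1"
  then obtain G where G: "1 = F * G" unfolding dvd_def by blast
  have "peval 1 x = peval F x * peval G x" unfolding G by (rule peval_mult)
  thus False using \<open>peval F x = 0\<close> by simp
qed

text \<open>On each line through the origin an invertible polynomial restricts to a unit among the
  one-variable polynomials, hence to a constant, namely its value at the origin.\<close>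

lemma unit_imp_const:
  assumes "(F :: 'v cpoly) dvd 1"
  obtains c where "c \<noteq> 0" "F = Poly_Mapping.single 0 c"
proof -
  obtain G where G: "1 = F * G" using assms by (rule dvdE)
  have nz: "peval F x * peval G x = 1" for x

  proof -
    have "peval F x * peval G x = peval (F * G) x" by (simp add: peval_mult)
    also have "\<dots> = 1" unfolding G[symmetric] by simp
    finally show ?thesis .
  qed
  define c where "c = peval F (\<lambda>_. 0)"
  have F_c: "peval F x = c" for x
  proof -
    have lp: "line_poly (peval H)" for H :: "'v cpoly" using line_poly_peval[of "\<lambda>v x. x v" H, OF line_poly_coord] .
    obtain a where a: "\<And>s. peval F (\<lambda>i. 0 + s * x i) = poly a s"
      using lp[of F, unfolded line_poly_def, rule_format, of "\<lambda>_. 0" x] by blast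
    obtain b where b: "\<And>s. peval G (\<lambda>i. 0 + s * x i) = poly b s"
      using lp[of G, unfolded line_poly_def, rule_format, of "\<lambda>_. 0" x] by blast
    have "poly (a * b) s = poly 1 s" for s  using nz[of "\<lambda>i. 0 + s * x i"] unfolding a b by simp
    hence "a * b = 1" by (intro poly_eq_poly_eq_iff[THEN iffD1] ext)
    hence "a \<noteq> 0" by (intro notI) simp
    moreover have "a dvd 1" using \<open>a * b = 1\<close> by (intro dvdI[of _ _ b]) simp
    ultimately have "degree a = 0" by (simp add: is_unit_iff_degree)
    then obtain a0 where "a = [:a0:]" by (rule degree_eq_zeroE)
    hence "poly a 1 = poly a 0" by simp
    thus ?thesis unfolding c_def a[symmetric] by simp
  qed
  have "F = Poly_Mapping.single 0 c" by (rule cpoly_eqI) (simp add: F_c)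
  moreover have "c \<noteq> 0" using nz[of "\<lambda>_. 0"] unfolding c_def by fastforce
  ultimately show ?thesis using that by blast
qed

section \<open>Resultants of polynomials of bounded degree\<close>

definition row_ix :: "nat \<Rightarrow> nat \<Rightarrow> nat" where
  "row_ix m r = (if r < m then r else r - m)"

text \<open>The Sylvester matrix for the formal degree \<open>m\<close> of both arguments, with
  columns in ascending powers. Keeping the formal degree makes the determinant notice a common root
  at infinity as well, as the Chow form of a projective curve must.\<close>

definition sylv :: "nat \<Rightarrow> complex poly \<Rightarrow> complex poly \<Rightarrow> complex mat" where
  "sylv m p q = mat (2 * m) (2 * m) (\<lambda>(r, c).
     if row_ix m r \<le> c then coeff (if r < m then p else q) (c - row_ix m r) else 0)"

lemma sylv_carrier: "sylv m p q \<in> carrier_mat (2 * m) (2 * m)"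
  by (simp add: sylv_def)

text \<open>A row of the Sylvester matrix applied to the vector of powers of
  \<open>t\<close>.\<close>

lemma sum_shifted_coeff:
  assumes "degree p \<le> m" "i < m"
  shows "(\<Sum>c\<in>{0..<2*m}. (if i \<le> c then coeff p (c - i) else 0) * t ^ c) = t ^ i * poly p (t :: complex)"
proof -
  have "(\<Sum>c\<in>{0..<2*m}. (if i \<le> c then coeff p (c - i) else 0) * t ^ c) =
        (\<Sum>c\<in>{i..i+m}. coeff p (c - i) * t ^ c)"
    by (rule sum.mono_neutral_cong_right) (use assms in \<open>auto simp: coeff_eq_0\<close>)
  also have "\<dots> = (\<Sum>j\<in>{0..m}. coeff p j * t ^ (j + i))"
    using sum.shift_bounds_cl_nat_ivl[of "\<lambda>c. coeff p (c - i) * t ^ c" 0 i m] by (simp add: add.commute)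
  also have "\<dots> = t ^ i * (\<Sum>j\<le>m. coeff p j * t ^ j)"
    by (simp add: sum_distrib_left power_add mult_ac atMost_atLeast0)
  also have "(\<Sum>j\<le>m. coeff p j * t ^ j) = poly p t"
    unfolding poly_altdef by (rule sum.mono_neutral_right) (use assms in \<open>auto simp: coeff_eq_0\<close>)
  finally show ?thesis .
qed

lemma coprime_if_no_common_root:
  fixes p q :: "complex poly"
  assumes "\<And>t. \<not> (poly p t = 0 \<and> poly q t = 0)" "p \<noteq> 0"
  shows "coprime p q"
proof (rule coprimeI)
  fix d assume d: "d dvd p" "d dvd q"
  have "\<not> (\<exists>t. poly d t = 0)"
  proof
    assume "\<exists>t. poly d t = 0"
    then obtain t where "poly d t = 0" ..
    hence "poly p t = 0" "poly q t = 0" using d by (auto simp: dvd_def)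
    thus False using assms(1) by blast
  qed
  hence "constant (poly d)" using fundamental_theorem_of_algebra by blast
  hence "degree d = 0" by (simp add: constant_degree)
  moreover have "d \<noteq> 0" using d(1) assms(2) by auto
  ultimately show "d dvd 1" by (simp add: is_unit_iff_degree)
qed

lemma coeff_mult_sum_interval:
  fixes a p :: "complex poly"
  assumes "degree a < m"
  shows "coeff (a * p) c = (\<Sum>i\<in>{0..<m}. if i \<le> c then coeff a i * coeff p (c - i) else 0)"
proof -
  have "coeff (a * p) c = (\<Sum>i\<le>c. coeff a i * coeff p (c - i))" by (rule coeff_mult)
  also have "\<dots> = (\<Sum>i\<in>{0..<m} \<inter> {..c}. coeff a i * coeff p (c - i))"
    by (rule sum.mono_neutral_right) (use assms in \<open>auto dest: le_degree\<close>)
  also have "\<dots> = (\<Sum>i\<in>{0..<m}. if i \<le> c then coeff a i * coeff p (c - i) else 0)"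
    by (simp add: sum.inter_restrict)
  finally show ?thesis .
qed

text \<open>The second alternative is a common root at infinity. Common roots give explicit kernel
  vectors. Conversely, a kernel vector of the transpose is a relation
  \<open>a * p + b * q = 0\<close> with multipliers of degree below \<open>m\<close>, which
  coprimality forbids once one of the degrees is really \<open>m\<close>.\<close>

lemma det_sylv_eq_0_iff:
  assumes deg: "degree p \<le> m" "degree q \<le> m" and m: "m \<ge> 1"
  shows "det (sylv m p q) = 0 \<longleftrightarrow>
    (\<exists>t. poly p t = 0 \<and> poly q t = 0) \<or> (coeff p m = 0 \<and> coeff q m = 0)"
proof
  have entry: "(sylv m p q *\<^sub>v v) $ r =
      (\<Sum>c\<in>{0..<2*m}. (if row_ix m r \<le> c then coeff (if r < m then p else q) (c - row_ix m r) else 0) * v $ c)"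
    if "r < 2 * m" "v \<in> carrier_vec (2 * m)" for r v
    using that by (simp add: sylv_def scalar_prod_def row_def)
  have ix: "row_ix m r < m" if "r < 2 * m" for r using that by (auto simp: row_ix_def)
  have degs: "degree (if b then p else q) \<le> m" for b using deg by simp
  assume "(\<exists>t. poly p t = 0 \<and> poly q t = 0) \<or> (coeff p m = 0 \<and> coeff q m = 0)"
  hence "\<exists>v \<in> carrier_vec (2 * m). v \<noteq> 0\<^sub>v (2 * m) \<and> sylv m p q *\<^sub>v v = 0\<^sub>v (2 * m)"
  proof (elim disjE exE)
    fix t assume t: "poly p t = 0 \<and> poly q t = 0"
    define v where "v = vec (2 * m) (\<lambda>c. t ^ c)"
    have v: "v \<in> carrier_vec (2 * m)" by (simp add: v_def)
    have "v $ 0 = 1" using m by (simp add: v_def)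
    hence "v \<noteq> 0\<^sub>v (2 * m)" using m by auto
    moreover have "sylv m p q *\<^sub>v v = 0\<^sub>v (2 * m)"
    proof (rule eq_vecI)
      fix r assume "r < dim_vec (0\<^sub>v (2 * m) :: complex vec)"
      hence r: "r < 2 * m" by simp
      have "(sylv m p q *\<^sub>v v) $ r = t ^ row_ix m r * poly (if r < m then p else q) t"
        unfolding entry[OF r v] sum_shifted_coeff[OF degs[of "r < m"] ix[OF r], symmetric]
        by (rule sum.cong) (auto simp: v_def)
      thus "(sylv m p q *\<^sub>v v) $ r = 0\<^sub>v (2 * m) $ r" using t r by simp
    qed (simp add: sylv_def)
    ultimately show ?thesis using v by blast
  next
    assume z: "coeff p m = 0 \<and> coeff q m = 0"
    \<comment> \<open>The last unit vector is the vector of powers for the root at infinity.\<close>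
    define v where "v = (unit_vec (2 * m) (2 * m - 1) :: complex vec)"
    have v: "v \<in> carrier_vec (2 * m)" by (simp add: v_def)
    have "v $ (2 * m - 1) = 1" using m by (simp add: v_def)
    hence "v \<noteq> 0\<^sub>v (2 * m)" using m by auto
    moreover have "sylv m p q *\<^sub>v v = 0\<^sub>v (2 * m)"
    proof (rule eq_vecI)
      fix r assume "r < dim_vec (0\<^sub>v (2 * m) :: complex vec)"
      hence r: "r < 2 * m" by simp
      have "coeff (if r < m then p else q) (c - row_ix m r) * v $ c = 0" if "c < 2 * m" for c
      proof (cases "c = 2 * m - 1")
        case True
        have "coeff (if r < m then p else q) j = 0" if "j \<ge> m" for j
        proof (cases "j = m")
          case False
          thus ?thesis using that degs[of "r < m"] by (intro coeff_eq_0) simp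
        qed (use z in simp)
        moreover have "m \<le> c - row_ix m r" using True ix[OF r] by simp
        ultimately show ?thesis by simp
      qed (use that in \<open>simp add: v_def\<close>)
      hence "(if row_ix m r \<le> c then coeff (if r < m then p else q) (c - row_ix m r) else 0) * v $ c = 0"
        if "c \<in> {0..<2 * m}" for c using that by simp
      hence "(sylv m p q *\<^sub>v v) $ r = 0" unfolding entry[OF r v] by (rule sum.neutral[OF ballI])
      thus "(sylv m p q *\<^sub>v v) $ r = 0\<^sub>v (2 * m) $ r" using r by simp
    qed (simp add: sylv_def)
    ultimately show ?thesis using v by blast
  qed
  thus "det (sylv m p q) = 0" using det_0_iff_vec_prod_zero[OF sylv_carrier] by blast
next
  assume "det (sylv m p q) = 0"
  hence "det (transpose_mat (sylv m p q)) = 0" using det_transpose[OF sylv_carrier] by simp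
  moreover have "transpose_mat (sylv m p q) \<in> carrier_mat (2 * m) (2 * m)" using sylv_carrier by simp
  ultimately obtain w where w: "w \<in> carrier_vec (2 * m)" "w \<noteq> 0\<^sub>v (2 * m)"
    "transpose_mat (sylv m p q) *\<^sub>v w = 0\<^sub>v (2 * m)" using det_0_iff_vec_prod_zero by blast
  \<comment> \<open>The two halves of the kernel vector are the coefficient vectors of the
    multipliers of \<open>p\<close> and of \<open>q\<close>.\<close>
  define a where "a = (\<Sum>i\<in>{0..<m}. monom (w $ i) i)"
  define b where "b = (\<Sum>i\<in>{0..<m}. monom (w $ (m + i)) i)"
  have ca: "coeff a i = (if i < m then w $ i else 0)" for i by (simp add: a_def coeff_sum)
  have cb: "coeff b i = (if i < m then w $ (m + i) else 0)" for i by (simp add: b_def coeff_sum)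
  have da: "degree a < m" using m by (intro le_less_trans[OF degree_le, of "m - 1"]) (auto simp: ca)
  have db: "degree b < m" using m by (intro le_less_trans[OF degree_le, of "m - 1"]) (auto simp: cb)
  have "a * p + b * q = 0"
  proof (rule poly_eqI)
    fix c
    show "coeff (a * p + b * q) c = coeff 0 c"
    proof (cases "c < 2 * m")
      case True
      have "0 = (transpose_mat (sylv m p q) *\<^sub>v w) $ c" using w(3) True by simp
      also have "\<dots> = (\<Sum>r\<in>{0..<2*m}. (if row_ix m r \<le> c then coeff (if r < m then p else q) (c - row_ix m r) else 0) * w $ r)"
        using True w(1) by (simp add: sylv_def scalar_prod_def)
      also have "\<dots> = (\<Sum>r\<in>{0..<m+m}. (if row_ix m r \<le> c then coeff (if r < m then p else q) (c - row_ix m r) else 0) * w $ r)"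
        by (simp add: mult_2)
      also have "\<dots> = (\<Sum>r\<in>{0..<m}. (if r \<le> c then coeff p (c - r) else 0) * w $ r) +
                       (\<Sum>r\<in>{m..<m+m}. (if r - m \<le> c then coeff q (c - (r - m)) else 0) * w $ r)"
        by (subst sum.atLeastLessThan_concat[symmetric, of 0 m "m + m"])
           (auto simp: row_ix_def intro!: arg_cong2[where f = "(+)"] sum.cong)
      also have "(\<Sum>r\<in>{m..<m+m}. (if r - m \<le> c then coeff q (c - (r - m)) else 0) * w $ r) =
                 (\<Sum>i\<in>{0..<m}. (if i \<le> c then coeff q (c - i) else 0) * w $ (m + i))"
        using sum.shift_bounds_nat_ivl[of "\<lambda>r. (if r - m \<le> c then coeff q (c - (r - m)) else 0) * w $ r" 0 m m]
        by (simp add: add.commute cong: if_cong)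
      also have "(\<Sum>r\<in>{0..<m}. (if r \<le> c then coeff p (c - r) else 0) * w $ r) = coeff (a * p) c"
        unfolding coeff_mult_sum_interval[OF da] by (rule sum.cong) (auto simp: ca)
      also have "(\<Sum>i\<in>{0..<m}. (if i \<le> c then coeff q (c - i) else 0) * w $ (m + i)) = coeff (b * q) c"
        unfolding coeff_mult_sum_interval[OF db] by (rule sum.cong) (auto simp: cb)
      finally have "0 = coeff (a * p) c + coeff (b * q) c" .
      thus ?thesis by simp
    next
      case False
      have "degree (a * p) < 2 * m" "degree (b * q) < 2 * m"
        using degree_mult_le[of a p] degree_mult_le[of b q] da db deg by linarith+
      thus ?thesis using False by (simp add: coeff_eq_0)
    qed
  qed
  hence rel: "a * p = - (b * q)" by (simp add: eq_neg_iff_add_eq_0)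
  have ab: "\<not> (a = 0 \<and> b = 0)"
  proof
    assume "a = 0 \<and> b = 0"
    hence z: "w $ i = 0" "w $ (m + i) = 0" if "i < m" for i
      using ca[of i] cb[of i] that by simp_all
    have "w = 0\<^sub>v (2 * m)"
    proof (rule eq_vecI)
      fix r assume "r < dim_vec (0\<^sub>v (2 * m) :: complex vec)"
      thus "w $ r = 0\<^sub>v (2 * m) $ r" using z(1)[of r] z(2)[of "r - m"] by (cases "r < m") auto
    qed (use w(1) in auto)
    with w(2) show False ..
  qed
  show "(\<exists>t. poly p t = 0 \<and> poly q t = 0) \<or> (coeff p m = 0 \<and> coeff q m = 0)"
  proof (rule ccontr)
    assume "\<not> ?thesis"
    hence no: "\<And>t. \<not> (poly p t = 0 \<and> poly q t = 0)" and top: "coeff p m \<noteq> 0 \<or> coeff q m \<noteq> 0" by auto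
    from top show False
    proof
      assume t: "coeff p m \<noteq> 0"
      hence p0: "p \<noteq> 0" by auto
      have "p dvd b * q" using rel by (metis dvd_minus_iff dvd_triv_right)
      hence "p dvd b" using coprime_if_no_common_root[OF no p0] by (simp add: coprime_dvd_mult_left_iff)
      moreover have "degree p > degree b" using db le_degree[OF t] by simp
      ultimately have "b = 0" using dvd_imp_degree_le by (metis not_le)
      thus False using rel p0 ab by simp
    next
      assume t: "coeff q m \<noteq> 0"
      hence q0: "q \<noteq> 0" by auto
      have "coprime q p" by (rule coprime_if_no_common_root[OF _ q0]) (use no in blast)
      moreover have "q dvd a * p" using rel by simp
      ultimately have "q dvd a" by (simp add: coprime_dvd_mult_left_iff)
      moreover have "degree q > degree a" using da le_degree[OF t] by simp
      ultimately have "a = 0" using dvd_imp_degree_le by (metis not_le)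
      thus False using rel q0 ab by simp
    qed
  qed
qed

text \<open>Exactly the first \<open>m\<close> rows scale, so every term of the determinant does so
  by the same power.\<close>

lemma det_sylv_smult: "det (sylv m (smult s p) q) = s ^ m * det (sylv m p q)"
proof -
  have "(\<Prod>r\<in>{0..<2*m}. sylv m (smult s p) q $$ (r, \<pi> r)) = s ^ m * (\<Prod>r\<in>{0..<2*m}. sylv m p q $$ (r, \<pi> r))"
    if "\<pi> permutes {0..<2*m}" for \<pi>
  proof -
    have "sylv m (smult s p) q $$ (r, \<pi> r) = (if r < m then s else 1) * sylv m p q $$ (r, \<pi> r)"
      if "r \<in> {0..<2*m}" for r
      using that permutes_in_image[OF \<open>\<pi> permutes {0..<2*m}\<close>, of r] by (auto simp: sylv_def)
    hence "(\<Prod>r\<in>{0..<2*m}. sylv m (smult s p) q $$ (r, \<pi> r)) =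
        (\<Prod>r\<in>{0..<2*m}. if r < m then s else 1) * (\<Prod>r\<in>{0..<2*m}. sylv m p q $$ (r, \<pi> r))"
      by (simp add: prod.distrib)
    also have "(\<Prod>r\<in>{0..<2*m}. if r < m then s else 1) = (\<Prod>r\<in>{0..<m}. s)"
      by (rule prod.mono_neutral_cong_right) auto
    finally show ?thesis by simp
  qed
  thus ?thesis
    unfolding det_def'[OF sylv_carrier] sum_distrib_left
    by (intro sum.cong refl) (simp add: mult.left_commute)
qed

text \<open>For constant \<open>p\<close> the matrix is lower triangular: the row
  \<open>m + i\<close> ends in column \<open>m + i\<close> with the coefficient of \<open>q\<close>
  of index \<open>m\<close>. This value becomes the leading coefficient of the resultant in one
  variable.\<close>

lemma det_sylv_const:
  assumes "degree q \<le> m"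
  shows "det (sylv m [:a:] q) = a ^ m * coeff q m ^ m"
proof -
  have "det (sylv m [:a:] q) = prod_list (diag_mat (sylv m [:a:] q))"
  proof (rule det_lower_triangular[OF _ sylv_carrier])
    fix i j assume "i < j" "j < 2 * m"
    thus "sylv m [:a:] q $$ (i, j) = 0"
      using assms by (auto simp: sylv_def row_ix_def coeff_pCons coeff_eq_0 split: nat.splits)
  qed
  also have "\<dots> = (\<Prod>r\<in>{0..<m+m}. sylv m [:a:] q $$ (r, r))"
    unfolding prod_list_diag_prod by (simp add: sylv_def mult_2)
  also have "\<dots> = (\<Prod>r\<in>{0..<m}. a) * (\<Prod>r\<in>{m..<m+m}. coeff q m)"
    by (subst prod.atLeastLessThan_concat[symmetric, of 0 m "m + m"])
       (auto simp: sylv_def row_ix_def intro!: arg_cong2[where f = "(*)"] prod.cong)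
  finally show ?thesis by simp
qed

section \<open>Cancellation and linear factors of polynomials in several variables\<close>

lemma line_poly_peval_id: "line_poly (peval F)"
  using line_poly_peval[of "\<lambda>v x. x v" F, OF line_poly_coord] .

lemma cpoly_mult_eq_0:
  assumes "(F :: 'v cpoly) * G = 0" "F \<noteq> 0"
  shows "G = 0"
proof -
  have "peval F x = 0 \<or> peval G x = 0" for x
    using assms(1) peval_mult[of F G x] by simp
  from line_poly_domain[OF line_poly_peval_id line_poly_peval_id this]
  show ?thesis using peval_zero_imp_zero[of F] peval_zero_imp_zero[of G] assms(2) by blast
qed

lemma cpoly_mult_cancel:
  assumes "(F :: 'v cpoly) * G = F * H" "F \<noteq> 0"
  shows "G = H"
  using cpoly_mult_eq_0[of F "G - H"] assms by (simp add: algebra_simps)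

lemma power_diff_dvd: "(x - y) dvd (x ^ k - y ^ k)" for x y :: "'a::comm_ring_1"
proof (induction k)
  case (Suc k)
  have "x ^ Suc k - y ^ Suc k = (x - y) * x ^ k + y * (x ^ k - y ^ k)" by (simp add: algebra_simps)
  with Suc.IH show ?case by (simp add: dvd_add dvd_mult)
qed simp

text \<open>The factor theorem: subtracting the zero value of \<open>G\<close> at
  \<open>y := \<eta>\<close> turns \<open>G\<close> into a combination of the differences
  \<open>Var y ^ i - \<eta> ^ i\<close>, each divisible by \<open>Var y - \<eta>\<close>.\<close>

lemma linear_dvd_if_vanishing:
  fixes G \<eta> :: "'v cpoly"
  assumes indep: "\<And>x c. peval \<eta> (x(y := c)) = peval \<eta> x"
    and van: "\<And>x. peval G (x(y := peval \<eta> x)) = 0"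
  shows "(Var y - \<eta>) dvd G"
proof -
  obtain k C where C: "\<And>x. peval G x = (\<Sum>i\<le>k. peval (C i) x * x y ^ i)"
    "\<And>i x c. peval (C i) (x(y := c)) = peval (C i) x"
    using ex_decomposition_in_variable[of G y] by blast
  have "G = (\<Sum>i\<le>k. C i * (Var y ^ i - \<eta> ^ i))"
  proof (rule cpoly_eqI)
    fix x
    have "peval G x = peval G x - peval G (x(y := peval \<eta> x))" using van by simp
    also have "\<dots> = (\<Sum>i\<le>k. peval (C i) x * x y ^ i) - (\<Sum>i\<le>k. peval (C i) x * peval \<eta> x ^ i)"
      by (simp only: C fun_upd_same)
    also have "\<dots> = peval (\<Sum>i\<le>k. C i * (Var y ^ i - \<eta> ^ i)) x"
      by (simp add: peval_sum peval_mult peval_diff peval_power sum_subtractf right_diff_distrib)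
    finally show "peval G x = peval (\<Sum>i\<le>k. C i * (Var y ^ i - \<eta> ^ i)) x" .
  qed
  moreover have "(Var y - \<eta>) dvd (\<Sum>i\<le>k. C i * (Var y ^ i - \<eta> ^ i))"
    by (intro dvd_sum dvd_mult power_diff_dvd)
  ultimately show ?thesis by simp
qed

section \<open>The resultant of two linear forms on a monomial curve\<close>

definition form_coeff :: "'i set \<Rightarrow> ('i \<Rightarrow> nat) \<Rightarrow> ('i \<Rightarrow> complex) \<Rightarrow> bool \<Rightarrow> nat \<Rightarrow> (bool \<times> 'i) cpoly" where
  "form_coeff A dg \<theta> b j = (\<Sum>k\<in>{k\<in>A. dg k = j}. Poly_Mapping.single 0 (\<theta> k) * Var (b, k))"

definition sylv_form :: "'i set \<Rightarrow> ('i \<Rightarrow> nat) \<Rightarrow> ('i \<Rightarrow> complex) \<Rightarrow> nat \<Rightarrow> (bool \<times> 'i) cpoly mat" where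
  "sylv_form A dg \<theta> m = mat (2 * m) (2 * m) (\<lambda>(r, c).
     if row_ix m r \<le> c then form_coeff A dg \<theta> (m \<le> r) (c - row_ix m r) else 0)"

definition res_form :: "'i set \<Rightarrow> ('i \<Rightarrow> nat) \<Rightarrow> ('i \<Rightarrow> complex) \<Rightarrow> nat \<Rightarrow> (bool \<times> 'i) cpoly" where
  "res_form A dg \<theta> m = det (sylv_form A dg \<theta> m)"

text \<open>The linear form with coefficients \<open>u (b, k)\<close> pulled back to the monomial
  curve with coordinates \<open>\<theta> k * t ^ dg k\<close>. The polynomials
  \<open>form_coeff\<close> are its coefficients with \<open>u\<close> left indeterminate.\<close>

definition section_poly :: "'i set \<Rightarrow> ('i \<Rightarrow> nat) \<Rightarrow> ('i \<Rightarrow> complex) \<Rightarrow> (bool \<times> 'i \<Rightarrow> complex) \<Rightarrow> bool \<Rightarrow> complex poly" where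
  "section_poly A dg \<theta> u b = (\<Sum>k\<in>A. monom (\<theta> k * u (b, k)) (dg k))"

lemma peval_form_coeff:
  assumes "finite A"
  shows "peval (form_coeff A dg \<theta> b j) u = coeff (section_poly A dg \<theta> u b) j"
proof -
  have "coeff (section_poly A dg \<theta> u b) j = (\<Sum>k\<in>A. if dg k = j then \<theta> k * u (b, k) else 0)"
    by (simp add: section_poly_def coeff_sum)
  also have "\<dots> = (\<Sum>k\<in>{k\<in>A. dg k = j}. \<theta> k * u (b, k))"
    by (rule sum.mono_neutral_cong_right) (use assms in auto)
  finally show ?thesis
    by (simp add: form_coeff_def peval_sum peval_mult)
qed

interpretation peval_hom: comm_ring_hom "\<lambda>F. peval F u" for u
  by unfold_locales (simp_all add: peval_mult peval_add)

lemma sylv_form_carrier: "sylv_form A dg \<theta> m \<in> carrier_mat (2 * m) (2 * m)"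
  by (simp add: sylv_form_def)

lemma peval_res_form:
  assumes "finite A"
  shows "peval (res_form A dg \<theta> m) u =
    det (sylv m (section_poly A dg \<theta> u False) (section_poly A dg \<theta> u True))"
proof -
  have "peval (res_form A dg \<theta> m) u = det (map_mat (\<lambda>F. peval F u) (sylv_form A dg \<theta> m))"
    unfolding res_form_def by (rule peval_hom.hom_det[symmetric])
  also have "map_mat (\<lambda>F. peval F u) (sylv_form A dg \<theta> m) =
      sylv m (section_poly A dg \<theta> u False) (section_poly A dg \<theta> u True)"
    by (rule eq_matI) (auto simp: sylv_def sylv_form_def peval_form_coeff[OF assms])
  finally show ?thesis .
qed

lemma poly_section_poly: "poly (section_poly A dg \<theta> u b) t = (\<Sum>k\<in>A. \<theta> k * u (b, k) * t ^ dg k)"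
  by (simp add: section_poly_def poly_sum poly_monom)

text \<open>Every degree up to \<open>m\<close> occurs with nonzero weight, so the sections are
  arbitrary polynomials of degree at most \<open>m\<close>. The variable of \<open>k0\<close> moves
  only the constant term of a section; it is the main variable for division.\<close>

locale graded_forms =
  fixes A :: "'i set" and dg :: "'i \<Rightarrow> nat" and \<theta> :: "'i \<Rightarrow> complex" and m :: nat and k0 :: 'i
  assumes fin: "finite A" and m: "m \<ge> 1" and dg: "dg ` A = {..m}"
    and \<theta>: "\<And>k. k \<in> A \<Longrightarrow> \<theta> k \<noteq> 0" and k0: "k0 \<in> A" "dg k0 = 0"
begin

abbreviation "P \<equiv> section_poly A dg \<theta>"
abbreviation "R \<equiv> res_form A dg \<theta> m"

lemma degree_P: "degree (P u b) \<le> m"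
  unfolding section_poly_def
  by (intro degree_sum_le fin order.trans[OF degree_monom_le]) (use dg in auto)

lemma R_eq_0_iff:
  "peval R u = 0 \<longleftrightarrow> (\<exists>t. poly (P u False) t = 0 \<and> poly (P u True) t = 0) \<or>
     (coeff (P u False) m = 0 \<and> coeff (P u True) m = 0)"
  unfolding peval_res_form[OF fin] by (rule det_sylv_eq_0_iff[OF degree_P degree_P m])

lemma ex_index: assumes "j \<le> m" obtains k where "k \<in> A" "dg k = j"
  using assms dg by (metis atMost_iff imageE)

lemma P_update: assumes "k \<in> A"
  shows "P (u((b, k) := z)) b = P (u((b, k) := 0)) b + monom (\<theta> k * z) (dg k)"
  unfolding section_poly_def using assms fin by (simp add: sum.remove[of A k])

lemma P_update_other: "P (u((b, k) := z)) (\<not> b) = P u (\<not> b)" "b \<noteq> c \<Longrightarrow> P (u((b, k) := z)) c = P u c"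
  by (simp_all add: section_poly_def)

lemma P_indicator: assumes "k \<in> A" "\<And>l. l \<in> A \<Longrightarrow> l \<noteq> k \<Longrightarrow> u (b, l) = 0"
  shows "P u b = monom (\<theta> k * u (b, k)) (dg k)"
proof -
  have "P u b = (\<Sum>l\<in>A. if l = k then monom (\<theta> k * u (b, k)) (dg k) else 0)"
    unfolding section_poly_def by (rule sum.cong) (use assms in auto)
  thus ?thesis using assms(1) fin by simp
qed

lemma line_poly_coeff_P: "(\<And>k. line_poly (\<lambda>x. h x (b, k))) \<Longrightarrow> line_poly (\<lambda>x. coeff (P (h x) b) j)"
  unfolding section_poly_def coeff_sum coeff_monom
  by (intro line_poly_sum line_poly_if line_poly_mult line_poly_const) auto

lemma line_poly_poly_P:
  "(\<And>k. line_poly (\<lambda>x. h x (b, k))) \<Longrightarrow> line_poly \<tau> \<Longrightarrow> line_poly (\<lambda>x. poly (P (h x) b) (\<tau> x))"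
  unfolding poly_section_poly
  by (intro line_poly_sum line_poly_mult line_poly_power line_poly_const) auto

end

text \<open>Multiplying by \<open>z\<close> to the degree of \<open>h\<close> clears denominators;
  the resulting polynomials agree at all nonzero \<open>z\<close> and hence coefficientwise. This
  converts scaling behaviour into a degree bound together with the top coefficient.\<close>

lemma rational_reflection_coeffs:
  fixes g h :: "complex poly"
  assumes "\<And>z. z \<noteq> 0 \<Longrightarrow> poly g z = z ^ m * poly h (1 / z)"
  shows "i > m \<Longrightarrow> coeff g i = 0" "coeff g m = poly h 0"
proof -
  define D where "D = degree h"
  have "poly (monom 1 D * g) z = poly (monom 1 m * reflect_poly h) z" if "z \<in> - {0}" for z
    using that by (simp add: poly_monom assms poly_reflect_poly_nz D_def divide_inverse)
  hence "- {0} \<subseteq> {z. poly (monom 1 D * g - monom 1 m * reflect_poly h) z = 0}" by auto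
  moreover have "infinite (- {0 :: complex})"
    using infinite_UNIV_char_0[where 'a = complex] finite_compl[of "{0 :: complex}"] by simp
  ultimately have "infinite {z. poly (monom 1 D * g - monom 1 m * reflect_poly h) z = 0}"
    by (rule infinite_super)
  hence "monom 1 D * g - monom 1 m * reflect_poly h = 0" using poly_roots_finite[of "monom 1 D * g - monom 1 m * reflect_poly h"] by argo
  hence eq: "coeff (monom 1 D * g) (D + i) = coeff (monom 1 m * reflect_poly h) (D + i)" for i by simp
  show "coeff g i = 0" if "i > m"
    using eq[of i] that by (simp add: coeff_monom_mult coeff_reflect_poly D_def)
  show "coeff g m = poly h 0"
    using eq[of m] by (simp add: coeff_monom_mult coeff_reflect_poly D_def poly_0_coeff_0)
qed

lemma rsquarefree_card_roots:
  fixes p :: "complex poly"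
  assumes "rsquarefree p"
  shows "card {z. poly p z = 0} = degree p"
proof -
  have p0: "p \<noteq> 0" using assms by (simp add: rsquarefree_def)
  have "degree p = degree (smult (lead_coeff p) (\<Prod>z|poly p z = 0. [:-z, 1:]))"
    by (simp only: complex_poly_decompose_rsquarefree[OF assms])
  also have "\<dots> = (\<Sum>z|poly p z = 0. degree [:-z, 1:])"
    using p0 by (simp add: degree_prod_sum_eq)
  finally show ?thesis by simp
qed

text \<open>A multiple root of \<open>q + [:s:]\<close> is a critical point of \<open>q\<close> with
  critical value \<open>- s\<close>, and there are finitely many critical values.\<close>

lemma squarefree_shift_roots:
  fixes q :: "complex poly"
  assumes "degree q = m" "m \<ge> 1"
  shows "finite {s. card {t. poly (q + [:s:]) t = 0} \<noteq> m}"
proof -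
  have pd: "pderiv q \<noteq> 0" using assms by (simp add: pderiv_eq_0_iff)
  have "{s. card {t. poly (q + [:s:]) t = 0} \<noteq> m} \<subseteq> (\<lambda>t. - poly q t) ` {t. poly (pderiv q) t = 0}"
  proof
    fix s assume s: "s \<in> {s. card {t. poly (q + [:s:]) t = 0} \<noteq> m}"
    have deg: "degree (q + [:s:]) = m" using assms by (simp add: degree_add_eq_left)
    hence "q + [:s:] \<noteq> 0" using assms by auto
    hence "\<not> rsquarefree (q + [:s:])"
      using rsquarefree_card_roots[of "q + [:s:]"] s deg by auto
    then obtain t where "poly (q + [:s:]) t = 0" "poly (pderiv (q + [:s:])) t = 0"
      unfolding rsquarefree_roots by blast
    hence "s = - poly q t" "poly (pderiv q) t = 0"
      by (auto simp: pderiv_add pderiv_pCons eq_neg_iff_add_eq_0 add.commute)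
    thus "s \<in> (\<lambda>t. - poly q t) ` {t. poly (pderiv q) t = 0}" by blast
  qed
  thus ?thesis by (rule finite_subset) (simp add: poly_roots_finite[OF pd])
qed

lemma smult_sum_right: "smult s (\<Sum>i\<in>I. f i) = (\<Sum>i\<in>I. smult s (f i))"
  by (induction I rule: infinite_finite_induct) (simp_all add: smult_add_right)

section \<open>The resultant as a polynomial in one constant term\<close>

context graded_forms
begin

abbreviation "zf \<equiv> (False, k0)"

definition lead_form :: "(bool \<times> 'i) cpoly" where
  "lead_form = Poly_Mapping.single 0 (\<theta> k0 ^ m) * form_coeff A dg \<theta> True m ^ m"

lemma peval_lead_form: "peval lead_form u = \<theta> k0 ^ m * coeff (P u True) m ^ m"
  by (simp add: lead_form_def peval_mult peval_power peval_form_coeff[OF fin])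

lemma P_zf: "P (u(zf := z)) False = P (u(zf := 0)) False + [:\<theta> k0 * z:]"
  using P_update[OF k0(1), of u False z] by (simp add: k0(2) monom_0)

lemma lead_form_indep: "peval lead_form (u(zf := z)) = peval lead_form u"
  by (simp add: peval_lead_form P_update_other)

text \<open>Homogeneity in the first section lets the \<open>m\<close>-th power of the constant term
  \<open>z\<close> be pulled out. What remains is a polynomial in \<open>1 / z\<close>, and its
  value at \<open>1 / z = 0\<close> is the resultant of a constant with the second section, that is
  \<open>lead_form\<close>.\<close>

lemma R_decomposition:
  obtains C where "\<And>u. peval R u = (\<Sum>i\<le>m. peval (C i) u * u zf ^ i)"
    "\<And>i u z. peval (C i) (u(zf := z)) = peval (C i) u" "\<And>u. peval (C m) u = peval lead_form u"
proof -
  obtain K C where C: "\<And>u. peval R u = (\<Sum>i\<le>K. peval (C i) u * u zf ^ i)"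
    "\<And>i u c. peval (C i) (u(zf := c)) = peval (C i) u"
    using ex_decomposition_in_variable[of R zf] by blast
  have main: "(i > m \<and> i \<le> K \<longrightarrow> peval (C i) u = 0) \<and> peval lead_form u = (if m \<le> K then peval (C m) u else 0)" for i u
  proof -
    define g where "g = (\<Sum>i\<le>K. monom (peval (C i) u) i)"
    define p where "p = P (u(zf := 0)) False"
    define q where "q = P u True"
    \<comment> \<open>A line in the space of sections: the second section stays fixed while the
      first one is \<open>smult s p + [:\<theta> k0:]\<close>. The parameter \<open>s\<close> plays
      the role of \<open>1 / z\<close>.\<close>
    obtain h where h: "\<forall>s. peval R (\<lambda>v. (u(zf := 0)) v * (if fst v then 1 else 0) + (if v = zf then 1 else 0)
          + s * ((u(zf := 0)) v * (if fst v then 0 else 1))) = poly h s"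
      using line_polyD[OF line_poly_peval_id[of R],
        of "\<lambda>v. (u(zf := 0)) v * (if fst v then 1 else 0) + (if v = zf then 1 else 0)"
           "\<lambda>v. (u(zf := 0)) v * (if fst v then 0 else 1)"] ..
    have hs: "poly h s = det (sylv m (smult s p + [:\<theta> k0:]) q)" for s
    proof -
      define w where "w = (\<lambda>v. (u(zf := 0)) v * (if fst v then 1 else 0) + (if v = zf then 1 else 0)
          + s * ((u(zf := 0)) v * (if fst v then 0 else 1)))"
      have "P w True = q" unfolding q_def section_poly_def by (rule sum.cong) (auto simp: w_def)
      moreover have "P w False = smult s p + [:\<theta> k0:]"
      proof -
        have "P w False = (\<Sum>k\<in>A. smult s (monom (\<theta> k * (u(zf := 0)) (False, k)) (dg k)) + (if k = k0 then [:\<theta> k0:] else 0))"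
          unfolding section_poly_def by (rule sum.cong) (auto simp: w_def smult_monom k0 monom_0 algebra_simps)
        thus ?thesis using fin k0 by (simp add: sum.distrib p_def section_poly_def smult_sum_right)
      qed
      ultimately show ?thesis using spec[OF h, of s] peval_res_form[OF fin, of dg \<theta> m w] by (simp add: w_def)
    qed
    have g: "poly g z = det (sylv m (p + [:\<theta> k0 * z:]) q)" for z
    proof -
      have "poly g z = peval R (u(zf := z))" by (simp add: g_def poly_sum poly_monom C)
      also have "\<dots> = det (sylv m (p + [:\<theta> k0 * z:]) q)"
        unfolding peval_res_form[OF fin] P_zf[of u z] p_def q_def by (simp add: P_update_other)
      finally show ?thesis .
    qed
    have "poly g z = z ^ m * poly h (1 / z)" if "z \<noteq> 0" for z
    proof -
      have "p + [:\<theta> k0 * z:] = smult z (smult (1 / z) p + [:\<theta> k0:])"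
        using that by (simp add: smult_add_right mult.commute)
      thus ?thesis unfolding g hs using det_sylv_smult by simp
    qed
    note refl = rational_reflection_coeffs[OF this]
    have cg: "coeff g j = (if j \<le> K then peval (C j) u else 0)" for j
      by (simp add: g_def coeff_sum)
    have "poly h 0 = peval lead_form u"
      unfolding hs peval_lead_form using det_sylv_const[OF degree_P, of "\<theta> k0" u True] by (simp add: q_def)
    thus ?thesis using refl(1)[of i] refl(2) cg[of i] cg[of m] by auto
  qed
  define C' where "C' i = (if i \<le> K then C i else 0)" for i
  have "peval R u = (\<Sum>i\<le>m. peval (C' i) u * u zf ^ i)" for u
  proof -
    have "(\<Sum>i\<le>m. peval (C' i) u * u zf ^ i) = (\<Sum>i\<in>{..m} \<inter> {..K}. peval (C i) u * u zf ^ i)"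
      by (rule sum.mono_neutral_cong_right) (auto simp: C'_def)
    also have "\<dots> = (\<Sum>i\<le>K. peval (C i) u * u zf ^ i)"
      by (rule sum.mono_neutral_left) (use main in force)+
    finally show ?thesis using C(1) by simp
  qed
  moreover have "peval (C' i) (u(zf := z)) = peval (C' i) u" for i u z by (simp add: C'_def C(2))
  moreover have "peval (C' m) u = peval lead_form u" for u using main[of 0 u] by (simp add: C'_def)
  ultimately show ?thesis using that by blast
qed

text \<open>Suppose the second section has \<open>m\<close> distinct roots and the first one takes
  distinct values there. For each root one value of the constant term \<open>zf\<close> makes it a
  common root, so \<open>F\<close> has \<open>m\<close> zeros in a variable in which its degree is
  below \<open>m\<close>. All other pairs follow by density.\<close>

lemma low_degree_vanishing_is_zero:
  assumes F: "\<And>u. peval F u = (\<Sum>i<\<delta>. peval (C i) u * u zf ^ i)"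
    and C: "\<And>i u z. peval (C i) (u(zf := z)) = peval (C i) u"
    and van: "\<And>u t. poly (P u False) t = 0 \<Longrightarrow> poly (P u True) t = 0 \<Longrightarrow> peval F u = 0"
    and "\<delta> \<le> m"
  shows "peval F u = 0"
proof -
  have good: "peval F w = 0" if card: "card {t. poly (P w True) t = 0} = m" and deg: "degree (P w True) = m" for w
  proof -
    define \<Omega> where "\<Omega> = {t. poly (P w True) t = 0}"
    have fin\<Omega>: "finite \<Omega>" unfolding \<Omega>_def by (rule poly_roots_finite) (use deg m in auto)
    \<comment> \<open>Freezes the second section at that of \<open>w\<close>; only the first section
      varies.\<close>
    define \<mu> where "\<mu> u = (\<lambda>v. if fst v then w v else u v)" for u :: "bool \<times> 'i \<Rightarrow> complex"
    have lp: "line_poly (\<lambda>u. \<mu> u v)" for v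
      unfolding \<mu>_def by (intro line_poly_if line_poly_const line_poly_coord)
    have PT: "P (\<mu> u) True = P w True" for u by (simp add: section_poly_def \<mu>_def)
    \<comment> \<open>Nonzero exactly if the first section separates the roots of the
      second.\<close>
    define disc where "disc u = (\<Prod>(a,b)\<in>{(a,b) \<in> \<Omega> \<times> \<Omega>. a \<noteq> b}. poly (P (\<mu> u) False) a - poly (P (\<mu> u) False) b)" for u
    have fin2: "finite {(a,b) \<in> \<Omega> \<times> \<Omega>. a \<noteq> b}"
      by (rule finite_subset[of _ "\<Omega> \<times> \<Omega>"]) (use fin\<Omega> in auto)
    have lp_disc: "line_poly disc" unfolding disc_def split_beta
      by (intro line_poly_prod line_poly_diff line_poly_poly_P lp line_poly_const)
    obtain k1 where k1: "k1 \<in> A" "dg k1 = 1" using ex_index[OF m] .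
    \<comment> \<open>The first section becomes \<open>t\<close> itself, which separates any set of
      roots.\<close>
    define u1 where "u1 = (\<lambda>v. if v = (False, k1) then 1 / \<theta> k1 else (0 :: complex))"
    have "P (\<mu> u1) False = monom 1 1"
      using P_indicator[OF k1(1), of "\<mu> u1" False] \<theta>[OF k1(1)] k1(2) by (simp add: \<mu>_def u1_def)
    hence disc1: "disc u1 \<noteq> 0"
      unfolding disc_def by (subst prod_zero_iff[OF fin2]) (auto simp: poly_monom)
    have lp_F: "line_poly (\<lambda>u. peval F (\<mu> u))" by (rule line_poly_peval[OF lp])
    have van_F: "peval F (\<mu> u) = 0" if d: "disc u \<noteq> 0" for u
    proof -
      have inj: "inj_on (\<lambda>t. poly (P (\<mu> u) False) t) \<Omega>"
      proof (rule inj_onI, rule ccontr)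
        fix a b assume "a \<in> \<Omega>" "b \<in> \<Omega>" "poly (P (\<mu> u) False) a = poly (P (\<mu> u) False) b" "a \<noteq> b"
        thus False using d unfolding disc_def prod_zero_iff[OF fin2] by auto
      qed
      define g where "g = (\<Sum>i<\<delta>. monom (peval (C i) (\<mu> u)) i)"
      have g: "poly g z = peval F ((\<mu> u)(zf := z))" for z
        by (simp add: g_def poly_sum poly_monom F C)
      \<comment> \<open>For each root \<open>t\<close> of the second section, the value of
        \<open>zf\<close> that cancels the value of the first section at \<open>t\<close>.\<close>
      define Z where "Z = (\<lambda>t. \<mu> u zf - poly (P (\<mu> u) False) t / \<theta> k0) ` \<Omega>"
      have "Z \<subseteq> {z. poly g z = 0}"
      proof
        fix z assume "z \<in> Z"
        then obtain t where t: "t \<in> \<Omega>" "z = \<mu> u zf - poly (P (\<mu> u) False) t / \<theta> k0" by (auto simp: Z_def)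
        have "poly (P ((\<mu> u)(zf := 0)) False) t + \<theta> k0 * \<mu> u zf = poly (P (\<mu> u) False) t"
          using P_zf[of "\<mu> u" "\<mu> u zf"] by simp
        hence "poly (P ((\<mu> u)(zf := z)) False) t = 0"
          using \<theta>[OF k0(1)] P_zf[of "\<mu> u" z] by (simp add: t(2) field_simps)
        moreover have "poly (P ((\<mu> u)(zf := z)) True) t = 0"
          using t(1) PT[of u] by (simp add: P_update_other \<Omega>_def)
        ultimately show "z \<in> {z. poly g z = 0}" using van g by simp
      qed
      moreover have "card Z = m"
      proof -
        have "inj_on (\<lambda>t. \<mu> u zf - poly (P (\<mu> u) False) t / \<theta> k0) \<Omega>"
          using inj \<theta>[OF k0(1)] by (auto simp: inj_on_def)
        thus ?thesis unfolding Z_def using card by (simp add: card_image \<Omega>_def)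
      qed
      moreover have "degree g < m \<or> g = 0"
      proof (cases "\<delta> = 0")
        case False
        have "degree g \<le> \<delta> - 1" unfolding g_def
          by (intro degree_sum_le order.trans[OF degree_monom_le]) auto
        thus ?thesis using False \<open>\<delta> \<le> m\<close> by linarith
      qed (simp add: g_def)
      ultimately have "g = 0"
        using card_poly_roots_bound[of g] card_mono[OF poly_roots_finite, of g Z] by linarith
      thus ?thesis using g[of "\<mu> u zf"] by simp
    qed
    have "peval F (\<mu> w) = 0" by (rule line_poly_dense[OF lp_F lp_disc disc1 van_F])
    thus ?thesis by (simp add: \<mu>_def)
  qed
  have top: "peval F w = 0" if "coeff (P w True) m \<noteq> 0" for w
  proof -
    have deg: "degree (P w True) = m" using le_degree[OF that] degree_P[of w True] by simp
    \<comment> \<open>Moving the constant term of the second section makes its roots simple for all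
      but finitely many \<open>s\<close>, so the restriction of \<open>F\<close> to this line
      vanishes infinitely often.\<close>
    obtain g where g: "\<forall>s. peval F (\<lambda>v. w v + s * (if v = (True, k0) then 1 / \<theta> k0 else 0)) = poly g s"
      using line_polyD[OF line_poly_peval_id[of F], of w "\<lambda>v. if v = (True, k0) then 1 / \<theta> k0 else 0"] ..
    have "- {s. card {t. poly (P w True + [:s:]) t = 0} \<noteq> m} \<subseteq> {s. poly g s = 0}"
    proof
      fix s assume s: "s \<in> - {s. card {t. poly (P w True + [:s:]) t = 0} \<noteq> m}"
      define w' where "w' = (\<lambda>v. w v + s * (if v = (True, k0) then 1 / \<theta> k0 else 0))"
      have "P w' True = (\<Sum>k\<in>A. monom (\<theta> k * w (True, k)) (dg k) + (if k = k0 then [:s:] else 0))"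
        unfolding section_poly_def
        by (rule sum.cong) (use \<theta>[OF k0(1)] in \<open>auto simp: w'_def k0 monom_0 field_simps\<close>)
      hence P': "P w' True = P w True + [:s:]" using fin k0 by (simp add: sum.distrib section_poly_def)
      have "peval F w' = 0"
      proof (rule good)
        show "card {t. poly (P w' True) t = 0} = m" using s P' by simp
        show "degree (P w' True) = m" unfolding P' using deg m by (simp add: degree_add_eq_left)
      qed
      thus "s \<in> {s. poly g s = 0}" using g by (simp add: w'_def)
    qed
    moreover have "infinite (- {s. card {t. poly (P w True + [:s:]) t = 0} \<noteq> m})"
      using finite_compl[OF squarefree_shift_roots[OF deg m]] infinite_UNIV_char_0[where 'a = complex] by simp
    ultimately have "infinite {s. poly g s = 0}" by (rule infinite_super)
    hence "g = 0" using poly_roots_finite[of g] by argo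
    thus ?thesis using spec[OF g, of 0] by simp
  qed
  obtain km where km: "km \<in> A" "dg km = m" using ex_index[of m] by blast
  define u1 where "u1 = (\<lambda>v. if v = (True, km) then 1 else (0 :: complex))"
  have top1: "coeff (P u1 True) m \<noteq> 0"
    using P_indicator[OF km(1), of u1 True] \<theta>[OF km(1)] km(2) by (simp add: u1_def)
  have "line_poly (\<lambda>u. coeff (P u True) m)" by (rule line_poly_coeff_P[OF line_poly_coord])
  from line_poly_dense[OF line_poly_peval_id this top1 top] show ?thesis .
qed

end

section \<open>Divisibility by the resultant and its irreducibility\<close>

context graded_forms
begin

lemma R_vanishes: "poly (P u False) t = 0 \<Longrightarrow> poly (P u True) t = 0 \<Longrightarrow> peval R u = 0"
  using R_eq_0_iff by blast

text \<open>As long as the degree in \<open>zf\<close> is at least that of \<open>R\<close>,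
  multiplying by \<open>lead_form\<close> and subtracting a multiple of \<open>R\<close> lowers it
  and keeps the vanishing on pairs with a common root. Below \<open>m\<close> nothing is left, so
  there is no remainder.\<close>

lemma pseudo_division:
  assumes "\<And>u. peval F u = (\<Sum>i<\<delta>. peval (C i) u * u zf ^ i)"
    and "\<And>i u z. peval (C i) (u(zf := z)) = peval (C i) u"
    and "\<And>u t. poly (P u False) t = 0 \<Longrightarrow> poly (P u True) t = 0 \<Longrightarrow> peval F u = 0"
  shows "\<exists>N G. lead_form ^ N * F = G * R"
  using assms
proof (induction \<delta> arbitrary: F C)
  case 0
  hence "F = 0" by (intro peval_zero_imp_zero) simp
  thus ?case by (intro exI[of _ 0]) simp
next
  case (Suc \<delta>)
  show ?case
  proof (cases "Suc \<delta> \<le> m")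
    case True
    have "F = 0"
      by (rule peval_zero_imp_zero, rule low_degree_vanishing_is_zero[OF Suc.prems(1,2,3) True])
    thus ?thesis by (intro exI[of _ 0]) simp
  next
    case False
    hence \<delta>: "m \<le> \<delta>" by simp
    obtain r where r: "\<And>u. peval R u = (\<Sum>i\<le>m. peval (r i) u * u zf ^ i)"
      "\<And>i u z. peval (r i) (u(zf := z)) = peval (r i) u" "\<And>u. peval (r m) u = peval lead_form u"
      using R_decomposition by blast
    \<comment> \<open>The terms of degree \<open>\<delta>\<close> in \<open>zf\<close> cancel
      because the top coefficient of \<open>R\<close> is \<open>lead_form\<close>.\<close>
    define F' where "F' = lead_form * F - C \<delta> * Var zf ^ (\<delta> - m) * R"
    define C' where "C' i = lead_form * C i - C \<delta> * (if \<delta> - m \<le> i then r (i - (\<delta> - m)) else 0)" for i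
    have "peval F' u = (\<Sum>i<\<delta>. peval (C' i) u * u zf ^ i)" for u
    proof -
      have "(\<Sum>i\<le>\<delta>. peval (if \<delta> - m \<le> i then r (i - (\<delta> - m)) else 0) u * u zf ^ i) =
          (\<Sum>i\<in>{0 + (\<delta> - m)..m + (\<delta> - m)}. peval (r (i - (\<delta> - m))) u * u zf ^ i)"
        by (rule sum.mono_neutral_cong_right) (use \<delta> in auto)
      also have "\<dots> = (\<Sum>i\<le>m. peval (r i) u * u zf ^ (i + (\<delta> - m)))"
        unfolding sum.shift_bounds_cl_nat_ivl by (simp add: atMost_atLeast0)
      also have "\<dots> = u zf ^ (\<delta> - m) * peval R u"
        by (simp add: r sum_distrib_left power_add mult_ac)
      finally have sR: "(\<Sum>i\<le>\<delta>. peval (if \<delta> - m \<le> i then r (i - (\<delta> - m)) else 0) u * u zf ^ i) = u zf ^ (\<delta> - m) * peval R u" .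
      have "peval F' u = peval lead_form u * (\<Sum>i<Suc \<delta>. peval (C i) u * u zf ^ i) - peval (C \<delta>) u * (u zf ^ (\<delta> - m) * peval R u)"
        by (simp add: F'_def peval_diff peval_mult peval_power Suc.prems(1) mult_ac del: sum.lessThan_Suc)
      also have "\<dots> = (\<Sum>i<Suc \<delta>. peval (C' i) u * u zf ^ i)"
        unfolding sR[symmetric] sum_distrib_left lessThan_Suc_atMost sum_subtractf[symmetric]
        by (rule sum.cong) (simp_all add: C'_def peval_diff peval_mult algebra_simps)
      also have "\<dots> = (\<Sum>i<\<delta>. peval (C' i) u * u zf ^ i)"
        using \<delta> by (simp add: C'_def peval_diff peval_mult r(3))
      finally show ?thesis .
    qed
    moreover have "peval (C' i) (u(zf := z)) = peval (C' i) u" for i u z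
      by (simp add: C'_def peval_diff peval_mult lead_form_indep Suc.prems(2) r(2))
    moreover have "peval F' u = 0" if "poly (P u False) t = 0" "poly (P u True) t = 0" for u t
      using Suc.prems(3)[OF that] R_vanishes[OF that] by (simp add: F'_def peval_diff peval_mult)
    ultimately obtain N G where "lead_form ^ N * F' = G * R" using Suc.IH by blast
    hence "lead_form ^ Suc N * F = (G + lead_form ^ N * C \<delta> * Var zf ^ (\<delta> - m)) * R"
      by (simp add: F'_def algebra_simps)
    thus ?thesis by blast
  qed
qed

text \<open>The coefficient is a linear form, so its zero set is parametrised by solving for one
  variable. There the product of \<open>G\<close> and \<open>R\<close> vanishes but \<open>R\<close>
  does not vanish identically; hence \<open>G\<close> does, and the factor theorem applies.\<close>

lemma form_coeff_dvd_if:
  assumes "form_coeff A dg \<theta> True m * F = G * R"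
  shows "form_coeff A dg \<theta> True m dvd G"
proof -
  obtain km where km: "km \<in> A" "dg km = m" using ex_index[of m] by blast
  define A' where "A' = {k\<in>A. dg k = m} - {km}"
  \<comment> \<open>The value of the variable \<open>(True, km)\<close> at which the top coefficient
    of the second section becomes zero.\<close>
  define \<eta> where "\<eta> = (\<Sum>k\<in>A'. Poly_Mapping.single 0 (- \<theta> k / \<theta> km) * Var (True, k))"
  have fA': "finite A'" using fin by (simp add: A'_def)
  have \<eta>: "peval \<eta> u = (\<Sum>k\<in>A'. - \<theta> k / \<theta> km * u (True, k))" for u
    by (simp add: \<eta>_def peval_sum peval_mult)
  have split: "{k\<in>A. dg k = m} = insert km A'" using km by (auto simp: A'_def)
  have B: "form_coeff A dg \<theta> True m = Poly_Mapping.single 0 (\<theta> km) * (Var (True, km) - \<eta>)"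
  proof (rule cpoly_eqI)
    fix u
    have "peval (form_coeff A dg \<theta> True m) u = \<theta> km * u (True, km) + (\<Sum>k\<in>A'. \<theta> k * u (True, k))"
    proof -
      have "km \<notin> A'" by (simp add: A'_def)
      thus ?thesis unfolding form_coeff_def split using fA'
        by (simp add: peval_add peval_sum peval_mult)
    qed
    thus "peval (form_coeff A dg \<theta> True m) u = peval (Poly_Mapping.single 0 (\<theta> km) * (Var (True, km) - \<eta>)) u"
      using \<theta>[OF km(1)] by (simp add: peval_mult peval_diff \<eta> right_diff_distrib sum_distrib_left sum_negf)
  qed
  have ind: "peval \<eta> (u((True, km) := c)) = peval \<eta> u" for u c
    unfolding \<eta> by (rule sum.cong) (auto simp: A'_def)
  define \<zeta> where "\<zeta> u = u((True, km) := peval \<eta> u)" for u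
  have lp\<zeta>: "line_poly (\<lambda>u. \<zeta> u v)" for v
    unfolding \<zeta>_def fun_upd_apply by (intro line_poly_if line_poly_coord line_poly_peval_id)
  have "peval G (\<zeta> u) = 0 \<or> peval R (\<zeta> u) = 0" for u
  proof -
    have "peval G (\<zeta> u) * peval R (\<zeta> u) = peval (form_coeff A dg \<theta> True m * F) (\<zeta> u)"
      unfolding assms by (simp add: peval_mult)
    also have "\<dots> = 0" unfolding B by (simp add: peval_mult peval_diff \<zeta>_def ind)
    finally show ?thesis by simp
  qed
  from line_poly_domain[OF line_poly_peval[OF lp\<zeta>] line_poly_peval[OF lp\<zeta>] this]
  have "peval G (\<zeta> u) = 0" for u
  proof
    assume *: "\<forall>u. peval R (\<zeta> u) = 0"
    \<comment> \<open>The sections are multiples of \<open>t ^ m\<close> and of \<open>1\<close>: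
      the top coefficient of the second one vanishes, yet they share no root, not even at
      infinity.\<close>
    define u0 where "u0 = (\<lambda>v. if v = (False, km) \<or> v = (True, k0) then 1 else (0 :: complex))"
    have kk: "km \<noteq> k0" using km k0 m by auto
    have "peval \<eta> u0 = 0" unfolding \<eta> u0_def using k0 m by (intro sum.neutral) (auto simp: A'_def)
    hence \<zeta>0: "\<zeta> u0 = u0" using kk by (auto simp: \<zeta>_def u0_def)
    have "P u0 False = monom (\<theta> km) m" using P_indicator[OF km(1), of u0 False] km(2) by (simp add: u0_def)
    moreover have "P u0 True = [:\<theta> k0:]"
      using P_indicator[OF k0(1), of u0 True] k0(2) by (simp add: u0_def monom_0)
    ultimately have "peval R u0 \<noteq> 0" using \<theta>[OF km(1)] \<theta>[OF k0(1)] by (simp add: R_eq_0_iff)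
    thus ?thesis using * \<zeta>0 by metis
  qed simp
  hence "(Var (True, km) - \<eta>) dvd G"
    by (intro linear_dvd_if_vanishing ind) (simp add: \<zeta>_def)
  then obtain G' where "G = (Var (True, km) - \<eta>) * G'" ..
  hence "G = form_coeff A dg \<theta> True m * (Poly_Mapping.single 0 (1 / \<theta> km) * G')"
    unfolding B using \<theta>[OF km(1)] by (intro cpoly_eqI) (simp add: peval_mult)
  thus ?thesis by simp
qed

lemma form_coeff_nonzero: "form_coeff A dg \<theta> True m \<noteq> 0"
proof
  assume z: "form_coeff A dg \<theta> True m = 0"
  obtain km where km: "km \<in> A" "dg km = m" using ex_index[of m] by blast
  define u1 where "u1 = (\<lambda>v. if v = (True, km) then 1 else (0 :: complex))"
  have "coeff (P u1 True) m \<noteq> 0"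
    using P_indicator[OF km(1), of u1 True] \<theta>[OF km(1)] km(2) by (simp add: u1_def)
  thus False using peval_form_coeff[OF fin, of dg \<theta> True m u1] z by simp
qed

text \<open>Pseudo-division leaves a power of \<open>lead_form\<close> in front of \<open>F\<close>.
  Up to a nonzero constant this is a power of a linear form, and it is cancelled one linear factor
  at a time.\<close>

theorem R_dvd_if_vanishing:
  assumes van: "\<And>u t. poly (P u False) t = 0 \<Longrightarrow> poly (P u True) t = 0 \<Longrightarrow> peval F u = 0"
  shows "R dvd F"
proof -
  let ?B = "form_coeff A dg \<theta> True m"
  obtain K C where C: "\<And>u. peval F u = (\<Sum>i\<le>K. peval (C i) u * u zf ^ i)"
    "\<And>i u c. peval (C i) (u(zf := c)) = peval (C i) u"
    using ex_decomposition_in_variable[of F zf] by blast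
  have "\<exists>N G. lead_form ^ N * F = G * R"
    by (rule pseudo_division[OF C(1)[unfolded lessThan_Suc_atMost[symmetric]] C(2)]) (rule van)
  then obtain N G where NG: "lead_form ^ N * F = G * R" by blast
  have cancel: "\<exists>G'. F = G' * R" if "?B ^ M * F = G * R" for M G
    using that
  proof (induction M arbitrary: G)
    case (Suc M)
    hence "?B * (?B ^ M * F) = G * R" by (simp add: mult.assoc)
    from form_coeff_dvd_if[OF this] obtain G' where G': "G = ?B * G'" ..
    have "?B * (?B ^ M * F) = ?B * (G' * R)" using Suc.prems G' by (simp add: mult.assoc)
    hence "?B ^ M * F = G' * R" using form_coeff_nonzero by (rule cpoly_mult_cancel)
    thus ?case by (rule Suc.IH)
  qed auto
  define c where "c = \<theta> k0 ^ (m * N)"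
  have c: "c \<noteq> 0" using \<theta>[OF k0(1)] by (simp add: c_def)
  have "?B ^ (m * N) * F = (Poly_Mapping.single 0 (1 / c) * G) * R"
  proof (rule cpoly_eqI)
    fix u
    have "peval (lead_form ^ N * F) u = peval (G * R) u" by (simp only: NG)
    hence "c * (peval ?B u ^ (m * N) * peval F u) = peval G u * peval R u"
      by (simp add: lead_form_def peval_mult peval_power c_def power_mult_distrib mult.assoc flip: power_mult)
    thus "peval (?B ^ (m * N) * F) u = peval ((Poly_Mapping.single 0 (1 / c) * G) * R) u"
      using c by (simp add: peval_mult peval_power field_simps)
  qed
  from cancel[OF this] show ?thesis by auto
qed

lemma R_nonzero: "R \<noteq> 0"
proof
  assume z: "R = 0"
  obtain km where km: "km \<in> A" "dg km = m" using ex_index[of m] by blast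
  define u0 where "u0 = (\<lambda>v. if v = (False, km) \<or> v = (True, k0) then 1 else (0 :: complex))"
  have kk: "km \<noteq> k0" using km k0 m by auto
  have "P u0 False = monom (\<theta> km) m" using P_indicator[OF km(1), of u0 False] km(2) by (simp add: u0_def)
  moreover have "P u0 True = [:\<theta> k0:]"
    using P_indicator[OF k0(1), of u0 True] k0(2) by (simp add: u0_def monom_0)
  ultimately have "peval R u0 \<noteq> 0" using \<theta>[OF km(1)] \<theta>[OF k0(1)] by (simp add: R_eq_0_iff)
  thus False using z by simp
qed

lemma R_not_unit: "\<not> R dvd 1"
  by (rule not_dvd_one_if_root[of _ "\<lambda>_. 0"]) (simp add: R_eq_0_iff section_poly_def)

text \<open>The pairs of sections with a common finite root are parametrised by an affine space:
  choose the root and arbitrary sections, then correct the constant terms. Hence a product can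
  vanish on all of them only if one factor does.\<close>

theorem irreducible_R: "irreducible R"
proof (rule irreducibleI)
  fix X Y assume XY: "R = X * Y"
  define \<zeta> :: "((bool \<times> 'i) option \<Rightarrow> complex) \<Rightarrow> bool \<times> 'i \<Rightarrow> complex" where
    "\<zeta> f = (\<lambda>(b, k). if k = k0 then f (Some (b, k0)) - poly (P (\<lambda>v. f (Some v)) b) (f None) / \<theta> k0
       else f (Some (b, k)))" for f
  have lp: "line_poly (\<lambda>f. \<zeta> f v)" for v
    unfolding \<zeta>_def split_beta divide_inverse
    by (intro line_poly_if line_poly_diff line_poly_mult line_poly_poly_P line_poly_coord line_poly_const)
  have root: "poly (P (\<zeta> f) b) (f None) = 0" for f b
  proof -
    have "poly (P (\<zeta> f) b) (f None) = (\<Sum>k\<in>A. \<theta> k * f (Some (b, k)) * f None ^ dg k -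
        (if k = k0 then poly (P (\<lambda>v. f (Some v)) b) (f None) else 0))"
      unfolding poly_section_poly using \<theta>[OF k0(1)]
      by (intro sum.cong refl) (auto simp: \<zeta>_def k0 right_diff_distrib poly_section_poly)
    thus ?thesis using fin k0(1) by (simp add: sum_subtractf poly_section_poly)
  qed
  have "peval X (\<zeta> f) = 0 \<or> peval Y (\<zeta> f) = 0" for f
    using R_vanishes[OF root root, of f] by (simp add: XY peval_mult)
  from line_poly_domain[OF line_poly_peval[OF lp] line_poly_peval[OF lp] this]
  have XY0: "(\<forall>f. peval X (\<zeta> f) = 0) \<or> (\<forall>f. peval Y (\<zeta> f) = 0)" .
  have surj: "\<exists>f. u = \<zeta> f" if "poly (P u False) t = 0" "poly (P u True) t = 0" for u t
  proof
    have "poly (P u b) t = 0" for b using that by (cases b) auto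
    thus "u = \<zeta> (\<lambda>v. case v of None \<Rightarrow> t | Some v \<Rightarrow> u v)"
      by (auto simp: \<zeta>_def)
  qed
  have unit: "V dvd 1" if "R = U * V" "\<forall>f. peval U (\<zeta> f) = 0" for U V
  proof -
    have "R dvd U" using that(2) surj by (intro R_dvd_if_vanishing) metis
    then obtain W where "U = R * W" ..
    hence "R * 1 = R * (W * V)" using that(1) by (simp add: mult_ac)
    hence "1 = W * V" using R_nonzero by (rule cpoly_mult_cancel)
    thus ?thesis by (metis dvd_triv_right)
  qed
  from XY0 show "X dvd 1 \<or> Y dvd 1"
    using unit[of X Y] unit[of Y X] XY by (auto simp: mult.commute)
qed (use R_nonzero R_not_unit in auto)

text \<open>Identifies whatever polynomial the choice in \<open>chow_form\<close> returns:
  \<open>R\<close> divides it, and irreducibility leaves only a constant cofactor.\<close>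

lemma associated_if_irreducible_vanishing:
  assumes Q: "irreducible Q"
    and "\<And>u t. poly (P u False) t = 0 \<Longrightarrow> poly (P u True) t = 0 \<Longrightarrow> peval Q u = 0"
  obtains c where "c \<noteq> 0" "Q = Poly_Mapping.single 0 c * R"
proof -
  have "R dvd Q" by (rule R_dvd_if_vanishing) (rule assms(2))
  then obtain K where K: "Q = R * K" ..
  hence "K dvd 1" using irreducibleD[OF Q K] R_not_unit by blast
  then obtain c where "c \<noteq> 0" "K = Poly_Mapping.single 0 c" by (rule unit_imp_const)
  thus ?thesis using that K by (simp add: mult.commute)
qed

end

section \<open>The monomials of the resultant\<close>

text \<open>Index set of the complete expansion of the Sylvester determinant: a permutation, and for
  every row one of the variables in the linear entry that the permutation selects.\<close>

definition sylv_choices :: "'i set \<Rightarrow> ('i \<Rightarrow> nat) \<Rightarrow> nat \<Rightarrow> ((nat \<Rightarrow> nat) \<times> (nat \<Rightarrow> 'i)) set" where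
  "sylv_choices A dg m = (SIGMA \<pi>:{\<pi>. \<pi> permutes {0..<2*m}}.
     Pi\<^sub>E {0..<2*m} (\<lambda>r. {k\<in>A. row_ix m r \<le> \<pi> r \<and> dg k = \<pi> r - row_ix m r}))"

definition row_monomial :: "nat \<Rightarrow> (nat \<Rightarrow> 'i) \<Rightarrow> (bool \<times> 'i) \<Rightarrow>\<^sub>0 nat" where
  "row_monomial m \<kappa> = (\<Sum>r\<in>{0..<2*m}. Poly_Mapping.single (m \<le> r, \<kappa> r) 1)"

lemma prod_Var: "(\<Prod>r\<in>I. Var (v r)) = Poly_Mapping.single (\<Sum>r\<in>I. Poly_Mapping.single (v r) 1) 1"
  by (induction I rule: infinite_finite_induct) (simp_all add: Var_def mult_single)

lemma finite_sylv_choices: "finite A \<Longrightarrow> finite (sylv_choices A dg m)"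
  unfolding sylv_choices_def by (intro finite_SigmaI finite_permutations finite_PiE) auto

text \<open>Expand the determinant and then each of its linear entries. With unit weights every term
  is a signed monomial, so the coefficients are integers.\<close>

lemma lookup_res_form_one:
  assumes "finite A"
  shows "Poly_Mapping.lookup (res_form A dg (\<lambda>_. 1) m) M =
    (\<Sum>(\<pi>, \<kappa>)\<in>sylv_choices A dg m. if row_monomial m \<kappa> = M then of_int (sign \<pi>) else 0)"
proof -
  have entry: "sylv_form A dg (\<lambda>_. 1) m $$ (r, c) =
      (\<Sum>k\<in>{k\<in>A. row_ix m r \<le> c \<and> dg k = c - row_ix m r}. Var (m \<le> r, k))"
    if "r < 2 * m" "c < 2 * m" for r c
    using that by (auto simp: sylv_form_def form_coeff_def)
  have "res_form A dg (\<lambda>_. 1) m =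
     (\<Sum>\<pi> | \<pi> permutes {0..<2*m}. of_int (sign \<pi>) * (\<Prod>r\<in>{0..<2*m}. sylv_form A dg (\<lambda>_. 1) m $$ (r, \<pi> r)))"
    unfolding res_form_def by (rule det_def'[OF sylv_form_carrier])
  also have "\<dots> = (\<Sum>\<pi> | \<pi> permutes {0..<2*m}. of_int (sign \<pi>) *
      (\<Sum>\<kappa>\<in>Pi\<^sub>E {0..<2*m} (\<lambda>r. {k\<in>A. row_ix m r \<le> \<pi> r \<and> dg k = \<pi> r - row_ix m r}).
         Poly_Mapping.single (row_monomial m \<kappa>) 1))"
  proof (intro sum.cong refl arg_cong2[where f = "(*)"])
    fix \<pi> assume "\<pi> \<in> {\<pi>. \<pi> permutes {0..<2*m}}"
    hence \<pi>: "\<pi> r < 2 * m" if "r < 2 * m" for r using permutes_in_image[of \<pi> "{0..<2*m}" r] that by auto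
    have "(\<Prod>r\<in>{0..<2*m}. sylv_form A dg (\<lambda>_. 1) m $$ (r, \<pi> r)) =
        (\<Prod>r\<in>{0..<2*m}. \<Sum>k\<in>{k\<in>A. row_ix m r \<le> \<pi> r \<and> dg k = \<pi> r - row_ix m r}. Var (m \<le> r, k))"
      by (rule prod.cong) (use \<pi> entry in auto)
    also have "\<dots> = (\<Sum>\<kappa>\<in>Pi\<^sub>E {0..<2*m} (\<lambda>r. {k\<in>A. row_ix m r \<le> \<pi> r \<and> dg k = \<pi> r - row_ix m r}).
         \<Prod>r\<in>{0..<2*m}. Var (m \<le> r, \<kappa> r))"
      by (rule prod_sum_PiE) (use assms in auto)
    finally show "(\<Prod>r\<in>{0..<2*m}. sylv_form A dg (\<lambda>_. 1) m $$ (r, \<pi> r)) =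
        (\<Sum>\<kappa>\<in>Pi\<^sub>E {0..<2*m} (\<lambda>r. {k\<in>A. row_ix m r \<le> \<pi> r \<and> dg k = \<pi> r - row_ix m r}).
           Poly_Mapping.single (row_monomial m \<kappa>) 1)"
      unfolding prod_Var row_monomial_def .
  qed
  also have "\<dots> = (\<Sum>(\<pi>, \<kappa>)\<in>sylv_choices A dg m. of_int (sign \<pi>) * Poly_Mapping.single (row_monomial m \<kappa>) 1)"
    unfolding sylv_choices_def sum_distrib_left
    by (rule sum.Sigma) (use assms in \<open>auto intro!: finite_permutations finite_PiE\<close>)
  also have "Poly_Mapping.lookup \<dots> M =
    (\<Sum>(\<pi>, \<kappa>)\<in>sylv_choices A dg m. if row_monomial m \<kappa> = M then of_int (sign \<pi>) else 0)"
    unfolding lookup_sum split_beta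
  proof (intro sum.cong refl)
    fix x :: "(nat \<Rightarrow> nat) \<times> (nat \<Rightarrow> 'a)"
    have "sign (fst x) = 1 \<or> sign (fst x) = -1" by (rule sign_cases) auto
    thus "Poly_Mapping.lookup (of_int (sign (fst x)) * Poly_Mapping.single (row_monomial m (snd x)) 1) M =
        (if row_monomial m (snd x) = M then complex_of_int (sign (fst x)) else 0)"
      by (auto simp: lookup_single when_def)
  qed
  finally show ?thesis .
qed

lemma mon_eval_times: "mon_eval M (\<lambda>v. x v * y v) = mon_eval M x * mon_eval M y"
  by (simp add: mon_eval_def power_mult_distrib prod.distrib)

text \<open>The weights enter only through the substitution of \<open>\<theta> k * u (b, k)\<close>
  for \<open>u (b, k)\<close>, which multiplies each coefficient by the value of its monomial at the
  weights.\<close>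

lemma lookup_res_form:
  assumes "finite A"
  shows "Poly_Mapping.lookup (res_form A dg \<theta> m) M =
     Poly_Mapping.lookup (res_form A dg (\<lambda>_. 1) m) M * mon_eval M (\<lambda>v. \<theta> (snd v))"
proof -
  define R1 where "R1 = res_form A dg (\<lambda>_. 1) m"
  define S where "S = (\<Sum>M\<in>Poly_Mapping.keys R1.
     Poly_Mapping.single M (Poly_Mapping.lookup R1 M * mon_eval M (\<lambda>v. \<theta> (snd v))))"
  have "res_form A dg \<theta> m = S"
  proof (rule cpoly_eqI)
    fix u
    have "peval S u = peval R1 (\<lambda>v. \<theta> (snd v) * u v)"
      unfolding S_def peval_sum peval_single peval_def[of R1] mon_eval_times by (simp add: mult.assoc)
    also have "\<dots> = peval (res_form A dg \<theta> m) u"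
      unfolding R1_def peval_res_form[OF assms] by (simp add: section_poly_def)
    finally show "peval (res_form A dg \<theta> m) u = peval S u" ..
  qed
  moreover have "Poly_Mapping.lookup S M = Poly_Mapping.lookup R1 M * mon_eval M (\<lambda>v. \<theta> (snd v))"
    unfolding S_def lookup_sum lookup_single when_def
    by (subst sum.delta) (auto simp: in_keys_iff)
  ultimately show ?thesis by (simp add: R1_def)
qed

lemma poly_vars_res_form:
  assumes "finite A"
  shows "poly_vars (res_form A dg \<theta> m) \<subseteq> UNIV \<times> A"
proof
  fix v assume "v \<in> poly_vars (res_form A dg \<theta> m)"
  then obtain M where M: "Poly_Mapping.lookup (res_form A dg \<theta> m) M \<noteq> 0" "v \<in> Poly_Mapping.keys M"
    by (auto simp: poly_vars_def in_keys_iff)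
  hence "(\<Sum>(\<pi>, \<kappa>)\<in>sylv_choices A dg m. if row_monomial m \<kappa> = M then of_int (sign \<pi>) else (0::complex)) \<noteq> 0"
    unfolding lookup_res_form[OF assms, of dg \<theta>] lookup_res_form_one[OF assms] by auto
  then obtain \<pi> \<kappa> where \<pi>\<kappa>: "(\<pi>, \<kappa>) \<in> sylv_choices A dg m" "row_monomial m \<kappa> = M"
    by (elim sum.not_neutral_contains_not_neutral) (auto split: if_splits)
  have "v \<in> Poly_Mapping.keys (row_monomial m \<kappa>)" using M \<pi>\<kappa> by simp
  then obtain r where "r \<in> {0..<2*m}" "v \<in> Poly_Mapping.keys (Poly_Mapping.single (m \<le> r, \<kappa> r) (1::nat))"
    unfolding row_monomial_def using keys_sum[of "\<lambda>r. Poly_Mapping.single (m \<le> r, \<kappa> r) (1::nat)" "{0..<2*m}"] by blast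
  thus "v \<in> UNIV \<times> A" using \<pi>\<kappa>(1) by (auto simp: sylv_choices_def PiE_iff)
qed

lemma res_form_key_choice:
  assumes "finite A" "Poly_Mapping.lookup (res_form A dg (\<lambda>_. 1) m) M \<noteq> 0"
  obtains \<pi> \<kappa> where "(\<pi>, \<kappa>) \<in> sylv_choices A dg m" "row_monomial m \<kappa> = M"
proof -
  have "(\<Sum>(\<pi>, \<kappa>)\<in>sylv_choices A dg m. if row_monomial m \<kappa> = M then of_int (sign \<pi>) else (0::complex)) \<noteq> 0"
    using assms(2) unfolding lookup_res_form_one[OF assms(1)] .
  thus ?thesis using that
    by (elim sum.not_neutral_contains_not_neutral) (auto split: if_splits)
qed

text \<open>One variable for each factor of the term \<open>a_0 ... a_(m-1) b_1 ... b_m\<close> of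
  the resultant of polynomials with coefficients \<open>a_j\<close> and \<open>b_j\<close>. The
  shift in \<open>K'\<close> keeps the argument equal to the degree of the coefficient.\<close>

definition staircase :: "nat \<Rightarrow> (nat \<Rightarrow> 'i) \<Rightarrow> (nat \<Rightarrow> 'i) \<Rightarrow> (bool \<times> 'i) \<Rightarrow>\<^sub>0 nat" where
  "staircase m K K' = (\<Sum>i<m. Poly_Mapping.single (False, K i) 1) + (\<Sum>i<m. Poly_Mapping.single (True, K' (Suc i)) 1)"

lemma row_monomial_split:
  "row_monomial m \<kappa> = (\<Sum>i<m. Poly_Mapping.single (False, \<kappa> i) 1) + (\<Sum>i<m. Poly_Mapping.single (True, \<kappa> (m + i)) 1)"
proof -
  have "row_monomial m \<kappa> = (\<Sum>r\<in>{0..<m}. Poly_Mapping.single (m \<le> r, \<kappa> r) 1) + (\<Sum>r\<in>{m..<m+m}. Poly_Mapping.single (m \<le> r, \<kappa> r) 1)"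
    unfolding row_monomial_def mult_2 by (rule sum.atLeastLessThan_concat[symmetric]) auto
  also have "(\<Sum>r\<in>{m..<m+m}. Poly_Mapping.single (m \<le> r, \<kappa> r) (1::nat)) = (\<Sum>i\<in>{0..<m}. Poly_Mapping.single (True, \<kappa> (m + i)) 1)"
    using sum.shift_bounds_nat_ivl[of "\<lambda>r. Poly_Mapping.single (m \<le> r, \<kappa> r) (1::nat)" 0 m m] by (simp add: add.commute)
  finally show ?thesis by (simp add: atLeast0LessThan)
qed

text \<open>Summing the squares of all columns forces the two permutations of degrees to be trivial.\<close>

lemma staircase_rigid:
  fixes p p' :: "nat \<Rightarrow> nat"
  assumes "bij_betw p {..<m} {..<m}" "bij_betw p' {..<m} {..<m}"
    and "(\<Sum>i<m. (i + p i)\<^sup>2) + (\<Sum>i<m. (i + p' i + 1)\<^sup>2) = (\<Sum>c<2*m. c\<^sup>2)" and "i < m"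
  shows "p i = i" "p' i = i"
proof -
  have sq: "(\<Sum>i<m. (int (p i))\<^sup>2) = (\<Sum>i<m. (int i)\<^sup>2)" and sq': "(\<Sum>i<m. (int (p' i))\<^sup>2) = (\<Sum>i<m. (int i)\<^sup>2)"
    and l': "(\<Sum>i<m. int (p' i)) = (\<Sum>i<m. int i)"
    using sum.reindex_bij_betw[OF assms(1), of "\<lambda>i. (int i)\<^sup>2"] sum.reindex_bij_betw[OF assms(2), of "\<lambda>i. (int i)\<^sup>2"]
      sum.reindex_bij_betw[OF assms(2), of int] by simp_all
  have cols: "(\<Sum>c<2*m. (int c)\<^sup>2) = (\<Sum>i<m. 8 * (int i)\<^sup>2 + 4 * int i + 1)"
    by (induction m) (simp_all add: power2_eq_square algebra_simps)
  have "int ((\<Sum>i<m. (i + p i)\<^sup>2) + (\<Sum>i<m. (i + p' i + 1)\<^sup>2)) = int (\<Sum>c<2*m. c\<^sup>2)" using assms(3) by simp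
  hence "(\<Sum>i<m. (int i + int (p i))\<^sup>2) + (\<Sum>i<m. (int i + int (p' i) + 1)\<^sup>2) = (\<Sum>i<m. 8 * (int i)\<^sup>2 + 4 * int i + 1)"
    using cols by (simp add: of_nat_sum add_ac)
  \<comment> \<open>The parallelogram identity: as \<open>p\<close> and \<open>p'\<close> are
    bijections, only the squared differences from the identity remain after summation.\<close>
  moreover have "(int i + int (p i))\<^sup>2 = 2 * (int i)\<^sup>2 + 2 * (int (p i))\<^sup>2 - (int i - int (p i))\<^sup>2" for i
    by (simp add: power2_eq_square algebra_simps)
  moreover have "(int i + int (p' i) + 1)\<^sup>2 = 2 * (int i)\<^sup>2 + 2 * (int (p' i))\<^sup>2 + 2 * int i + 2 * int (p' i) + 1 - (int i - int (p' i))\<^sup>2" for i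
    by (simp add: power2_eq_square algebra_simps)
  ultimately have zero: "(\<Sum>i<m. (int i - int (p i))\<^sup>2) + (\<Sum>i<m. (int i - int (p' i))\<^sup>2) = 0"
    by (simp add: sum.distrib sum_subtractf sq sq' l' flip: sum_distrib_left)
  have "(\<Sum>i<m. (int i - int (p i))\<^sup>2) \<ge> 0" "(\<Sum>i<m. (int i - int (p' i))\<^sup>2) \<ge> 0" by (simp_all add: sum_nonneg)
  with zero have "(\<Sum>i<m. (int i - int (p i))\<^sup>2) = 0" "(\<Sum>i<m. (int i - int (p' i))\<^sup>2) = 0" by linarith+
  thus "p i = i" "p' i = i" using assms(4) by (simp_all add: sum_nonneg_eq_0_iff)
qed

text \<open>Equality of monomials gives equality of multiplicities only; injectivity of
  \<open>K\<close> makes all of them at most one.\<close>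

lemma bij_betw_if_equal_counts:
  fixes \<kappa> K :: "nat \<Rightarrow> 'a"
  assumes "\<And>k. (\<Sum>i<m. if \<kappa> i = k then 1 else 0 :: nat) = (\<Sum>i<m. if K i = k then 1 else 0)"
    and "inj_on K {..<m}"
  shows "bij_betw \<kappa> {..<m} (K ` {..<m})"
proof -
  have *: "k \<in> f ` {..<m} \<longleftrightarrow> (\<Sum>i<m. if f i = k then 1 else 0 :: nat) \<noteq> 0" for f :: "nat \<Rightarrow> 'a" and k
    by (auto simp: image_iff)
  have im: "\<kappa> ` {..<m} = K ` {..<m}" unfolding set_eq_iff *[of _ \<kappa>] *[of _ K] assms(1) by simp
  moreover have "card (\<kappa> ` {..<m}) = card {..<m}" unfolding im by (rule card_image[OF assms(2)])
  ultimately show ?thesis by (simp add: bij_betw_def eq_card_imp_inj_on)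
qed

lemma split_rows: "(\<Sum>r\<in>{0..<2*m}. f r) = (\<Sum>i<m. f i) + (\<Sum>i<m. f (m + i))" for f :: "nat \<Rightarrow> nat"
proof -
  have "(\<Sum>r\<in>{0..<2*m}. f r) = (\<Sum>r\<in>{0..<m}. f r) + (\<Sum>r\<in>{m..<m+m}. f r)"
    unfolding mult_2 by (rule sum.atLeastLessThan_concat[symmetric]) auto
  also have "(\<Sum>r\<in>{m..<m+m}. f r) = (\<Sum>i\<in>{0..<m}. f (m + i))"
    using sum.shift_bounds_nat_ivl[of f 0 m m] by (simp add: add.commute)
  finally show ?thesis by (simp add: atLeast0LessThan)
qed

text \<open>The monomial fixes which variables occur in each half of the rows, hence the degrees
  there up to a permutation. Every column is used once, so the squares of the column numbers have a
  prescribed sum and \<open>staircase_rigid\<close> removes the remaining freedom.\<close>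

lemma staircase_choice_unique:
  assumes "(\<pi>, \<kappa>) \<in> sylv_choices A dg m" "row_monomial m \<kappa> = staircase m K K'"
    and K: "\<And>i. i < m \<Longrightarrow> dg (K i) = i" and K': "\<And>i. i < m \<Longrightarrow> dg (K' (Suc i)) = Suc i"
    and i: "i < m"
  shows "\<kappa> i = K i" "\<kappa> (m + i) = K' (Suc i)" "\<pi> i = 2 * i" "\<pi> (m + i) = Suc (2 * i)"
proof -
  have perm: "\<pi> permutes {0..<2*m}" and ch: "\<And>r. r < 2 * m \<Longrightarrow> \<pi> r = row_ix m r + dg (\<kappa> r)"
    using assms(1) by (auto simp: sylv_choices_def PiE_iff)
  have "Poly_Mapping.lookup (row_monomial m \<kappa>) v = Poly_Mapping.lookup (staircase m K K') v" for v
    using assms(2) by simp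
  hence look: "(\<Sum>i<m. if (False, \<kappa> i) = v then 1 else 0) + (\<Sum>i<m. if (True, \<kappa> (m + i)) = v then 1 else 0) =
      (\<Sum>i<m. if (False, K i) = v then 1 else 0) + (\<Sum>i<m. if (True, K' (Suc i)) = v then 1 else (0::nat))" for v
    unfolding row_monomial_split staircase_def
    by (simp add: lookup_add lookup_sum lookup_single when_def del: One_nat_def)
  have injK: "inj_on K {..<m}" by (rule inj_on_inverseI[of _ dg]) (simp add: K)
  have injK': "inj_on (\<lambda>i. K' (Suc i)) {..<m}" by (rule inj_on_inverseI[of _ "\<lambda>k. dg k - 1"]) (simp add: K')
  have b: "bij_betw \<kappa> {..<m} (K ` {..<m})"
  proof (rule bij_betw_if_equal_counts[OF _ injK])
    show "(\<Sum>i<m. if \<kappa> i = k then 1 else 0 :: nat) = (\<Sum>i<m. if K i = k then 1 else 0)" for k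
      using look[of "(False, k)"] by simp
  qed
  have b': "bij_betw (\<lambda>i. \<kappa> (m + i)) {..<m} ((\<lambda>i. K' (Suc i)) ` {..<m})"
  proof (rule bij_betw_if_equal_counts[OF _ injK'])
    show "(\<Sum>i<m. if \<kappa> (m + i) = k then 1 else 0 :: nat) = (\<Sum>i<m. if K' (Suc i) = k then 1 else 0)" for k
      using look[of "(True, k)"] by simp
  qed
  define p where "p i = dg (\<kappa> i)" for i
  define p' where "p' i = dg (\<kappa> (m + i)) - 1" for i
  have \<kappa>p: "\<kappa> i = K (p i)" if "i < m" for i
  proof -
    have "\<kappa> i \<in> K ` {..<m}" using b that by (auto simp: bij_betw_def)
    thus ?thesis by (auto simp: p_def K)
  qed
  have \<kappa>p': "\<kappa> (m + i) = K' (Suc (p' i)) \<and> dg (\<kappa> (m + i)) = Suc (p' i)" if "i < m" for i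
  proof -
    have "\<kappa> (m + i) \<in> (\<lambda>i. K' (Suc i)) ` {..<m}" using b' that by (auto simp: bij_betw_def)
    thus ?thesis by (auto simp: p'_def K')
  qed
  have "bij_betw dg (K ` {..<m}) {..<m}"
    by (rule bij_betwI[of _ _ _ K]) (auto simp: K)
  from bij_betw_trans[OF b this] have bp: "bij_betw p {..<m} {..<m}" by (simp add: p_def[abs_def] comp_def)
  have "bij_betw (\<lambda>k. dg k - 1) ((\<lambda>i. K' (Suc i)) ` {..<m}) {..<m}"
    by (rule bij_betwI[of _ _ _ "\<lambda>i. K' (Suc i)"]) (auto simp: K')
  from bij_betw_trans[OF b' this] have bp': "bij_betw p' {..<m} {..<m}" by (simp add: p'_def[abs_def] comp_def)
  have "(\<Sum>r\<in>{0..<2*m}. (\<pi> r)\<^sup>2) = (\<Sum>c\<in>{0..<2*m}. c\<^sup>2)"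
    using sum.permute[OF perm, of "\<lambda>c. c\<^sup>2"] by (simp add: comp_def)
  also have "(\<Sum>r\<in>{0..<2*m}. (\<pi> r)\<^sup>2) = (\<Sum>i<m. (i + p i)\<^sup>2) + (\<Sum>i<m. (i + p' i + 1)\<^sup>2)"
    unfolding split_rows
    by (intro arg_cong2[where f = "(+)"] sum.cong refl) (use conjunct2[OF \<kappa>p'] in \<open>simp_all add: ch row_ix_def p_def\<close>)
  finally have "(\<Sum>i<m. (i + p i)\<^sup>2) + (\<Sum>i<m. (i + p' i + 1)\<^sup>2) = (\<Sum>c<2*m. c\<^sup>2)"
    by (simp add: atLeast0LessThan)
  from staircase_rigid[OF bp bp' this i] have pp: "p i = i" "p' i = i" .
  show "\<kappa> i = K i" "\<kappa> (m + i) = K' (Suc i)" using \<kappa>p[OF i] \<kappa>p'[OF i] pp by simp_all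
  show "\<pi> i = 2 * i" "\<pi> (m + i) = Suc (2 * i)"
    using ch[of i] ch[of "m + i"] conjunct2[OF \<kappa>p'[OF i]] i pp by (auto simp: row_ix_def p_def)
qed

lemma permutes_interleave:
  "(\<lambda>r. if r < m then 2 * r else if r < 2 * m then Suc (2 * (r - m)) else r) permutes {0..<2*m}"
proof (rule bij_imp_permutes)
  show "bij_betw (\<lambda>r. if r < m then 2 * r else if r < 2 * m then Suc (2 * (r - m)) else r) {0..<2*m} {0..<2*m}"
    by (rule bij_betwI[of _ _ _ "\<lambda>c. if even c then c div 2 else m + c div 2"]) (auto elim!: oddE)
qed auto

text \<open>A single term of the expansion yields this monomial, so nothing can cancel: the
  coefficient is the sign of the permutation that interleaves the two blocks of rows.\<close>

lemma lookup_res_form_staircase: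
  assumes "finite A"
    and K: "\<And>i. i < m \<Longrightarrow> K i \<in> A \<and> dg (K i) = i" and K': "\<And>i. i < m \<Longrightarrow> K' (Suc i) \<in> A \<and> dg (K' (Suc i)) = Suc i"
  shows "Poly_Mapping.lookup (res_form A dg (\<lambda>_. 1) m) (staircase m K K') =
    of_int (sign (\<lambda>r. if r < m then 2 * r else if r < 2 * m then Suc (2 * (r - m)) else r))"
proof -
  define \<pi>0 where "\<pi>0 = (\<lambda>r. if r < m then 2 * r else if r < 2 * m then Suc (2 * (r - m)) else r)"
  define \<kappa>0 where "\<kappa>0 = (\<lambda>r\<in>{0..<2*m}. if r < m then K r else K' (Suc (r - m)))"
  have perm: "\<pi>0 permutes {0..<2*m}" unfolding \<pi>0_def by (rule permutes_interleave)
  have mem: "(\<pi>0, \<kappa>0) \<in> sylv_choices A dg m"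
    unfolding sylv_choices_def using perm K K' by (auto simp: \<pi>0_def \<kappa>0_def row_ix_def)
  have mono: "row_monomial m \<kappa>0 = staircase m K K'"
    unfolding row_monomial_split staircase_def by (simp add: \<kappa>0_def)
  have uniq: "row_monomial m (snd x) = staircase m K K' \<longleftrightarrow> x = (\<pi>0, \<kappa>0)" if "x \<in> sylv_choices A dg m" for x
  proof
    assume mx: "row_monomial m (snd x) = staircase m K K'"
    obtain \<pi> \<kappa> where x: "x = (\<pi>, \<kappa>)" by (cases x)
    note u = staircase_choice_unique[OF that[unfolded x] mx[unfolded x snd_conv], rule_format]
    have \<pi>: "\<pi> permutes {0..<2*m}" and \<kappa>: "\<kappa> \<in> extensional {0..<2*m}"
      using that by (auto simp: x sylv_choices_def PiE_iff)
    have "\<pi> r = \<pi>0 r \<and> \<kappa> r = \<kappa>0 r" for r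
    proof -
      consider "r < m" | "m \<le> r" "r < 2 * m" | "2 * m \<le> r" by linarith
      thus ?thesis
      proof cases
        case 1
        thus ?thesis using u[of r] K K' by (simp add: \<pi>0_def \<kappa>0_def)
      next
        case 2
        thus ?thesis using u[of "r - m"] K K' by (simp add: \<pi>0_def \<kappa>0_def)
      next
        case 3
        thus ?thesis using \<pi> \<kappa> by (simp add: \<pi>0_def \<kappa>0_def permutes_not_in extensional_def)
      qed
    qed
    thus "x = (\<pi>0, \<kappa>0)" by (auto simp: x)
  qed (simp add: mono)
  have "Poly_Mapping.lookup (res_form A dg (\<lambda>_. 1) m) (staircase m K K') =
      (\<Sum>x\<in>sylv_choices A dg m. if x = (\<pi>0, \<kappa>0) then of_int (sign \<pi>0) else 0)"
    unfolding lookup_res_form_one[OF assms(1)] split_beta by (rule sum.cong) (simp_all add: uniq)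
  also have "\<dots> = of_int (sign \<pi>0)"
    using mem finite_sylv_choices[OF assms(1)] by simp
  finally show ?thesis by (simp add: \<pi>0_def)
qed

section \<open>Morphisms of quasi-projective sets\<close>

lemma self_in_hclass: "x \<in> hclass x"
  by (auto simp: hclass_def intro: exI[of _ 1])

lemma hclassE:
  assumes "y \<in> hclass x"
  obtains s where "y = (\<lambda>i. s * x i)" "s \<noteq> 0"
  using assms unfolding hclass_def by blast

lemma hclass_scale: assumes "c \<noteq> 0" shows "hclass (\<lambda>i. c * x i) = hclass x"
proof (intro equalityI subsetI)
  fix y assume "y \<in> hclass (\<lambda>i. c * x i)"
  then obtain b where "y = (\<lambda>i. b * (c * x i))" "b \<noteq> 0" by (auto simp: hclass_def)
  thus "y \<in> hclass x" unfolding hclass_def using assms by (auto intro!: exI[of _ "b * c"])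
next
  fix y assume "y \<in> hclass x"
  then obtain b where "y = (\<lambda>i. b * x i)" "b \<noteq> 0" by (auto simp: hclass_def)
  thus "y \<in> hclass (\<lambda>i. c * x i)" unfolding hclass_def using assms by (auto intro!: exI[of _ "b / c"])
qed

lemma hclass_eqI: assumes "y \<in> hclass x" shows "hclass y = hclass x"
proof -
  obtain c where "y = (\<lambda>i. c * x i)" "c \<noteq> 0" using assms unfolding hclass_def by blast
  thus ?thesis by (simp add: hclass_scale)
qed

lemma hclass_in_pspace: "x \<noteq> (\<lambda>_. 0) \<Longrightarrow> hclass x \<in> pspace UNIV"
  by (auto simp: pspace_def supported_def)

lemma pspace_mono: "A \<subseteq> B \<Longrightarrow> pspace A \<subseteq> pspace B"
  unfolding pspace_def supported_def by blast

lemma pspace_elemE: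
  assumes "p \<in> pspace UNIV"
  obtains x where "p = hclass x" "x \<in> p" "x \<noteq> (\<lambda>_. 0)"
  using assms self_in_hclass unfolding pspace_def by blast

lemma pspace_nonempty: "p \<in> pspace UNIV \<Longrightarrow> \<exists>x. x \<in> p"
  using pspace_elemE by metis

lemma pspace_elem_hclass:
  assumes "p \<in> pspace UNIV" "x \<in> p"
  shows "p = hclass x" "x \<noteq> (\<lambda>_. 0)"
proof -
  obtain y where y: "p = hclass y" "y \<noteq> (\<lambda>_. 0)" using assms(1) by (rule pspace_elemE)
  show "p = hclass x" using hclass_eqI[of x y] assms(2) y by simp
  show "x \<noteq> (\<lambda>_. 0)" using assms(2) y(2) unfolding y(1) hclass_def by (auto simp: fun_eq_iff)
qed

lemma openin_nonvanishing:
  assumes "homogeneous e F"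
  shows "openin zariski {p \<in> pspace UNIV. \<not> pvanish F p}"
  unfolding openin_zariski by (intro exI[of _ "{F}"]) (use assms in auto)

lemma pvanish_iff:
  assumes "homogeneous e F" "p \<in> pspace UNIV" "x \<in> p"
  shows "pvanish F p \<longleftrightarrow> peval F x = 0"
  using pvanish_hclass[OF assms(1), of x] pspace_elem_hclass(1)[OF assms(2,3)] by simp

lemma zariski_open_basis:
  assumes "openin zariski U" "p \<in> U"
  obtains e F where "homogeneous e F" "\<not> pvanish F p" "{q \<in> pspace UNIV. \<not> pvanish F q} \<subseteq> U"
proof -
  obtain S where S: "\<forall>F\<in>S. \<exists>e. homogeneous e F" "U = pspace UNIV - {p. \<forall>F\<in>S. pvanish F p}"
    using assms(1) unfolding openin_zariski by (elim exE conjE) (rule that)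
  obtain F where F: "F \<in> S" "\<not> pvanish F p" using assms(2) S(2) by auto
  obtain e where "homogeneous e F" using S(1) F(1) by auto
  moreover have "{q \<in> pspace UNIV. \<not> pvanish F q} \<subseteq> U" unfolding S(2) using F(1) by auto
  ultimately show ?thesis using F(2) by (intro that)
qed

lemma morphism_maps_to:
  assumes "morphism X Y f" "X \<subseteq> pspace UNIV" "p \<in> X"
  shows "f p \<in> Y"
proof -
  have "f \<in> topspace (zar X) \<rightarrow> topspace (zar Y)" using assms(1) by (auto simp: morphism_def continuous_map_def)
  thus ?thesis using assms(2,3) by (auto simp: topspace_zariski)
qed

lemma morphism_preimage_open:
  assumes "morphism X Y f" "X \<subseteq> pspace UNIV" "openin (zar Y) V"
  shows "openin (zar X) (X \<inter> f -` V)"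
proof -
  have "openin (zar X) {x \<in> topspace (zar X). f x \<in> V}"
    using assms by (auto simp: morphism_def continuous_map_def)
  moreover have "{x \<in> topspace (zar X). f x \<in> V} = X \<inter> f -` V"
    using assms(2) by (auto simp: topspace_zariski)
  ultimately show ?thesis by simp
qed

lemma morphism_regular:
  "morphism X Y f \<Longrightarrow> openin (zar Y) V \<Longrightarrow> regular_on V h \<Longrightarrow> regular_on (X \<inter> f -` V) (h \<circ> f)"
  unfolding morphism_def by blast

lemma morphism_continuous: "morphism X Y f \<Longrightarrow> continuous_map (zar X) (zar Y) f"
  unfolding morphism_def by blast

lemma regular_onE:
  assumes "regular_on U f" "p \<in> U"
  obtains W e F G where "openin zariski W" "p \<in> W" "homogeneous e F" "homogeneous e G"
    "\<forall>q\<in>W \<inter> U. \<forall>x\<in>q. peval G x \<noteq> 0 \<and> f q = peval F x / peval G x"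
  using bspec[OF assms(1)[unfolded regular_on_def] assms(2)] by (elim exE conjE) (rule that)

lemma regular_onI:
  assumes "\<And>p. p \<in> U \<Longrightarrow> \<exists>W e F G. openin zariski W \<and> p \<in> W \<and> homogeneous e F \<and> homogeneous e G \<and>
      (\<forall>q\<in>W \<inter> U. \<forall>x\<in>q. peval G x \<noteq> 0 \<and> f q = peval F x / peval G x)"
  shows "regular_on U f"
  unfolding regular_on_def by (rule ballI) (rule assms)

lemma regular_on_subset:
  assumes "regular_on U f" "V \<subseteq> U"
  shows "regular_on V f"
proof (rule regular_onI)
  fix p assume "p \<in> V"
  hence "p \<in> U" using assms(2) by blast
  with assms(1) obtain W e F G where *: "openin zariski W" "p \<in> W" "homogeneous e F" "homogeneous e G"
    "\<forall>q\<in>W \<inter> U. \<forall>x\<in>q. peval G x \<noteq> 0 \<and> f q = peval F x / peval G x"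
    by (rule regular_onE)
  have "\<forall>q\<in>W \<inter> V. \<forall>x\<in>q. peval G x \<noteq> 0 \<and> f q = peval F x / peval G x"
  proof
    fix q assume "q \<in> W \<inter> V"
    hence "q \<in> W \<inter> U" using assms(2) by blast
    thus "\<forall>x\<in>q. peval G x \<noteq> 0 \<and> f q = peval F x / peval G x" by (rule bspec[OF *(5)])
  qed
  with *(1-4) show "\<exists>W e F G. openin zariski W \<and> p \<in> W \<and> homogeneous e F \<and> homogeneous e G \<and>
      (\<forall>q\<in>W \<inter> V. \<forall>x\<in>q. peval G x \<noteq> 0 \<and> f q = peval F x / peval G x)"
    by (intro exI[of _ W] exI[of _ e] exI[of _ F] exI[of _ G] conjI)
qed

lemma morphism_id: "morphism X X (\<lambda>p. p)"
proof -
  have "regular_on (X \<inter> (\<lambda>p. p) -` V) (h \<circ> (\<lambda>p. p))" if "regular_on V h" for V h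
  proof -
    have "regular_on (X \<inter> V) h" by (rule regular_on_subset[OF that]) simp
    thus ?thesis by (simp add: comp_def)
  qed
  thus ?thesis using continuous_map_id[of "zar X"] by (simp add: morphism_def id_def)
qed

lemma morphism_compose:
  assumes f: "morphism X Y f" and g: "morphism Y Z g" and "X \<subseteq> pspace UNIV" "Y \<subseteq> pspace UNIV"
  shows "morphism X Z (\<lambda>p. g (f p))"
proof -
  have cont: "continuous_map (zar X) (zar Z) (\<lambda>p. g (f p))"
    using continuous_map_compose[of "zar X" "zar Y" f "zar Z" g] f g by (simp add: morphism_def comp_def)
  have "regular_on (X \<inter> (\<lambda>p. g (f p)) -` V) (h \<circ> (\<lambda>p. g (f p)))"
    if V: "openin (zar Z) V" "regular_on V h" for V h
  proof -
    have "regular_on (Y \<inter> g -` V) (h \<circ> g)" by (rule morphism_regular[OF g V])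
    moreover have "openin (zar Y) (Y \<inter> g -` V)" using morphism_preimage_open[OF g assms(4) V(1)] .
    ultimately have "regular_on (X \<inter> f -` (Y \<inter> g -` V)) ((h \<circ> g) \<circ> f)" by (intro morphism_regular[OF f])
    moreover have "X \<inter> f -` (Y \<inter> g -` V) = X \<inter> (\<lambda>p. g (f p)) -` V"
      using morphism_maps_to[OF f assms(3)] by auto
    ultimately show ?thesis by (simp add: comp_def)
  qed
  with cont show ?thesis by (simp add: morphism_def)
qed

lemma morphism_restrict_domain:
  assumes f: "morphism X Y f" and "X' \<subseteq> X"
  shows "morphism X' Y f"
proof -
  have "continuous_map (subtopology (zar X) X') (zar Y) f"
    by (rule continuous_map_from_subtopology[OF morphism_continuous[OF f]])
  moreover have "subtopology (zar X) X' = zar X'"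
    using assms(2) by (simp add: subtopology_subtopology Int_absorb1)
  moreover have "regular_on (X' \<inter> f -` V) (h \<circ> f)" if "openin (zar Y) V" "regular_on V h" for V h
  proof -
    have "regular_on (X \<inter> f -` V) (h \<circ> f)" by (rule morphism_regular[OF f that])
    thus ?thesis by (rule regular_on_subset) (use assms(2) in auto)
  qed
  ultimately show ?thesis by (simp add: morphism_def)
qed

lemma morphism_enlarge_codomain:
  assumes f: "morphism X Y f" and "Y \<subseteq> Z" "X \<subseteq> pspace UNIV"
  shows "morphism X Z f"
proof -
  have YZ: "subtopology (zar Z) Y = zar Y" using assms(2) by (simp add: subtopology_subtopology Int_absorb1)
  have "continuous_map (zar X) (zar Z) f"
    using morphism_continuous[OF f] unfolding YZ[symmetric] continuous_map_in_subtopology by blast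
  moreover have "regular_on (X \<inter> f -` V) (h \<circ> f)" if V: "openin (zar Z) V" "regular_on V h" for V h
  proof -
    have "openin (zar Y) (V \<inter> Y)" using openin_subtopology_Int[OF V(1), of Y] unfolding YZ .
    hence "regular_on (X \<inter> f -` (V \<inter> Y)) (h \<circ> f)" by (rule morphism_regular[OF f _ regular_on_subset[OF V(2)]]) simp
    moreover have "X \<inter> f -` (V \<inter> Y) = X \<inter> f -` V" using morphism_maps_to[OF f assms(3)] by auto
    ultimately show ?thesis by simp
  qed
  ultimately show ?thesis by (simp add: morphism_def)
qed

text \<open>Polynomials on the target pull back by \<open>psubst\<close>, homogeneously because all
  components have the same degree on \<open>W\<close>. Hence basic open sets have open preimages,
  and local quotients pull back to local quotients.\<close>

lemma morphism_if_locally_polynomial: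
  assumes X: "X \<subseteq> pspace UNIV" and maps: "\<And>p. p \<in> X \<Longrightarrow> f p \<in> Z" and Z: "Z \<subseteq> pspace UNIV"
    and loc: "\<And>p. p \<in> X \<Longrightarrow> \<exists>W e G. openin zariski W \<and> p \<in> W \<and> (\<forall>a. homogeneous e (G a)) \<and>
       (\<forall>q\<in>W \<inter> X. \<forall>y\<in>q. f q = hclass (\<lambda>a. peval (G a) y))"
  shows "morphism X Z f"
proof -
  have topX: "topspace (zar X) = X" and topZ: "topspace (zar Z) = Z"
    using X Z by (auto simp: topspace_zariski)
  have pre: "openin (zar X) {x \<in> X. f x \<in> V}" if V: "openin (zar Z) V" for V
  proof (subst openin_subopen, intro ballI)
    fix p assume "p \<in> {x \<in> X. f x \<in> V}"
    hence p: "p \<in> X" "f p \<in> V" by auto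
    obtain V' where V': "openin zariski V'" "V = V' \<inter> Z" using V by (auto simp: openin_subtopology)
    have "f p \<in> V'" using p(2) V'(2) by simp
    from zariski_open_basis[OF V'(1) this] obtain e' F where
      F: "homogeneous e' F" "\<not> pvanish F (f p)" "{q \<in> pspace UNIV. \<not> pvanish F q} \<subseteq> V'" .
    obtain W e G where W': "openin zariski W" "p \<in> W" "\<forall>a. homogeneous e (G a)"
      and fG': "\<forall>q\<in>W \<inter> X. \<forall>y\<in>q. f q = hclass (\<lambda>a. peval (G a) y)"
      using loc[OF p(1)] by (elim exE conjE) (rule that)
    note W = W'(1,2) spec[OF W'(3)] and fG = bspec[OF bspec[OF fG']]
    have hom: "homogeneous (e * e') (psubst F G)" by (rule homogeneous_psubst[OF F(1) W(3)])
    have key: "pvanish (psubst F G) q \<longleftrightarrow> pvanish F (f q)" if q: "q \<in> W \<inter> X" for q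
    proof -
      obtain y where y: "y \<in> q" using q X pspace_nonempty by blast
      have "pvanish (psubst F G) q \<longleftrightarrow> peval F (\<lambda>a. peval (G a) y) = 0"
        using q X pvanish_iff[OF hom _ y] by (auto simp: peval_psubst)
      thus ?thesis using fG[OF q y] pvanish_hclass[OF F(1)] by simp
    qed
    define O' where "O' = W \<inter> {q \<in> pspace UNIV. \<not> pvanish (psubst F G) q}"
    have "openin zariski O'" unfolding O'_def by (intro openin_Int W openin_nonvanishing[OF hom])
    hence "openin (zar X) (O' \<inter> X)" by (auto simp: openin_subtopology)
    moreover have "p \<in> O' \<inter> X" using p W X F(2) key by (auto simp: O'_def)
    moreover have "O' \<inter> X \<subseteq> {x \<in> X. f x \<in> V}"
    proof
      fix q assume q: "q \<in> O' \<inter> X"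
      hence "\<not> pvanish F (f q)" using key by (auto simp: O'_def)
      moreover have "f q \<in> Z" using maps q by blast
      ultimately have "f q \<in> V'" using F(3) Z by auto
      thus "q \<in> {x \<in> X. f x \<in> V}" using \<open>f q \<in> Z\<close> q V'(2) by simp
    qed
    ultimately show "\<exists>T. openin (zar X) T \<and> p \<in> T \<and> T \<subseteq> {x \<in> X. f x \<in> V}"
      by (intro exI[of _ "O' \<inter> X"] conjI)
  qed
  have "continuous_map (zar X) (zar Z) f"
    unfolding continuous_map_def topX topZ by (simp add: Pi_iff maps pre)
  moreover have "regular_on (X \<inter> f -` V) (h \<circ> f)" if V: "openin (zar Z) V" and h: "regular_on V h" for V h
  proof (rule regular_onI)
    fix p assume "p \<in> X \<inter> f -` V"
    hence p: "p \<in> X" "f p \<in> V" by auto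
    obtain W2 e2 F1 F2 where W2: "openin zariski W2" "f p \<in> W2" "homogeneous e2 F1" "homogeneous e2 F2"
      and hF: "\<forall>q\<in>W2 \<inter> V. \<forall>x\<in>q. peval F2 x \<noteq> 0 \<and> h q = peval F1 x / peval F2 x"
      by (rule regular_onE[OF h p(2)])
    obtain W e G where W': "openin zariski W" "p \<in> W" "\<forall>a. homogeneous e (G a)"
      and fG': "\<forall>q\<in>W \<inter> X. \<forall>y\<in>q. f q = hclass (\<lambda>a. peval (G a) y)"
      using loc[OF p(1)] by (elim exE conjE) (rule that)
    note W = W'(1,2) spec[OF W'(3)] and fG = bspec[OF bspec[OF fG']]
    have "openin (zar X) {x \<in> X. f x \<in> W2 \<inter> Z}" by (rule pre) (use W2(1) in \<open>auto simp: openin_subtopology\<close>)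
    then obtain O' where O': "openin zariski O'" "{x \<in> X. f x \<in> W2 \<inter> Z} = O' \<inter> X" by (auto simp: openin_subtopology)
    have "p \<in> O'" using O'(2) p W2(2) maps by blast
    moreover have "peval (psubst F2 G) y \<noteq> 0 \<and> (h \<circ> f) q = peval (psubst F1 G) y / peval (psubst F2 G) y"
      if q: "q \<in> (W \<inter> O') \<inter> (X \<inter> f -` V)" and y: "y \<in> q" for q y
    proof -
      have "f q = hclass (\<lambda>a. peval (G a) y)" by (rule fG) (use q y in auto)
      hence "(\<lambda>a. peval (G a) y) \<in> f q" using self_in_hclass by simp
      moreover have "f q \<in> W2 \<inter> V" using q O'(2) by blast
      ultimately show ?thesis using hF by (simp add: peval_psubst)
    qed
    ultimately show "\<exists>W e F G. openin zariski W \<and> p \<in> W \<and> homogeneous e F \<and> homogeneous e G \<and>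
       (\<forall>q\<in>W \<inter> (X \<inter> f -` V). \<forall>x\<in>q. peval G x \<noteq> 0 \<and> (h \<circ> f) q = peval F x / peval G x)"
      using W(2)
      by (intro exI[of _ "W \<inter> O'"] exI[of _ "e * e2"] exI[of _ "psubst F1 G"] exI[of _ "psubst F2 G"] conjI
            openin_Int W(1) O'(1) homogeneous_psubst[OF W2(3) W(3)] homogeneous_psubst[OF W2(4) W(3)] ballI) simp_all
  qed
  ultimately show ?thesis by (simp add: morphism_def)
qed

text \<open>Separatedness of projective space: some affine chart \<open>L \<noteq> 0\<close>
  contains both points, and one of its affine coordinates tells them apart.\<close>

lemma ex_separating_quotient:
  assumes "p \<in> pspace UNIV" "q \<in> pspace UNIV" "p \<noteq> q"
  obtains L k where "homogeneous 1 L" "\<not> pvanish L p" "\<not> pvanish L q"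
    "\<And>a b. a \<in> p \<Longrightarrow> b \<in> q \<Longrightarrow> a k / peval L a \<noteq> b k / peval L b"
proof -
  obtain a where a: "p = hclass a" "a \<in> p" "a \<noteq> (\<lambda>_. 0)" using assms(1) by (rule pspace_elemE)
  obtain b where b: "q = hclass b" "b \<in> q" "b \<noteq> (\<lambda>_. 0)" using assms(2) by (rule pspace_elemE)
  obtain i where i: "a i \<noteq> 0" using a(3) by auto
  obtain j where j: "b j \<noteq> 0" using b(3) by auto
  \<comment> \<open>Each of the two conditions excludes at most one \<open>c\<close>; one of 0, 1, 2
    always works.\<close>
  have "\<exists>c. a i + c * a j \<noteq> 0 \<and> b i + c * b j \<noteq> 0"
  proof (cases "b i = 0")
    case False thus ?thesis using i by (intro exI[of _ 0]) simp
  next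
    case bi: True
    show ?thesis
    proof (cases "a i + a j = 0")
      case False thus ?thesis using bi j by (intro exI[of _ 1]) simp
    next
      case True
      hence "a j = - a i" by (simp add: add_eq_0_iff)
      thus ?thesis using bi i j by (intro exI[of _ 2]) simp
    qed
  qed
  then obtain c where c: "a i + c * a j \<noteq> 0" "b i + c * b j \<noteq> 0" by blast
  define L where "L = Var i + Poly_Mapping.single 0 c * Var j"
  have L: "homogeneous 1 L" unfolding L_def by (intro homogeneous_add homogeneous_Var homogeneous_const_mult)
  have La: "peval L a \<noteq> 0" and Lb: "peval L b \<noteq> 0" using c by (simp_all add: L_def peval_add peval_mult)
  have "\<exists>k. a k / peval L a \<noteq> b k / peval L b"
  proof (rule ccontr)
    assume "\<not> ?thesis"
    hence "a = (\<lambda>k. peval L a / peval L b * b k)" using La Lb by (auto simp: field_simps)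
    hence "hclass a = hclass b" using hclass_scale[of "peval L a / peval L b" b] La Lb by simp
    thus False using a b assms(3) by simp
  qed
  then obtain k where k: "a k / peval L a \<noteq> b k / peval L b" ..
  have inv: "x k / peval L x = y k / peval L y" if xy: "x \<in> hclass y" for x y
  proof -
    obtain s where s: "x = (\<lambda>i. s * y i)" "s \<noteq> 0" using xy by (rule hclassE)
    have "peval L x = s * peval L y" using peval_scale[OF L, of s y] s by simp
    thus ?thesis using s by simp
  qed
  show ?thesis
  proof (rule that[OF L])
    show "\<not> pvanish L p" "\<not> pvanish L q" using pvanish_hclass[OF L] La Lb a(1) b(1) by simp_all
    show "x k / peval L x \<noteq> y k / peval L y" if "x \<in> p" "y \<in> q" for x y
      using k inv[of x a] inv[of y b] that a(1) b(1) by simp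
  qed
qed

text \<open>If the images of \<open>p\<close> differ, a regular function separates them. Its
  pullbacks along \<open>f\<close> and \<open>g\<close> are quotients near \<open>p\<close>, and
  they stay different on a neighbourhood of \<open>p\<close>, which has to meet
  \<open>S\<close>.\<close>

lemma morphisms_agree_if_agree_on_dense:
  assumes f: "morphism X Z f" and g: "morphism X Z g" and X: "X \<subseteq> pspace UNIV" and Z: "Z \<subseteq> pspace UNIV"
    and S: "S \<subseteq> X" "X \<subseteq> zariski closure_of S" and eq: "\<And>q. q \<in> S \<Longrightarrow> f q = g q" and p: "p \<in> X"
  shows "f p = g p"
proof (rule ccontr)
  assume ne: "f p \<noteq> g p"
  have fp: "f p \<in> Z" "g p \<in> Z" using morphism_maps_to[OF f X p] morphism_maps_to[OF g X p] .
  obtain L k where L: "homogeneous 1 L" "\<not> pvanish L (f p)" "\<not> pvanish L (g p)"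
    and sep: "\<And>a b. a \<in> f p \<Longrightarrow> b \<in> g p \<Longrightarrow> a k / peval L a \<noteq> b k / peval L b"
    using ex_separating_quotient[of "f p" "g p"] fp Z ne by blast
  define V where "V = Z \<inter> {q \<in> pspace UNIV. \<not> pvanish L q}"
  define h where "h q = (SOME x. x \<in> q) k / peval L (SOME x. x \<in> q)" for q :: "'b ppoint"
  have openV: "openin (zar Z) V" using openin_nonvanishing[OF L(1)] unfolding V_def openin_subtopology by blast
  have hx: "peval L x \<noteq> 0 \<and> h q = x k / peval L x" if "q \<in> V" "x \<in> q" for q x
  proof -
    have q: "q \<in> pspace UNIV" "\<not> pvanish L q" using that by (auto simp: V_def)
    define y where "y = (SOME x. x \<in> q)"
    have "y \<in> q" unfolding y_def by (rule someI[of "\<lambda>x. x \<in> q" x]) (rule that(2))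
    hence "y \<in> hclass x" using pspace_elem_hclass(1)[OF q(1) that(2)] by simp
    then obtain s where s: "y = (\<lambda>i. s * x i)" "s \<noteq> 0" by (rule hclassE)
    have "peval L y = s * peval L x" using peval_scale[OF L(1), of s x] s by simp
    thus ?thesis using s pvanish_iff[OF L(1) q(1) that(2)] q(2) by (simp add: h_def flip: y_def)
  qed
  have regh: "regular_on V h"
  proof (rule regular_onI)
    fix q assume "q \<in> V"
    thus "\<exists>W e F G. openin zariski W \<and> q \<in> W \<and> homogeneous e F \<and> homogeneous e G \<and>
        (\<forall>r\<in>W \<inter> V. \<forall>x\<in>r. peval G x \<noteq> 0 \<and> h r = peval F x / peval G x)"
      using openin_nonvanishing[OF L(1)] L(1) homogeneous_Var[of k] hx
      by (intro exI[of _ "{q \<in> pspace UNIV. \<not> pvanish L q}"] exI[of _ 1] exI[of _ "Var k"] exI[of _ L])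
         (auto simp: V_def)
  qed
  have pV: "f p \<in> V" "g p \<in> V" using fp Z L by (auto simp: V_def)
  have reg1: "regular_on (X \<inter> f -` V) (h \<circ> f)" by (rule morphism_regular[OF f openV regh])
  obtain W1 e1 F1 G1 where W1: "openin zariski W1" "p \<in> W1" "homogeneous e1 F1" "homogeneous e1 G1"
    and h1: "\<forall>q\<in>W1 \<inter> (X \<inter> f -` V). \<forall>x\<in>q. peval G1 x \<noteq> 0 \<and> (h \<circ> f) q = peval F1 x / peval G1 x"
    by (rule regular_onE[OF reg1]) (use p pV(1) in blast)
  have reg2: "regular_on (X \<inter> g -` V) (h \<circ> g)" by (rule morphism_regular[OF g openV regh])
  obtain W2 e2 F2 G2 where W2: "openin zariski W2" "p \<in> W2" "homogeneous e2 F2" "homogeneous e2 G2"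
    and h2: "\<forall>q\<in>W2 \<inter> (X \<inter> g -` V). \<forall>x\<in>q. peval G2 x \<noteq> 0 \<and> (h \<circ> g) q = peval F2 x / peval G2 x"
    by (rule regular_onE[OF reg2]) (use p pV(2) in blast)
  obtain O1 where O1: "openin zariski O1" "X \<inter> f -` V = O1 \<inter> X"
    using morphism_preimage_open[OF f X openV] by (auto simp: openin_subtopology)
  obtain O2 where O2: "openin zariski O2" "X \<inter> g -` V = O2 \<inter> X"
    using morphism_preimage_open[OF g X openV] by (auto simp: openin_subtopology)
  \<comment> \<open>The numerator of the difference of the two pullbacks.\<close>
  define D where "D = F1 * G2 - F2 * G1"
  have D: "homogeneous (e1 + e2) D" unfolding D_def
    using homogeneous_mult[OF W1(3) W2(4)] homogeneous_mult[OF W2(3) W1(4)] by (intro homogeneous_diff) (simp_all add: add.commute)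
  have Dx: "peval D x = 0 \<longleftrightarrow> h (f q) = h (g q)" if "q \<in> X" "q \<in> W1" "q \<in> W2" "q \<in> O1" "q \<in> O2" "x \<in> q" for q x
  proof -
    have "q \<in> W1 \<inter> (X \<inter> f -` V)" "q \<in> W2 \<inter> (X \<inter> g -` V)" using that O1(2) O2(2) by blast+
    hence "peval G1 x \<noteq> 0 \<and> h (f q) = peval F1 x / peval G1 x" "peval G2 x \<noteq> 0 \<and> h (g q) = peval F2 x / peval G2 x"
      using h1 h2 that(6) by (auto simp: comp_def)
    thus ?thesis by (simp add: D_def peval_diff peval_mult field_simps)
  qed
  define O' where "O' = W1 \<inter> W2 \<inter> O1 \<inter> O2 \<inter> {q \<in> pspace UNIV. \<not> pvanish D q}"
  have "openin zariski O'" unfolding O'_def by (intro openin_Int W1 W2 O1 O2 openin_nonvanishing[OF D])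
  moreover have "p \<in> O'"
  proof -
    obtain x where x: "x \<in> p" using p X pspace_nonempty by blast
    obtain a where a: "a \<in> f p" using fp Z pspace_nonempty by blast
    obtain b where b: "b \<in> g p" using fp Z pspace_nonempty by blast
    have "h (f p) \<noteq> h (g p)" using sep[OF a b] hx[OF pV(1) a] hx[OF pV(2) b] by simp
    moreover have "p \<in> O1" "p \<in> O2" using p pV O1(2) O2(2) by blast+
    ultimately have "peval D x \<noteq> 0" using Dx[OF p W1(2) W2(2) _ _ x] by simp
    thus ?thesis using \<open>p \<in> O1\<close> \<open>p \<in> O2\<close> W1(2) W2(2) p X pvanish_iff[OF D _ x] by (auto simp: O'_def)
  qed
  moreover have "p \<in> zariski closure_of S" using p S(2) by blast
  ultimately obtain q where q: "q \<in> S" "q \<in> O'" unfolding in_closure_of by blast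
  obtain x where x: "x \<in> q" using q S(1) X pspace_nonempty by blast
  have "peval D x = 0" using Dx[of q x] q x S(1) eq by (auto simp: O'_def)
  thus False using q pvanish_iff[OF D _ x] by (auto simp: O'_def)
qed

section \<open>Open sets of irreducible varieties and lifts along birational morphisms\<close>

lemma irreducible_opens_meet:
  assumes "irreducible_in zariski N" "openin (zar N) U" "U \<noteq> {}" "openin (zar N) V" "V \<noteq> {}"
  shows "U \<inter> V \<noteq> {}"
proof
  assume UV: "U \<inter> V = {}"
  obtain U' V' where U': "openin zariski U'" "U = U' \<inter> N" and V': "openin zariski V'" "V = V' \<inter> N"
    using assms(2,4) by (auto simp: openin_subtopology)
  have N: "N \<subseteq> topspace zariski" using assms(1) by (simp add: irreducible_in_def)
  have "N \<subseteq> (topspace zariski - U') \<union> (topspace zariski - V')" using N UV U' V' by auto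
  hence "N \<subseteq> topspace zariski - U' \<or> N \<subseteq> topspace zariski - V'"
    using assms(1) U'(1) V'(1) unfolding irreducible_in_def by blast
  thus False using assms(3,5) U' V' by auto
qed

lemma irreducible_open_dense:
  assumes "irreducible_in zariski N" "openin (zar N) U" "U \<noteq> {}"
  shows "N \<subseteq> zariski closure_of U"
proof
  fix p assume p: "p \<in> N"
  have "\<exists>y\<in>U. y \<in> T" if "p \<in> T" "openin zariski T" for T
    using irreducible_opens_meet[OF assms, of "T \<inter> N"] that p by (auto simp: openin_subtopology)
  moreover have "p \<in> topspace zariski" using assms(1) p by (auto simp: irreducible_in_def)
  ultimately show "p \<in> zariski closure_of U" unfolding in_closure_of by blast
qed

text \<open>A left inverse of \<open>\<rho>\<close> on the target of a birational morphism \<open>\<pi>\<close> inverts every lift of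
  \<open>\<rho>\<close> along \<open>\<pi>\<close>: by separatedness it suffices that the image of the lift is dense, and it is
  since \<open>\<pi>\<close> is injective over an open set.\<close>

theorem lift_is_isomorphism:
  assumes N: "variety N" and T: "T \<subseteq> pspace UNIV" and Y: "Y \<subseteq> pspace UNIV"
    and \<rho>: "morphism T Y \<rho>" and \<rho>t: "morphism T N \<rho>t" and \<pi>: "birational_morphism N Y \<pi>"
    and lift: "\<And>p. p \<in> T \<Longrightarrow> \<rho> p = \<pi> (\<rho>t p)" and dense: "Y \<subseteq> zariski closure_of (\<rho> ` T)"
    and g: "morphism Y T g" and inv: "\<And>p. p \<in> T \<Longrightarrow> g (\<rho> p) = p"
  shows "isomorphism T N \<rho>t"
proof -
  have irr: "irreducible_in zariski N" using N by (simp add: variety_def)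
  have Np: "N \<subseteq> pspace UNIV" using irr by (simp add: irreducible_in_def topspace_zariski)
  have \<pi>m: "morphism N Y \<pi>" using \<pi> by (simp add: birational_morphism_def)
  obtain U V where U: "openin (zar N) U" "U \<noteq> {}" and V: "openin (zar Y) V" "V \<noteq> {}" and iso: "isomorphism U V \<pi>"
    using \<pi> by (auto simp: birational_morphism_def)
  obtain h where h: "morphism V U h" "\<And>p. p \<in> U \<Longrightarrow> h (\<pi> p) = p" "\<And>q. q \<in> V \<Longrightarrow> \<pi> (h q) = q"
    using iso by (auto simp: isomorphism_def)
  have UN: "U \<subseteq> N" and VY: "V \<subseteq> Y" using openin_imp_subset[OF U(1)] openin_imp_subset[OF V(1)] .
  have Vp: "V \<subseteq> pspace UNIV" using VY Y by blast
  have \<pi>U: "\<pi> p \<in> V" if "p \<in> U" for p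
    using morphism_maps_to[of U V \<pi> p] iso that UN Np by (auto simp: isomorphism_def)
  \<comment> \<open>The isomorphism relates \<open>U\<close> to \<open>V\<close>, but a priori
    further points of \<open>N\<close> may lie over \<open>V\<close>. They do not: \<open>h\<close>
    after \<open>\<pi>\<close> agrees with the identity on \<open>U\<close>, hence on the whole
    preimage \<open>N'\<close> by density, and its values lie in \<open>U\<close>.\<close>
  define N' where "N' = N \<inter> \<pi> -` V"
  have N'N: "N' \<subseteq> N" and UN': "U \<subseteq> N'" using UN \<pi>U by (auto simp: N'_def)
  have N'p: "N' \<subseteq> pspace UNIV" using N'N Np by blast
  have \<pi>N': "morphism N' V \<pi>"
  proof -
    have "continuous_map (zar N') (zar Y) \<pi>"
      using morphism_restrict_domain[OF \<pi>m N'N] by (simp add: morphism_def)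
    moreover have VYs: "subtopology (zar Y) V = zar V" using VY by (simp add: subtopology_subtopology Int_absorb1)
    ultimately have "continuous_map (zar N') (zar V) \<pi>"
      unfolding VYs[symmetric] continuous_map_in_subtopology by (auto simp: N'_def)
    moreover have "regular_on (N' \<inter> \<pi> -` O') (f \<circ> \<pi>)" if O': "openin (zar V) O'" "regular_on O' f" for O' f
    proof -
      have "openin (zar Y) O'" using openin_trans_full[of "zar Y" V O'] O'(1) V(1) unfolding VYs by blast
      hence "regular_on (N \<inter> \<pi> -` O') (f \<circ> \<pi>)" by (rule morphism_regular[OF \<pi>m _ O'(2)])
      thus ?thesis by (rule regular_on_subset) (use N'N in auto)
    qed
    ultimately show ?thesis by (simp add: morphism_def)
  qed
  have "morphism N' U (\<lambda>p. h (\<pi> p))" by (rule morphism_compose[OF \<pi>N' h(1) N'p Vp])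
  hence m1: "morphism N' N (\<lambda>p. h (\<pi> p))" by (rule morphism_enlarge_codomain[OF _ UN N'p])
  have m2: "morphism N' N (\<lambda>p. p)" by (rule morphism_enlarge_codomain[OF morphism_id N'N N'p])
  have dU: "N' \<subseteq> zariski closure_of U" using irreducible_open_dense[OF irr U] N'N by blast
  have hpi: "h (\<pi> p) = p" if "p \<in> N'" for p
    by (rule morphisms_agree_if_agree_on_dense[OF m1 m2 N'p Np UN' dU h(2) that])
  have N'U: "N' \<subseteq> U"
  proof
    fix p assume p: "p \<in> N'"
    have "h (\<pi> p) \<in> U" by (rule morphism_maps_to[OF h(1) Vp]) (use p in \<open>auto simp: N'_def\<close>)
    thus "p \<in> U" using hpi[OF p] by simp
  qed
  \<comment> \<open>A nonempty open set of \<open>N\<close> meets \<open>U\<close>; its image under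
    \<open>\<pi>\<close> is open in the target and so contains some \<open>\<rho> t\<close>. Since
    only \<open>U\<close> lies over \<open>V\<close>, the point \<open>\<rho>t t\<close> is in the
    given open set.\<close>
  have dense_t: "N \<subseteq> zariski closure_of (\<rho>t ` T)"
  proof
    fix p0 assume p0: "p0 \<in> N"
    have "\<exists>y\<in>\<rho>t ` T. y \<in> O'" if O': "p0 \<in> O'" "openin zariski O'" for O'
    proof -
      have ON: "openin (zar N) (O' \<inter> N)" "O' \<inter> N \<noteq> {}" using O' p0 by (auto simp: openin_subtopology)
      have "(O' \<inter> N) \<inter> U \<noteq> {}" by (rule irreducible_opens_meet[OF irr ON U])
      then obtain q where q: "q \<in> O'" "q \<in> U" by blast
      have "openin (zar U) (O' \<inter> U)" using O'(2) by (auto simp: openin_subtopology)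
      hence "openin (zar V) (V \<inter> h -` (O' \<inter> U))" by (rule morphism_preimage_open[OF h(1) Vp])
      moreover have "subtopology (zar Y) V = zar V" using VY by (simp add: subtopology_subtopology Int_absorb1)
      ultimately have "openin (subtopology (zar Y) V) (V \<inter> h -` (O' \<inter> U))" by simp
      hence "openin (zar Y) (V \<inter> h -` (O' \<inter> U))" using V(1) by (rule openin_trans_full)
      then obtain B where B: "openin zariski B" "V \<inter> h -` (O' \<inter> U) = B \<inter> Y" by (auto simp: openin_subtopology)
      have "\<pi> q \<in> B \<inter> Y" unfolding B(2)[symmetric] using q \<pi>U[OF q(2)] h(2)[OF q(2)] by simp
      hence \<pi>q: "\<pi> q \<in> zariski closure_of (\<rho> ` T)" "\<pi> q \<in> B" using subsetD[OF dense] by simp_all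
      obtain t where t: "t \<in> T" "\<rho> t \<in> B" using \<pi>q B(1) unfolding in_closure_of by blast
      have "\<rho> t \<in> Y" by (rule morphism_maps_to[OF \<rho> T t(1)])
      hence "\<rho> t \<in> V \<inter> h -` (O' \<inter> U)" unfolding B(2) using t(2) by (rule IntI[rotated])
      hence \<rho>tV: "\<rho> t \<in> V" "h (\<rho> t) \<in> O'" by simp_all
      have "\<rho>t t \<in> N" by (rule morphism_maps_to[OF \<rho>t T t(1)])
      hence "\<rho>t t \<in> N'" using \<rho>tV(1) lift[OF t(1)] by (simp add: N'_def)
      hence "h (\<rho> t) = \<rho>t t" using hpi lift[OF t(1)] by simp
      thus ?thesis using \<rho>tV(2) t(1) by auto
    qed
    moreover have "p0 \<in> topspace zariski" using p0 Np unfolding topspace_zariski by blast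
    ultimately show "p0 \<in> zariski closure_of (\<rho>t ` T)" unfolding in_closure_of by blast
  qed
  have g': "morphism N T (\<lambda>q. g (\<pi> q))" by (rule morphism_compose[OF \<pi>m g Np Y])
  have m3: "morphism N N (\<lambda>q. \<rho>t (g (\<pi> q)))" by (rule morphism_compose[OF g' \<rho>t Np T])
  have sub: "\<rho>t ` T \<subseteq> N" by (rule image_subsetI) (rule morphism_maps_to[OF \<rho>t T])
  have on_image: "\<rho>t (g (\<pi> q)) = q" if q: "q \<in> \<rho>t ` T" for q
  proof -
    obtain t where t: "t \<in> T" "q = \<rho>t t" using q by blast
    have "g (\<pi> q) = t" unfolding t(2) lift[OF t(1), symmetric] by (rule inv[OF t(1)])
    thus ?thesis using t(2) by simp
  qed
  have eq: "\<rho>t (g (\<pi> q)) = q" if "q \<in> N" for q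
    by (rule morphisms_agree_if_agree_on_dense[OF m3 morphism_id Np Np sub dense_t on_image that])
  have "g (\<pi> (\<rho>t p)) = p" if "p \<in> T" for p
    unfolding lift[OF that, symmetric] by (rule inv[OF that])
  thus ?thesis unfolding isomorphism_def using \<rho>t g' eq
    by (intro conjI exI[of _ "\<lambda>q. g (\<pi> q)"] ballI)
qed

section \<open>Multi-indices and monomials of the Chow form\<close>

definition msupp :: "nat \<Rightarrow> (nat \<Rightarrow> nat) \<Rightarrow> nat set" where
  "msupp m k = {i\<in>{1..m}. k i \<noteq> 0}"

text \<open>The weight of the Segre coordinate \<open>k\<close> under the torus: the exponent of
  \<open>t\<close> when all affine coordinates are multiplied by \<open>t\<close>.\<close>

definition mdeg :: "nat \<Rightarrow> (nat \<Rightarrow> nat) \<Rightarrow> nat" where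
  "mdeg m k = card (msupp m k)"

text \<open>The Segre coordinate with multi-index \<open>k\<close> of the points with homogeneous
  coordinates \<open>[1 : x i]\<close>.\<close>

definition mval :: "nat \<Rightarrow> (nat \<times> nat \<Rightarrow> complex) \<Rightarrow> (nat \<Rightarrow> nat) \<Rightarrow> complex" where
  "mval m x k = (\<Prod>i\<in>{1..m}. if k i = 0 then 1 else x (i, k i))"

lemma finite_msupp [simp]: "finite (msupp m k)"
  by (simp add: msupp_def)

lemma finite_multi_idx: "finite (multi_idx d m)"
  by (simp add: multi_idx_def finite_PiE)

lemma msupp_subset: "msupp m k \<subseteq> {1..m}"
  by (auto simp: msupp_def)

lemma mdeg_le: "mdeg m k \<le> m"
  using card_mono[OF _ msupp_subset, of m k] by (simp add: mdeg_def)

lemma multi_idx_upd: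
  assumes "k \<in> multi_idx d m" "i \<in> {1..m}" "c \<le> d"
  shows "k(i := c) \<in> multi_idx d m"
  using assms by (auto simp: multi_idx_def PiE_iff extensional_def)

lemma multi_idx_eqI:
  assumes "k \<in> multi_idx d m" "l \<in> multi_idx d m" "\<And>i. i \<in> {1..m} \<Longrightarrow> k i = l i"
  shows "k = l"
  using assms unfolding multi_idx_def by (intro PiE_ext) auto

lemma mval_nonzero:
  assumes "\<And>i c. i \<in> {1..m} \<Longrightarrow> c \<in> {1..d} \<Longrightarrow> x (i, c) \<noteq> 0" "k \<in> multi_idx d m"
  shows "mval m x k \<noteq> 0"
proof -
  have "(if k i = 0 then 1 else x (i, k i)) \<noteq> 0" if i: "i \<in> {1..m}" for i
  proof (cases "k i = 0")
    case False
    have "k i \<le> d" using assms(2) i by (auto simp: multi_idx_def)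
    thus ?thesis using assms(1)[OF i, of "k i"] False by simp
  qed simp
  thus ?thesis by (simp add: mval_def)
qed

lemma mval_upd:
  assumes "i \<in> {1..m}" "k i = 0" "c \<noteq> 0"
  shows "mval m x (k(i := c)) = mval m x k * x (i, c)"
proof -
  have "(\<Prod>j\<in>{1..m}-{i}. if (k(i := c)) j = 0 then 1 else x (j, (k(i := c)) j)) =
      (\<Prod>j\<in>{1..m}-{i}. if k j = 0 then 1 else x (j, k j))" by (rule prod.cong) auto
  hence "mval m x (k(i := c)) = x (i, c) * (\<Prod>j\<in>{1..m}-{i}. if k j = 0 then 1 else x (j, k j))"
    unfolding mval_def using assms by (subst prod.remove[of _ i]) auto
  moreover have "mval m x k = (\<Prod>j\<in>{1..m}-{i}. if k j = 0 then 1 else x (j, k j))"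
    unfolding mval_def using assms by (subst prod.remove[of _ i]) auto
  ultimately show ?thesis by simp
qed

lemma mdeg_upd:
  assumes "i \<in> {1..m}" "k i = 0" "c \<noteq> 0"
  shows "mdeg m (k(i := c)) = Suc (mdeg m k)"
proof -
  have "msupp m (k(i := c)) = insert i (msupp m k)" using assms by (auto simp: msupp_def)
  moreover have "i \<notin> msupp m k" using assms by (simp add: msupp_def)
  ultimately show ?thesis by (simp add: mdeg_def)
qed

lemma mdeg_image:
  assumes "d \<ge> 1"
  shows "mdeg m ` multi_idx d m = {..m}"
proof
  show "mdeg m ` multi_idx d m \<subseteq> {..m}" using mdeg_le by auto
  show "{..m} \<subseteq> mdeg m ` multi_idx d m"
  proof
    fix j assume j: "j \<in> {..m}"
    define k where "k = (\<lambda>i\<in>{1..m}. if i \<le> j then 1 else 0 :: nat)"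
    have "k \<in> multi_idx d m" using assms by (auto simp: k_def multi_idx_def)
    moreover have "msupp m k = {1..j}" using j by (auto simp: msupp_def k_def)
    hence "mdeg m k = j" by (simp add: mdeg_def)
    ultimately show "j \<in> mdeg m ` multi_idx d m" by blast
  qed
qed

definition zero_idx :: "nat \<Rightarrow> nat \<Rightarrow> nat" where
  "zero_idx m = (\<lambda>i\<in>{1..m}. 0)"

lemma zero_idx: "zero_idx m \<in> multi_idx d m" "mdeg m (zero_idx m) = 0"
proof -
  have "msupp m (zero_idx m) = {}" by (auto simp: msupp_def zero_idx_def)
  thus "mdeg m (zero_idx m) = 0" by (simp add: mdeg_def)
qed (auto simp: zero_idx_def multi_idx_def)

lemma graded_forms_mval:
  assumes "d \<ge> 1" "m \<ge> 1" "\<And>i c. i \<in> {1..m} \<Longrightarrow> c \<in> {1..d} \<Longrightarrow> x (i, c) \<noteq> 0"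
  shows "graded_forms (multi_idx d m) (mdeg m) (mval m x) m (zero_idx m)"
proof
  show "mval m x k \<noteq> 0" if "k \<in> multi_idx d m" for k
    by (rule mval_nonzero[where d = d, OF _ that]) (rule assms(3))
qed (use assms(1,2) in \<open>simp_all add: finite_multi_idx mdeg_image zero_idx\<close>)

definition chow_coeff :: "nat \<Rightarrow> nat \<Rightarrow> ((bool \<times> (nat \<Rightarrow> nat)) \<Rightarrow>\<^sub>0 nat) \<Rightarrow> complex" where
  "chow_coeff d m M = Poly_Mapping.lookup (res_form (multi_idx d m) (mdeg m) (\<lambda>_. 1) m) M"

definition chow_vec :: "nat \<Rightarrow> nat \<Rightarrow> (nat \<times> nat \<Rightarrow> complex) \<Rightarrow> ((bool \<times> (nat \<Rightarrow> nat)) \<Rightarrow>\<^sub>0 nat) \<Rightarrow> complex" where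
  "chow_vec d m x M = chow_coeff d m M * mon_eval M (\<lambda>v. mval m x (snd v))"

lemma lookup_res_form_mval: "Poly_Mapping.lookup (res_form (multi_idx d m) (mdeg m) (mval m x) m) = chow_vec d m x"
  unfolding chow_vec_def chow_coeff_def by (rule ext) (rule lookup_res_form[OF finite_multi_idx])

lemma mon_eval_single: "mon_eval (Poly_Mapping.single v 1) u = u v"
  by (simp add: mon_eval_def)

lemma mon_eval_sum: "mon_eval (\<Sum>i\<in>I. f i) u = (\<Prod>i\<in>I. mon_eval (f i) u)"
  by (induction I rule: infinite_finite_induct) (simp_all add: mon_eval_add mon_eval_def[of 0])

lemma mon_eval_row_monomial: "mon_eval (row_monomial m F) (\<lambda>v. \<theta> (snd v)) = (\<Prod>r\<in>{0..<2*m}. \<theta> (F r))"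
  by (simp add: row_monomial_def mon_eval_sum mon_eval_single del: One_nat_def)

section \<open>Reduction to staircase monomials\<close>

text \<open>Entries at positions where \<open>k\<close> is nonzero and \<open>k'\<close> is zero can
  be handed over from \<open>k\<close> to \<open>k'\<close>. This shifts weight between the two but
  permutes the factors of the product of values, simultaneously for all \<open>x\<close>.\<close>

lemma move_support:
  assumes k: "k \<in> multi_idx d m" and k': "k' \<in> multi_idx d m" and D: "D \<subseteq> msupp m k - msupp m k'"
  obtains k1 k1' where "k1 \<in> multi_idx d m" "k1' \<in> multi_idx d m"
    "mdeg m k1 = mdeg m k - card D" "mdeg m k1' = mdeg m k' + card D"
    "\<forall>x. mval m x k1 * mval m x k1' = mval m x k * mval m x k'"
proof -
  have D1: "D \<subseteq> {1..m}" using D msupp_subset[of m k] by blast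
  define k1 where "k1 = (\<lambda>i. if i \<in> D then 0 else k i)"
  define k1' where "k1' = (\<lambda>i. if i \<in> D then k i else k' i)"
  have mem: "k1 \<in> multi_idx d m" "k1' \<in> multi_idx d m"
    using k k' D1 by (auto simp: multi_idx_def PiE_iff k1_def k1'_def extensional_def)
  have fD: "finite D" using D1 finite_subset by blast
  have s1: "msupp m k1 = msupp m k - D" by (auto simp: msupp_def k1_def)
  have s1': "msupp m k1' = msupp m k' \<union> D" using D by (auto simp: msupp_def k1'_def)
  have "mdeg m k1 = mdeg m k - card D" unfolding mdeg_def s1 using D fD by (intro card_Diff_subset) auto
  moreover have "mdeg m k1' = mdeg m k' + card D" unfolding mdeg_def s1' using D fD by (intro card_Un_disjoint) auto
  moreover have "\<forall>x. mval m x k1 * mval m x k1' = mval m x k * mval m x k'"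
    unfolding mval_def prod.distrib[symmetric]
    by (intro allI prod.cong) (use D in \<open>auto simp: k1_def k1'_def msupp_def\<close>)
  ultimately show ?thesis by (rule that[OF mem])
qed

lemma finite_has_maximizer:
  fixes f :: "'a \<Rightarrow> nat"
  assumes "finite G" "G \<noteq> {}"
  shows "\<exists>a\<in>G. \<forall>b\<in>G. f b \<le> f a"
proof -
  have "Max (f ` G) \<in> f ` G" using assms by (intro Max_in) auto
  then obtain a where "a \<in> G" "f a = Max (f ` G)" by auto
  thus ?thesis using assms(1) by (intro bexI[of _ a]) auto
qed

section \<open>Uncrossing the rows of a term of the determinant\<close>

definition valid_rows :: "nat \<Rightarrow> nat \<Rightarrow> (nat \<Rightarrow> nat) \<Rightarrow> (nat \<Rightarrow> nat \<Rightarrow> nat) \<Rightarrow> bool" where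
  "valid_rows d m \<pi> \<kappa> \<longleftrightarrow> \<pi> permutes {0..<2*m} \<and>
     (\<forall>r<2*m. \<kappa> r \<in> multi_idx d m \<and> \<pi> r = row_ix m r + mdeg m (\<kappa> r))"

text \<open>Exchanging the two columns requires moving weight \<open>\<pi> r - \<pi> r'\<close> from
  row \<open>r\<close> to row \<open>r'\<close>. The weights differ by more than that, because the
  row indices are ordered the other way, so enough positions are available to be handed
  over.\<close>

lemma uncross:
  assumes v: "valid_rows d m \<pi> \<kappa>" and r: "r < 2 * m" "r' < 2 * m"
    and inv: "row_ix m r < row_ix m r'" "\<pi> r' < \<pi> r"
  obtains \<kappa>' where "valid_rows d m (\<pi> \<circ> Transposition.transpose r r') \<kappa>'"
    "\<forall>x. (\<Prod>r\<in>{0..<2*m}. mval m x (\<kappa>' r)) = (\<Prod>r\<in>{0..<2*m}. mval m x (\<kappa> r))"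
proof -
  define \<delta> where "\<delta> = \<pi> r - \<pi> r'"
  have ne: "r \<noteq> r'" using inv by auto
  have \<kappa>: "\<kappa> r \<in> multi_idx d m" "\<kappa> r' \<in> multi_idx d m" and \<pi>: "\<pi> r = row_ix m r + mdeg m (\<kappa> r)"
    "\<pi> r' = row_ix m r' + mdeg m (\<kappa> r')"
    using v r by (auto simp: valid_rows_def)
  have "mdeg m (\<kappa> r) - mdeg m (\<kappa> r') \<le> card (msupp m (\<kappa> r) - msupp m (\<kappa> r'))"
    unfolding mdeg_def by (rule diff_card_le_card_Diff) simp
  hence "\<delta> \<le> card (msupp m (\<kappa> r) - msupp m (\<kappa> r'))" using \<pi> inv by (simp add: \<delta>_def)
  then obtain D where D: "D \<subseteq> msupp m (\<kappa> r) - msupp m (\<kappa> r')" "card D = \<delta>"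
    by (rule obtain_subset_with_card_n)
  obtain k1 k1' where k1: "k1 \<in> multi_idx d m" "k1' \<in> multi_idx d m"
    "mdeg m k1 = mdeg m (\<kappa> r) - \<delta>" "mdeg m k1' = mdeg m (\<kappa> r') + \<delta>"
    "\<forall>x. mval m x k1 * mval m x k1' = mval m x (\<kappa> r) * mval m x (\<kappa> r')"
    by (rule move_support[OF \<kappa> D(1), unfolded D(2)])
  define \<kappa>' where "\<kappa>' = \<kappa>(r := k1, r' := k1')"
  have "\<pi> \<circ> Transposition.transpose r r' permutes {0..<2*m}"
    using v r by (intro permutes_compose permutes_swap_id) (auto simp: valid_rows_def)
  moreover have "\<kappa>' s \<in> multi_idx d m \<and> (\<pi> \<circ> Transposition.transpose r r') s = row_ix m s + mdeg m (\<kappa>' s)"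
    if "s < 2 * m" for s
  proof -
    consider "s = r" | "s = r'" | "s \<noteq> r" "s \<noteq> r'" by blast
    thus ?thesis
    proof cases
      case 1
      thus ?thesis using ne k1 \<pi> inv by (simp add: \<kappa>'_def \<delta>_def)
    next
      case 2
      thus ?thesis using ne k1 \<pi> inv by (simp add: \<kappa>'_def \<delta>_def)
    next
      case 3
      thus ?thesis using v that by (simp add: \<kappa>'_def valid_rows_def)
    qed
  qed
  ultimately have "valid_rows d m (\<pi> \<circ> Transposition.transpose r r') \<kappa>'" by (simp add: valid_rows_def)
  moreover have "\<forall>x. (\<Prod>r\<in>{0..<2*m}. mval m x (\<kappa>' r)) = (\<Prod>r\<in>{0..<2*m}. mval m x (\<kappa> r))"
  proof
    fix x
    have split: "(\<Prod>s\<in>{0..<2*m}. f s) = f r * (f r' * (\<Prod>s\<in>{0..<2*m} - {r} - {r'}. f s))" for f :: "nat \<Rightarrow> complex"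
      using r ne by (subst prod.remove[of _ r], simp, simp, subst prod.remove[of _ r']) auto
    have "(\<Prod>s\<in>{0..<2*m} - {r} - {r'}. mval m x (\<kappa>' s)) = (\<Prod>s\<in>{0..<2*m} - {r} - {r'}. mval m x (\<kappa> s))"
      by (rule prod.cong) (auto simp: \<kappa>'_def)
    thus "(\<Prod>r\<in>{0..<2*m}. mval m x (\<kappa>' r)) = (\<Prod>r\<in>{0..<2*m}. mval m x (\<kappa> r))"
      unfolding split using ne spec[OF k1(5), of x] by (simp add: \<kappa>'_def mult.assoc[symmetric])
  qed
  ultimately show ?thesis by (rule that)
qed

text \<open>The weights that place the rows \<open>i\<close> and \<open>m + i\<close> in the columns
  \<open>2 * i\<close> and \<open>2 * i + 1\<close>.\<close>

definition stair_size :: "nat \<Rightarrow> nat \<Rightarrow> nat" where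
  "stair_size m r = (if r < m then r else Suc (r - m))"

definition stair_families :: "nat \<Rightarrow> nat \<Rightarrow> (nat \<Rightarrow> nat \<Rightarrow> nat) set" where
  "stair_families d m = Pi\<^sub>E {0..<2*m} (\<lambda>r. {k \<in> multi_idx d m. mdeg m k = stair_size m r})"

text \<open>Two rows share each index. The rows of smaller index fill columns to the left of
  \<open>\<pi> r\<close>, those of larger index columns to the right; counting them leaves just two
  possible columns.\<close>

lemma sorted_rows_position:
  assumes v: "valid_rows d m \<pi> \<kappa>" and r: "r < 2 * m"
    and sorted: "\<And>r r'. r < 2 * m \<Longrightarrow> r' < 2 * m \<Longrightarrow> row_ix m r < row_ix m r' \<Longrightarrow> \<pi> r < \<pi> r'"
  shows "\<pi> r = 2 * row_ix m r \<or> \<pi> r = Suc (2 * row_ix m r)"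
proof -
  have perm: "\<pi> permutes {0..<2*m}" using v by (simp add: valid_rows_def)
  have ix: "row_ix m r < m" using r by (auto simp: row_ix_def)
  have inj: "inj_on \<pi> S" for S using permutes_inj[OF perm] by (rule inj_on_subset) simp
  have lt: "\<pi> s < 2 * m" if "s < 2 * m" for s using permutes_in_image[OF perm, of s] that by simp
  have cardlow: "card {s. s < 2 * m \<and> row_ix m s < i} = 2 * i" if "i \<le> m" for i
  proof -
    have "{s. s < 2 * m \<and> row_ix m s < i} = {0..<i} \<union> {m..<m+i}" using that by (auto simp: row_ix_def)
    also have "card \<dots> = i + i" using that by (subst card_Un_disjoint) auto
    finally show ?thesis by simp
  qed
  have "2 * row_ix m r = card (\<pi> ` {s. s < 2 * m \<and> row_ix m s < row_ix m r})"
    using cardlow[of "row_ix m r"] ix by (subst card_image[OF inj]) simp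
  also have "\<dots> \<le> card {0..<\<pi> r}" by (rule card_mono) (use sorted[OF _ r] in auto)
  finally have low: "2 * row_ix m r \<le> \<pi> r" by simp
  have "{s. s < 2 * m \<and> row_ix m r < row_ix m s} = {0..<2*m} - {s. s < 2 * m \<and> row_ix m s < Suc (row_ix m r)}" by auto
  moreover have "card ({0..<2*m} - {s. s < 2 * m \<and> row_ix m s < Suc (row_ix m r)}) =
      card {0..<2*m} - card {s. s < 2 * m \<and> row_ix m s < Suc (row_ix m r)}"
    by (rule card_Diff_subset[OF finite_subset[of _ "{0..<2*m}"]]) auto
  ultimately have "card {s. s < 2 * m \<and> row_ix m r < row_ix m s} = 2 * m - 2 * Suc (row_ix m r)"
    using cardlow[of "Suc (row_ix m r)"] ix by simp
  hence "2 * m - 2 * Suc (row_ix m r) = card (\<pi> ` {s. s < 2 * m \<and> row_ix m r < row_ix m s})"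
    by (subst card_image[OF inj]) simp
  also have "\<dots> \<le> card {Suc (\<pi> r)..<2*m}" by (rule card_mono) (use sorted[OF r] lt in \<open>auto simp: Suc_le_eq\<close>)
  finally have "2 * m - 2 * Suc (row_ix m r) \<le> 2 * m - Suc (\<pi> r)" by simp
  with low lt[OF r] ix show ?thesis by arith
qed

text \<open>Uncrossing rows increases the sum of products of row and column numbers, so a maximal
  choice has no inversions; then the rows \<open>i\<close> and \<open>m + i\<close> carry degrees \<open>i\<close> and \<open>i + 1\<close>.\<close>

lemma ex_stair_family:
  assumes "valid_rows d m \<pi>0 \<kappa>0"
  obtains F where "F \<in> stair_families d m"
    "\<forall>x. (\<Prod>r\<in>{0..<2*m}. mval m x (F r)) = (\<Prod>r\<in>{0..<2*m}. mval m x (\<kappa>0 r))"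
proof -
  define good where "good \<pi> \<longleftrightarrow> (\<exists>\<kappa>. valid_rows d m \<pi> \<kappa> \<and>
    (\<forall>x. (\<Prod>r\<in>{0..<2*m}. mval m x (\<kappa> r)) = (\<Prod>r\<in>{0..<2*m}. mval m x (\<kappa>0 r))))" for \<pi>
  define S where "S \<pi> = (\<Sum>r\<in>{0..<2*m}. row_ix m r * \<pi> r)" for \<pi> :: "nat \<Rightarrow> nat"
  have "finite {\<pi>. good \<pi>}"
    by (rule finite_subset[OF _ finite_permutations[of "{0..<2*m}"]]) (auto simp: good_def valid_rows_def)
  moreover have "good \<pi>0" unfolding good_def using assms by (intro exI[of _ \<kappa>0]) simp
  ultimately have "\<exists>\<pi>\<in>{\<pi>. good \<pi>}. \<forall>\<pi>'\<in>{\<pi>. good \<pi>}. S \<pi>' \<le> S \<pi>"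
    by (intro finite_has_maximizer[of "{\<pi>. good \<pi>}" S]) auto
  then obtain \<pi> where \<pi>: "good \<pi>" "\<forall>\<pi>'. good \<pi>' \<longrightarrow> S \<pi>' \<le> S \<pi>" by auto
  obtain \<kappa> where \<kappa>: "valid_rows d m \<pi> \<kappa>"
    "\<forall>x. (\<Prod>r\<in>{0..<2*m}. mval m x (\<kappa> r)) = (\<Prod>r\<in>{0..<2*m}. mval m x (\<kappa>0 r))"
    using \<pi>(1) unfolding good_def by (elim exE conjE) (rule that)
  have perm: "\<pi> permutes {0..<2*m}" using \<kappa>(1) by (simp add: valid_rows_def)
  have sorted: "\<pi> r < \<pi> r'" if r: "r < 2 * m" "r' < 2 * m" "row_ix m r < row_ix m r'" for r r'
  proof (rule ccontr)
    assume "\<not> \<pi> r < \<pi> r'"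
    moreover have "\<pi> r \<noteq> \<pi> r'"
    proof
      assume "\<pi> r = \<pi> r'"
      hence "r = r'" by (rule injD[OF permutes_inj[OF perm]])
      thus False using r(3) by simp
    qed
    ultimately have inv: "\<pi> r' < \<pi> r" by simp
    define \<pi>' where "\<pi>' = \<pi> \<circ> Transposition.transpose r r'"
    obtain \<kappa>' where "valid_rows d m \<pi>' \<kappa>'"
      "\<forall>x. (\<Prod>r\<in>{0..<2*m}. mval m x (\<kappa>' r)) = (\<Prod>r\<in>{0..<2*m}. mval m x (\<kappa> r))"
      unfolding \<pi>'_def by (rule uncross[OF \<kappa>(1) r inv])
    hence "good \<pi>'" unfolding good_def using \<kappa>(2) by (intro exI[of _ \<kappa>']) simp
    have ne: "r \<noteq> r'" using r(3) by auto
    have split: "(\<Sum>s\<in>{0..<2*m}. f s) = f r + (f r' + (\<Sum>s\<in>{0..<2*m} - {r} - {r'}. f s))" for f :: "nat \<Rightarrow> nat"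
      using r ne by (subst sum.remove[of _ r], simp, simp, subst sum.remove[of _ r']) auto
    have "(\<Sum>s\<in>{0..<2*m} - {r} - {r'}. row_ix m s * \<pi>' s) = (\<Sum>s\<in>{0..<2*m} - {r} - {r'}. row_ix m s * \<pi> s)"
      by (rule sum.cong) (auto simp: \<pi>'_def)
    moreover have "row_ix m r * \<pi> r + row_ix m r' * \<pi> r' < row_ix m r * \<pi> r' + row_ix m r' * \<pi> r"
    proof -
      obtain a where "row_ix m r' = Suc (row_ix m r + a)" using less_imp_Suc_add[OF r(3)] by blast
      moreover obtain b where "\<pi> r = Suc (\<pi> r' + b)" using less_imp_Suc_add[OF inv] by blast
      ultimately show ?thesis by (simp add: algebra_simps)
    qed
    ultimately have "S \<pi> < S \<pi>'" unfolding S_def split by (simp add: \<pi>'_def)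
    moreover have "S \<pi>' \<le> S \<pi>" using \<pi>(2) \<open>good \<pi>'\<close> by blast
    ultimately show False by simp
  qed
  have pos: "mdeg m (\<kappa> r) = row_ix m r \<or> mdeg m (\<kappa> r) = Suc (row_ix m r)" and mem: "\<kappa> r \<in> multi_idx d m" if "r < 2 * m" for r
    using sorted_rows_position[OF \<kappa>(1) that sorted] \<kappa>(1) that by (auto simp: valid_rows_def)
  have diff: "mdeg m (\<kappa> i) \<noteq> mdeg m (\<kappa> (m + i))" if "i < m" for i
  proof
    assume "mdeg m (\<kappa> i) = mdeg m (\<kappa> (m + i))"
    hence "\<pi> i = \<pi> (m + i)" using \<kappa>(1) that by (simp add: valid_rows_def row_ix_def)
    hence "i = m + i" by (rule injD[OF permutes_inj[OF perm]])
    thus False using that by simp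
  qed
  \<comment> \<open>Rows \<open>i\<close> and \<open>m + i\<close> hold the columns
    \<open>2 * i\<close> and \<open>2 * i + 1\<close> in some order; their contents are swapped
    where needed so that the first block gets weight \<open>i\<close>.\<close>
  define F where "F = (\<lambda>r\<in>{0..<2*m}. if r < m then (if mdeg m (\<kappa> r) = r then \<kappa> r else \<kappa> (m + r))
     else (if mdeg m (\<kappa> (r - m)) = r - m then \<kappa> r else \<kappa> (r - m)))"
  have F1: "F i \<in> multi_idx d m \<and> mdeg m (F i) = i" and
       F2: "F (m + i) \<in> multi_idx d m \<and> mdeg m (F (m + i)) = Suc i" and
       F3: "mval m x (F i) * mval m x (F (m + i)) = mval m x (\<kappa> i) * mval m x (\<kappa> (m + i))" if i: "i < m" for i x
  proof -
    have p: "mdeg m (\<kappa> i) = i \<or> mdeg m (\<kappa> i) = Suc i" "mdeg m (\<kappa> (m + i)) = i \<or> mdeg m (\<kappa> (m + i)) = Suc i"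
      using pos[of i] pos[of "m + i"] i by (simp_all add: row_ix_def)
    have mm: "\<kappa> i \<in> multi_idx d m" "\<kappa> (m + i) \<in> multi_idx d m" using mem[of i] mem[of "m + i"] i by simp_all
    have "(F i = \<kappa> i \<and> F (m + i) = \<kappa> (m + i) \<and> mdeg m (\<kappa> i) = i \<and> mdeg m (\<kappa> (m + i)) = Suc i) \<or>
        (F i = \<kappa> (m + i) \<and> F (m + i) = \<kappa> i \<and> mdeg m (\<kappa> i) = Suc i \<and> mdeg m (\<kappa> (m + i)) = i)"
      using p diff[OF i] i by (cases "mdeg m (\<kappa> i) = i") (simp_all add: F_def)
    hence "F i \<in> multi_idx d m \<and> mdeg m (F i) = i \<and> F (m + i) \<in> multi_idx d m \<and> mdeg m (F (m + i)) = Suc i \<and>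
       mval m x (F i) * mval m x (F (m + i)) = mval m x (\<kappa> i) * mval m x (\<kappa> (m + i))"
    proof
      assume "F i = \<kappa> i \<and> F (m + i) = \<kappa> (m + i) \<and> mdeg m (\<kappa> i) = i \<and> mdeg m (\<kappa> (m + i)) = Suc i"
      thus ?thesis using mm by simp
    next
      assume "F i = \<kappa> (m + i) \<and> F (m + i) = \<kappa> i \<and> mdeg m (\<kappa> i) = Suc i \<and> mdeg m (\<kappa> (m + i)) = i"
      thus ?thesis using mm by (simp add: mult.commute)
    qed
    thus "F i \<in> multi_idx d m \<and> mdeg m (F i) = i"
       "F (m + i) \<in> multi_idx d m \<and> mdeg m (F (m + i)) = Suc i"
       "mval m x (F i) * mval m x (F (m + i)) = mval m x (\<kappa> i) * mval m x (\<kappa> (m + i))" by blast+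
  qed
  have "F r \<in> multi_idx d m \<and> mdeg m (F r) = stair_size m r" if "r < 2 * m" for r
    using F1[of r] F2[of "r - m"] that by (cases "r < m") (simp_all add: stair_size_def)
  hence "F \<in> stair_families d m" by (auto simp: stair_families_def F_def)
  moreover have "\<forall>x. (\<Prod>r\<in>{0..<2*m}. mval m x (F r)) = (\<Prod>r\<in>{0..<2*m}. mval m x (\<kappa>0 r))"
  proof
    fix x
    have split: "(\<Prod>r\<in>{0..<2*m}. f r) = (\<Prod>i\<in>{0..<m}. f i * f (m + i))" for f :: "nat \<Rightarrow> complex"
    proof -
      have "(\<Prod>r\<in>{0..<2*m}. f r) = (\<Prod>r\<in>{0..<m}. f r) * (\<Prod>r\<in>{m..<m+m}. f r)"
        unfolding mult_2 by (rule prod.atLeastLessThan_concat[symmetric]) auto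
      also have "(\<Prod>r\<in>{m..<m+m}. f r) = (\<Prod>i\<in>{0..<m}. f (m + i))"
        using prod.shift_bounds_nat_ivl[of f 0 m m] by (simp add: add.commute)
      finally show ?thesis by (simp add: prod.distrib)
    qed
    show "(\<Prod>r\<in>{0..<2*m}. mval m x (F r)) = (\<Prod>r\<in>{0..<2*m}. mval m x (\<kappa>0 r))"
      unfolding spec[OF \<kappa>(2), of x, symmetric] split by (rule prod.cong) (simp_all add: F3)
  qed
  ultimately show ?thesis by (rule that)
qed

section \<open>Staircase coordinates of generic Chow points and of their limits\<close>

definition stair_sign :: "nat \<Rightarrow> complex" where
  "stair_sign m = of_int (sign (\<lambda>r. if r < m then 2 * r else if r < 2 * m then Suc (2 * (r - m)) else r))"

lemma stair_sign_nonzero: "stair_sign m \<noteq> 0"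
  by (simp add: stair_sign_def sign_def)

lemma chow_coeff_staircase:
  assumes "\<And>i. i < m \<Longrightarrow> K i \<in> multi_idx d m \<and> mdeg m (K i) = i"
    and "\<And>i. i < m \<Longrightarrow> K' (Suc i) \<in> multi_idx d m \<and> mdeg m (K' (Suc i)) = Suc i"
  shows "chow_coeff d m (staircase m K K') = stair_sign m"
  unfolding chow_coeff_def stair_sign_def by (rule lookup_res_form_staircase[OF finite_multi_idx assms])

lemma mon_eval_staircase:
  "mon_eval (staircase m K K') (\<lambda>v. \<theta> (snd v)) = (\<Prod>i<m. \<theta> (K i)) * (\<Prod>i<m. \<theta> (K' (Suc i)))"
  by (simp add: staircase_def mon_eval_add mon_eval_sum mon_eval_single del: One_nat_def)

lemma row_monomial_eq_staircase: "row_monomial m F = staircase m F (\<lambda>j. F (m + (j - 1)))"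
  by (simp add: row_monomial_split staircase_def)

lemma stair_familyD:
  assumes "F \<in> stair_families d m" "r < 2 * m"
  shows "F r \<in> multi_idx d m" "mdeg m (F r) = stair_size m r"
  using assms by (auto simp: stair_families_def PiE_iff)

lemma chow_vec_stair_family:
  assumes "F \<in> stair_families d m"
  shows "chow_vec d m x (row_monomial m F) = stair_sign m * (\<Prod>r\<in>{0..<2*m}. mval m x (F r))"
proof -
  have "chow_coeff d m (row_monomial m F) = stair_sign m"
    unfolding row_monomial_eq_staircase
    by (rule chow_coeff_staircase) (use stair_familyD[OF assms] in \<open>simp_all add: stair_size_def\<close>)
  thus ?thesis by (simp add: chow_vec_def mon_eval_row_monomial)
qed

text \<open>More restrictive than membership in the open moduli space: nonzero coordinates make all
  weights \<open>mval\<close> nonzero, as \<open>graded_forms\<close> demands, and distinct first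
  coordinates guarantee distinct points.\<close>

definition generic :: "nat \<Rightarrow> nat \<Rightarrow> (nat \<times> nat \<Rightarrow> complex) \<Rightarrow> bool" where
  "generic d m x \<longleftrightarrow> supported ({1..m} \<times> {1..d}) x \<and> (\<forall>i\<in>{1..m}. \<forall>c\<in>{1..d}. x (i, c) \<noteq> 0) \<and>
     inj_on (\<lambda>i. x (i, 1)) {1..m}"

text \<open>The homogeneous coordinate vectors of the points in the Zariski closure of the Chow points of
  generic orbit closures.\<close>

definition chow_limit :: "nat \<Rightarrow> nat \<Rightarrow> (((bool \<times> (nat \<Rightarrow> nat)) \<Rightarrow>\<^sub>0 nat) \<Rightarrow> complex) \<Rightarrow> bool" where
  "chow_limit d m y \<longleftrightarrow> y \<noteq> (\<lambda>_. 0) \<and>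
     (\<forall>e F. homogeneous e F \<longrightarrow> (\<forall>x. generic d m x \<longrightarrow> peval F (chow_vec d m x) = 0) \<longrightarrow> peval F y = 0)"

lemma chow_limitD:
  assumes "chow_limit d m y" "homogeneous e F" "\<And>x. generic d m x \<Longrightarrow> peval F (chow_vec d m x) = 0"
  shows "peval F y = 0"
  using assms unfolding chow_limit_def by blast

text \<open>Some coordinate of \<open>y\<close> is nonzero, and uncrossing finds a stair family with
  the same monomial in \<open>x\<close>. The two coordinates of \<open>chow_vec\<close> are then
  proportional with constants independent of \<open>x\<close>; this linear relation also holds at
  \<open>y\<close>.\<close>

lemma ex_alive_stair_family:
  assumes y: "chow_limit d m y"
  obtains F where "F \<in> stair_families d m" "y (row_monomial m F) \<noteq> 0"
proof -
  have "\<exists>M. y M \<noteq> 0" using y unfolding chow_limit_def by force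
  then obtain M where M: "y M \<noteq> 0" ..
  \<comment> \<open>A coordinate with zero integer factor vanishes at all generic vectors, hence at
    \<open>y\<close>.\<close>
  have nM: "chow_coeff d m M \<noteq> 0"
  proof
    assume "chow_coeff d m M = 0"
    hence "peval (Var M) y = 0" by (intro chow_limitD[OF y homogeneous_Var]) (simp add: chow_vec_def)
    thus False using M by simp
  qed
  obtain \<pi> \<kappa> where pk: "(\<pi>, \<kappa>) \<in> sylv_choices (multi_idx d m) (mdeg m) m" "row_monomial m \<kappa> = M"
    using nM unfolding chow_coeff_def by (rule res_form_key_choice[OF finite_multi_idx])
  have "valid_rows d m \<pi> \<kappa>"
    using pk(1) by (auto simp: sylv_choices_def valid_rows_def PiE_iff)
  then obtain F where F: "F \<in> stair_families d m"
    "\<forall>x. (\<Prod>r\<in>{0..<2*m}. mval m x (F r)) = (\<Prod>r\<in>{0..<2*m}. mval m x (\<kappa> r))" by (rule ex_stair_family)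
  let ?G = "Poly_Mapping.single 0 (stair_sign m) * Var M - Poly_Mapping.single 0 (chow_coeff d m M) * Var (row_monomial m F)"
  have "peval ?G y = 0"
  proof (rule chow_limitD[OF y])
    show "homogeneous 1 ?G" by (intro homogeneous_diff homogeneous_const_mult homogeneous_Var)
    fix x
    have "mon_eval M (\<lambda>v. mval m x (snd v)) = (\<Prod>r\<in>{0..<2*m}. mval m x (F r))"
      using mon_eval_row_monomial[of m \<kappa> "mval m x"] spec[OF F(2), of x] unfolding pk(2) by simp
    thus "peval ?G (chow_vec d m x) = 0"
      using chow_vec_stair_family[OF F(1), of x] by (simp add: peval_diff peval_mult chow_vec_def[of d m x M])
  qed
  hence "stair_sign m * y M = chow_coeff d m M * y (row_monomial m F)" by (simp add: peval_diff peval_mult)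
  hence "y (row_monomial m F) \<noteq> 0" using M stair_sign_nonzero[of m] by auto
  with F(1) show ?thesis by (rule that)
qed

section \<open>Exchanging entries between rows\<close>

definition exchange :: "(nat \<Rightarrow> nat \<Rightarrow> nat) \<Rightarrow> nat \<Rightarrow> nat \<Rightarrow> nat \<Rightarrow> nat \<Rightarrow> nat \<Rightarrow> nat \<Rightarrow> nat" where
  "exchange F r a b l' = F(r := (F r)(a := 0, b := l'))"

lemma exchange_family:
  assumes F: "F \<in> stair_families d m" and r: "r < 2 * m" and ab: "a \<in> {1..m}" "b \<in> {1..m}"
    and l: "F r a \<noteq> 0" "l' \<noteq> 0" "l' \<le> d" and free: "a = b \<or> F r b = 0"
  shows "exchange F r a b l' \<in> stair_families d m"
    "(\<Prod>q\<in>{0..<2*m}. mval m x (exchange F r a b l' q)) * x (a, F r a) =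
     (\<Prod>q\<in>{0..<2*m}. mval m x (F q)) * x (b, l')"
proof -
  define k where "k = (F r)(a := 0)"
  have Fr: "F r \<in> multi_idx d m" "mdeg m (F r) = stair_size m r" using stair_familyD[OF F r] .
  have k: "k \<in> multi_idx d m" unfolding k_def by (rule multi_idx_upd[OF Fr(1) ab(1)]) simp
  have k0: "k a = 0" "k b = 0" using free by (auto simp: k_def)
  have Fk: "F r = k(a := F r a)" by (simp add: k_def)
  have E: "exchange F r a b l' r = k(b := l')" by (simp add: exchange_def k_def)
  have "mdeg m (k(b := l')) = stair_size m r"
    using Fr(2) mdeg_upd[of a m k "F r a", OF ab(1) k0(1) l(1)] mdeg_upd[of b m k l', OF ab(2) k0(2) l(2)] Fk by simp
  moreover have "k(b := l') \<in> multi_idx d m" by (rule multi_idx_upd[OF k ab(2) l(3)])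
  ultimately have "exchange F r a b l' q \<in> {k \<in> multi_idx d m. mdeg m k = stair_size m q}" if "q < 2 * m" for q
    using E stair_familyD[OF F that] by (cases "q = r") (simp_all add: exchange_def k_def)
  moreover have "exchange F r a b l' q = undefined" if "q \<notin> {0..<2*m}" for q
    using that r F by (auto simp: exchange_def stair_families_def PiE_iff extensional_def)
  ultimately show "exchange F r a b l' \<in> stair_families d m"
    unfolding stair_families_def PiE_iff extensional_def by auto
  have split: "(\<Prod>q\<in>{0..<2*m}. f q) = f r * (\<Prod>q\<in>{0..<2*m} - {r}. f q)" for f :: "nat \<Rightarrow> complex"
    using r by (intro prod.remove) auto
  have rest: "(\<Prod>q\<in>{0..<2*m} - {r}. mval m x (exchange F r a b l' q)) = (\<Prod>q\<in>{0..<2*m} - {r}. mval m x (F q))"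
    by (rule prod.cong) (auto simp: exchange_def)
  have v1: "mval m x (F r) = mval m x k * x (a, F r a)" using mval_upd[of a m k "F r a" x, OF ab(1) k0(1) l(1)] Fk by simp
  have v2: "mval m x (exchange F r a b l' r) = mval m x k * x (b, l')" unfolding E by (rule mval_upd[of b m k l', OF ab(2) k0(2) l(2)])
  show "(\<Prod>q\<in>{0..<2*m}. mval m x (exchange F r a b l' q)) * x (a, F r a) =
     (\<Prod>q\<in>{0..<2*m}. mval m x (F q)) * x (b, l')"
    unfolding split rest v1 v2 by simp
qed

definition entry_count :: "nat \<Rightarrow> (nat \<Rightarrow> nat \<Rightarrow> nat) \<Rightarrow> nat \<times> nat \<Rightarrow> int" where
  "entry_count m F v = (\<Sum>q\<in>{0..<2*m}. if F q (fst v) = snd v then 1 else 0)"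

lemma entry_count_exchange:
  assumes "r < 2 * m" "c \<noteq> 0" "F r a \<noteq> 0" "a = b \<or> F r b = 0" "l' \<noteq> 0"
  shows "entry_count m (exchange F r a b l') (i, c) =
    entry_count m F (i, c) + (if (i, c) = (b, l') then 1 else 0) - (if (i, c) = (a, F r a) then 1 else 0)"
proof -
  have split: "(\<Sum>q\<in>{0..<2*m}. f q) = f r + (\<Sum>q\<in>{0..<2*m} - {r}. f q)" for f :: "nat \<Rightarrow> int"
    using assms(1) by (intro sum.remove) auto
  have rest: "(\<Sum>q\<in>{0..<2*m} - {r}. if exchange F r a b l' q i = c then 1 else (0::int)) = (\<Sum>q\<in>{0..<2*m} - {r}. if F q i = c then 1 else 0)"
    by (rule sum.cong) (auto simp: exchange_def)
  show ?thesis
    unfolding entry_count_def fst_conv snd_conv split rest using assms by (auto simp: exchange_def)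
qed

text \<open>The squared Euclidean norm of the exponent vector of the monomial in \<open>x\<close>
  attached to \<open>F\<close>; maximizing it looks for an extreme monomial among the nonzero
  coordinates.\<close>

definition energy :: "nat \<Rightarrow> nat \<Rightarrow> (nat \<Rightarrow> nat \<Rightarrow> nat) \<Rightarrow> int" where
  "energy d m F = (\<Sum>v\<in>{1..m} \<times> {1..d}. (entry_count m F v)\<^sup>2)"

text \<open>The two exchanges move the exponent vector by opposite vectors with one entry 1 and one
  entry -1, of squared norm 2. The parallelogram law gives the summand 4.\<close>

lemma energy_exchange:
  assumes r: "r < 2 * m" "s < 2 * m" and ab: "a \<in> {1..m}" "b \<in> {1..m}"
    and l: "F r a \<in> {1..d}" "F s b \<in> {1..d}" and free: "a = b \<or> F r b = 0" "a = b \<or> F s a = 0"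
    and ne: "(a, F r a) \<noteq> (b, F s b)"
  shows "energy d m (exchange F r a b (F s b)) + energy d m (exchange F s b a (F r a)) = 2 * energy d m F + 4"
proof -
  have nz: "F r a \<noteq> 0" "F s b \<noteq> 0" using l by auto
  have free': "b = a \<or> F s a = 0" using free(2) by auto
  have "(entry_count m (exchange F r a b (F s b)) v)\<^sup>2 + (entry_count m (exchange F s b a (F r a)) v)\<^sup>2 =
      2 * (entry_count m F v)\<^sup>2 + (if v = (b, F s b) then 2 else 0) + (if v = (a, F r a) then 2 else 0)"
    if v: "v \<in> {1..m} \<times> {1..d}" for v
  proof -
    obtain i c where vic: "v = (i, c)" by (cases v)
    have c: "c \<noteq> 0" using v vic by auto
    show ?thesis
      unfolding vic entry_count_exchange[of r m c F a b "F s b" i, OF r(1) c nz(1) free(1) nz(2)]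
        entry_count_exchange[of s m c F b a "F r a" i, OF r(2) c nz(2) free' nz(1)]
      using ne by (auto simp: power2_eq_square algebra_simps)
  qed
  hence "energy d m (exchange F r a b (F s b)) + energy d m (exchange F s b a (F r a)) =
     (\<Sum>v\<in>{1..m} \<times> {1..d}. 2 * (entry_count m F v)\<^sup>2 + (if v = (b, F s b) then 2 else 0) + (if v = (a, F r a) then 2 else 0))"
    unfolding energy_def sum.distrib[symmetric] by (rule sum.cong[OF refl])
  also have "\<dots> = 2 * energy d m F + 4"
    using ab l by (simp add: sum.distrib energy_def sum_distrib_left)
  finally show ?thesis .
qed

text \<open>Extension of partial functions, where the value 0 means undefined.\<close>

definition idx_le :: "nat \<Rightarrow> (nat \<Rightarrow> nat) \<Rightarrow> (nat \<Rightarrow> nat) \<Rightarrow> bool" where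
  "idx_le m k k' \<longleftrightarrow> (\<forall>i\<in>{1..m}. k i \<noteq> 0 \<longrightarrow> k' i = k i)"

text \<open>The opposite changes cancel: the product of the two exchanged coordinates equals the
  square of the original one at all generic vectors. This binomial relation persists in the limit,
  where the square is nonzero.\<close>

lemma alive_exchange:
  assumes y: "chow_limit d m y" and F: "F \<in> stair_families d m" and alive: "y (row_monomial m F) \<noteq> 0"
    and r: "r < 2 * m" "s < 2 * m" and ab: "a \<in> {1..m}" "b \<in> {1..m}"
    and l: "F r a \<in> {1..d}" "F s b \<in> {1..d}" and free: "a = b \<or> F r b = 0" "a = b \<or> F s a = 0"
  shows "y (row_monomial m (exchange F r a b (F s b))) \<noteq> 0" "y (row_monomial m (exchange F s b a (F r a))) \<noteq> 0"
proof -
  have nz: "F r a \<noteq> 0" "F s b \<noteq> 0" "F r a \<le> d" "F s b \<le> d" using l by auto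
  have free': "b = a \<or> F s a = 0" using free(2) by auto
  note E1 = exchange_family[OF F r(1) ab nz(1) nz(2) nz(4) free(1)]
  note E2 = exchange_family[OF F r(2) ab(2,1) nz(2) nz(1) nz(3) free']
  let ?M1 = "row_monomial m (exchange F r a b (F s b))" and ?M2 = "row_monomial m (exchange F s b a (F r a))"
    and ?M = "row_monomial m F"
  have "peval (Var ?M1 * Var ?M2 - Var ?M * Var ?M) y = 0"
  proof (rule chow_limitD[OF y])
    show "homogeneous (1 + 1) (Var ?M1 * Var ?M2 - Var ?M * Var ?M)"
      by (intro homogeneous_diff homogeneous_mult homogeneous_Var)
    fix x assume x: "generic d m x"
    have xa: "x (a, F r a) \<noteq> 0" "x (b, F s b) \<noteq> 0" using x ab l by (auto simp: generic_def)
    define P where "P = (\<Prod>q\<in>{0..<2*m}. mval m x (F q))"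
    define P1 where "P1 = (\<Prod>q\<in>{0..<2*m}. mval m x (exchange F r a b (F s b) q))"
    define P2 where "P2 = (\<Prod>q\<in>{0..<2*m}. mval m x (exchange F s b a (F r a) q))"
    have "P1 * x (a, F r a) = P * x (b, F s b)" "P2 * x (b, F s b) = P * x (a, F r a)"
      unfolding P_def P1_def P2_def by (rule E1(2), rule E2(2))
    hence "(P1 * P2) * (x (a, F r a) * x (b, F s b)) = (P * P) * (x (a, F r a) * x (b, F s b))"
      by (metis (no_types, lifting) mult.assoc mult.commute)
    hence "P1 * P2 = P * P" using xa by simp
    thus "peval (Var ?M1 * Var ?M2 - Var ?M * Var ?M) (chow_vec d m x) = 0"
      by (simp add: peval_diff peval_mult chow_vec_stair_family[OF E1(1)] chow_vec_stair_family[OF E2(1)]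
          chow_vec_stair_family[OF F] flip: P_def P1_def P2_def)
  qed
  hence "y ?M1 * y ?M2 = y ?M * y ?M" by (simp add: peval_diff peval_mult)
  thus "y ?M1 \<noteq> 0" "y ?M2 \<noteq> 0" using alive by auto
qed

text \<open>Among the nonvanishing staircase coordinates one of maximal energy is totally ordered, since
  the exchange of two incomparable entries changes the energy by four on average.\<close>

lemma ex_alive_comparable_family:
  assumes y: "chow_limit d m y"
  obtains F where "F \<in> stair_families d m" "y (row_monomial m F) \<noteq> 0"
    "\<forall>r<2*m. \<forall>s<2*m. idx_le m (F r) (F s) \<or> idx_le m (F s) (F r)"
proof -
  define S where "S = {F \<in> stair_families d m. y (row_monomial m F) \<noteq> 0}"
  have "finite S" unfolding S_def stair_families_def
    by (rule finite_subset[OF Collect_subset finite_PiE]) (auto simp: finite_multi_idx)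
  moreover have "S \<noteq> {}" using ex_alive_stair_family[OF y] unfolding S_def by blast
  ultimately have "\<exists>F\<in>S. \<forall>F'\<in>S. nat (energy d m F') \<le> nat (energy d m F)" by (rule finite_has_maximizer)
  then obtain F where F: "F \<in> S" "\<forall>F'\<in>S. nat (energy d m F') \<le> nat (energy d m F)" by blast
  have Fm: "F \<in> stair_families d m" and alive: "y (row_monomial m F) \<noteq> 0" using F(1) by (auto simp: S_def)
  have energy_nonneg: "energy d m F' \<ge> 0" for F' by (simp add: energy_def sum_nonneg)
  have no_exchange: False
    if h: "r < 2 * m" "s < 2 * m" "a \<in> {1..m}" "b \<in> {1..m}" "F r a \<noteq> 0" "F s b \<noteq> 0" "a = b \<or> F r b = 0" "a = b \<or> F s a = 0"
      "(a, F r a) \<noteq> (b, F s b)" for r s a b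
  proof -
    have l: "F r a \<in> {1..d}" "F s b \<in> {1..d}"
      using stair_familyD(1)[OF Fm h(1)] stair_familyD(1)[OF Fm h(2)] h(3-6) by (force simp: multi_idx_def)+
    have free': "b = a \<or> F s a = 0" using h(8) by auto
    have "exchange F r a b (F s b) \<in> stair_families d m"
      by (rule exchange_family(1)[OF Fm h(1,3,4,5,6) _ h(7)]) (use l in simp)
    moreover have "exchange F s b a (F r a) \<in> stair_families d m"
      by (rule exchange_family(1)[OF Fm h(2,4,3,6,5) _ free']) (use l in simp)
    ultimately have "exchange F r a b (F s b) \<in> S" "exchange F s b a (F r a) \<in> S"
      using alive_exchange[OF y Fm alive h(1,2,3,4) l h(7,8)] by (simp_all add: S_def)
    hence "nat (energy d m (exchange F r a b (F s b))) \<le> nat (energy d m F)"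
      "nat (energy d m (exchange F s b a (F r a))) \<le> nat (energy d m F)" using F(2) by blast+
    thus False using energy_exchange[OF h(1,2,3,4) l h(7,8,9)] energy_nonneg[of F] by linarith
  qed
  have "idx_le m (F r) (F s) \<or> idx_le m (F s) (F r)" if rs: "r < 2 * m" "s < 2 * m" for r s
  proof (rule ccontr)
    assume "\<not> ?thesis"
    then obtain a b where a: "a \<in> {1..m}" "F r a \<noteq> 0" "F s a \<noteq> F r a" and b: "b \<in> {1..m}" "F s b \<noteq> 0" "F r b \<noteq> F s b"
      by (auto simp: idx_le_def)
    show False
    \<comment> \<open>If both rows have an entry at \<open>a\<close> or at \<open>b\<close>, the
      conflicting entries are exchanged at that one position. Otherwise each row is free where the
      other is occupied, and the exchange runs between two positions.\<close>
    proof (cases "F s a = 0")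
      case False
      thus ?thesis using no_exchange[of r s a a] rs a by simp
    next
      case sa: True
      show ?thesis
      proof (cases "F r b = 0")
        case False
        thus ?thesis using no_exchange[of r s b b] rs b by simp
      next
        case True
        moreover have "a \<noteq> b" using sa b(2) by auto
        ultimately show ?thesis using no_exchange[of r s a b] rs a b sa by simp
      qed
    qed
  qed
  thus ?thesis by (intro that[OF Fm alive]) simp
qed

section \<open>Chains of multi-indices\<close>

text \<open>Equivalent to an ordering of \<open>{1..m}\<close> together with a label in
  \<open>{1..d}\<close> for each element: \<open>K j\<close> records the first \<open>j\<close>
  elements with their labels. Chains index the charts of the left inverse.\<close>

definition chain :: "nat \<Rightarrow> nat \<Rightarrow> (nat \<Rightarrow> nat \<Rightarrow> nat) \<Rightarrow> bool" where
  "chain d m K \<longleftrightarrow> (\<forall>j\<le>m. K j \<in> multi_idx d m \<and> mdeg m (K j) = j) \<and>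
     (\<forall>i j. i \<le> j \<longrightarrow> j \<le> m \<longrightarrow> idx_le m (K i) (K j))"

lemma idx_le_msupp: "idx_le m k k' \<Longrightarrow> msupp m k \<subseteq> msupp m k'"
  by (auto simp: idx_le_def msupp_def)

lemma idx_le_eq_if_mdeg_ge:
  assumes "idx_le m k k'" "mdeg m k' \<le> mdeg m k" "k \<in> multi_idx d m" "k' \<in> multi_idx d m"
  shows "k = k'"
proof (rule multi_idx_eqI[OF assms(3,4)])
  have "msupp m k = msupp m k'"
    using idx_le_msupp[OF assms(1)] assms(2) by (intro card_seteq) (auto simp: mdeg_def)
  fix i assume i: "i \<in> {1..m}"
  show "k i = k' i"
  proof (cases "k i = 0")
    case True
    hence "i \<notin> msupp m k" by (simp add: msupp_def)
    hence "i \<notin> msupp m k'" using \<open>msupp m k = msupp m k'\<close> by simp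
    thus ?thesis using True i by (simp add: msupp_def)
  next
    case False
    thus ?thesis using assms(1) i by (simp add: idx_le_def)
  qed
qed

text \<open>In a totally ordered family two rows of equal weight coincide. Hence both blocks of rows
  are read off from one index per weight.\<close>

lemma ex_alive_chain:
  assumes y: "chow_limit d m y" and m: "m \<ge> 1"
  obtains K where "chain d m K" "y (staircase m K K) \<noteq> 0"
proof -
  obtain F where F: "F \<in> stair_families d m" "y (row_monomial m F) \<noteq> 0"
    and comp: "\<forall>r<2*m. \<forall>s<2*m. idx_le m (F r) (F s) \<or> idx_le m (F s) (F r)"
    using y by (rule ex_alive_comparable_family)
  have le: "idx_le m (F r) (F s)" if "r < 2 * m" "s < 2 * m" "stair_size m r \<le> stair_size m s" for r s
  proof (cases "idx_le m (F r) (F s)")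
    case False
    hence "idx_le m (F s) (F r)" using comp that by blast
    hence "F s = F r"
      by (rule idx_le_eq_if_mdeg_ge) (use stair_familyD[OF F(1)] that in auto)
    thus ?thesis by (simp add: idx_le_def)
  qed
  \<comment> \<open>The first block carries the weights below \<open>m\<close>; weight
    \<open>m\<close> occurs only in the last row of the second block.\<close>
  define row where "row j = (if j < m then j else 2 * m - 1)" for j
  have row: "row j < 2 * m" "stair_size m (row j) = j" if "j \<le> m" for j
    using that m by (auto simp: row_def stair_size_def)
  define K where "K j = F (row j)" for j
  have "chain d m K"
    unfolding chain_def K_def using stair_familyD[OF F(1)] row by (auto intro!: le)
  moreover have "row_monomial m F = staircase m K K"
  proof -
    have "F (m + i) = K (Suc i)" if "i < m" for i
    proof (rule idx_le_eq_if_mdeg_ge[where d = d])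
      have sz: "stair_size m (m + i) = Suc i" by (simp add: stair_size_def)
      show "idx_le m (F (m + i)) (K (Suc i))" unfolding K_def using that row[of "Suc i"] sz by (intro le) auto
      show "mdeg m (K (Suc i)) \<le> mdeg m (F (m + i))" unfolding K_def
        using that row[of "Suc i"] sz stair_familyD(2)[OF F(1), of "m + i"] stair_familyD(2)[OF F(1), of "row (Suc i)"] by simp
      show "F (m + i) \<in> multi_idx d m" using stair_familyD(1)[OF F(1), of "m + i"] that by simp
      show "K (Suc i) \<in> multi_idx d m" unfolding K_def using stair_familyD(1)[OF F(1), of "row (Suc i)"] row[of "Suc i"] that by simp
    qed
    moreover have "F i = K i" if "i < m" for i using that by (simp add: K_def row_def)
    ultimately show ?thesis unfolding row_monomial_split staircase_def by simp
  qed
  ultimately show ?thesis using F(2) by (intro that) simp_all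
qed

section \<open>Coordinate ratios read off from a chain\<close>

definition first_level :: "nat \<Rightarrow> (nat \<Rightarrow> nat \<Rightarrow> nat) \<Rightarrow> nat set \<Rightarrow> nat" where
  "first_level m K J = (LEAST p. msupp m (K p) \<inter> J \<noteq> {})"

text \<open>Replaces the entry with which the chain first enters \<open>J\<close> by the entry
  \<open>v\<close>, so that the coordinate changes by the ratio of the two entries of
  \<open>x\<close>. Only the second family of variables is altered: its weights
  \<open>1, ..., m\<close> include every possible first level.\<close>

definition swap_monomial :: "nat \<Rightarrow> (nat \<Rightarrow> nat \<Rightarrow> nat) \<Rightarrow> nat set \<Rightarrow> nat \<times> nat \<Rightarrow> (bool \<times> (nat \<Rightarrow> nat)) \<Rightarrow>\<^sub>0 nat" where
  "swap_monomial m K J v =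
     (let p = first_level m K J in staircase m K (K(p := (K (p - 1))(fst v := snd v))))"

text \<open>Supports grow by one element per level, from the empty set to \<open>{1..m}\<close>. At
  the first level that meets \<open>J\<close> the new element must therefore lie in
  \<open>J\<close>, and nothing else changes.\<close>

lemma chain_first_level:
  assumes K: "chain d m K" and J: "J \<subseteq> {1..m}" "J \<noteq> {}" and p: "p = first_level m K J"
  obtains b c where "b \<in> J" "c \<in> {1..d}" "K p = (K (p - 1))(b := c)" "1 \<le> p" "p \<le> m"
    "msupp m (K (p - 1)) \<inter> J = {}"
proof -
  have Kj: "K j \<in> multi_idx d m" "mdeg m (K j) = j" if "j \<le> m" for j using K that by (auto simp: chain_def)
  have "msupp m (K m) = {1..m}"
    using Kj(2)[of m] msupp_subset by (intro card_seteq) (auto simp: mdeg_def)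
  hence hit: "msupp m (K m) \<inter> J \<noteq> {}" using J by auto
  have pJ: "msupp m (K p) \<inter> J \<noteq> {}" unfolding p first_level_def by (rule LeastI[of _ m]) (rule hit)
  have pm: "p \<le> m" unfolding p first_level_def by (rule Least_le) (rule hit)
  have "msupp m (K 0) = {}" using Kj(2)[of 0] by (simp add: mdeg_def)
  hence p1: "1 \<le> p" using pJ by (cases p) auto
  have prev: "msupp m (K (p - 1)) \<inter> J = {}"
  proof (rule ccontr)
    assume "\<not> ?thesis"
    hence "p \<le> p - 1" unfolding p first_level_def by (intro Least_le) simp
    thus False using p1 by simp
  qed
  have le: "idx_le m (K (p - 1)) (K p)" using K pm by (auto simp: chain_def)
  obtain b where b: "b \<in> msupp m (K p)" "b \<in> J" using pJ by auto
  have bnot: "b \<notin> msupp m (K (p - 1))" using prev b by auto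
  have "insert b (msupp m (K (p - 1))) = msupp m (K p)"
  proof (rule card_seteq)
    show "insert b (msupp m (K (p - 1))) \<subseteq> msupp m (K p)" using idx_le_msupp[OF le] b by auto
    show "card (msupp m (K p)) \<le> card (insert b (msupp m (K (p - 1))))"
      using Kj(2)[OF pm] Kj(2)[of "p - 1"] pm p1 bnot by (simp add: mdeg_def)
  qed simp
  hence supp: "i = b \<or> i \<in> msupp m (K (p - 1))" if "i \<in> msupp m (K p)" for i using that by auto
  have b1: "b \<in> {1..m}" using b J by auto
  have c: "K p b \<in> {1..d}" using b Kj(1)[OF pm] by (auto simp: msupp_def multi_idx_def PiE_iff)
  have "K p = (K (p - 1))(b := K p b)"
  proof (rule multi_idx_eqI[where d = d and m = m])
    show "K p \<in> multi_idx d m" using Kj(1)[OF pm] .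
    show "(K (p - 1))(b := K p b) \<in> multi_idx d m" using Kj(1)[of "p - 1"] pm b1 c by (intro multi_idx_upd) auto
    fix i assume i: "i \<in> {1..m}"
    show "K p i = ((K (p - 1))(b := K p b)) i"
    proof (cases "K (p - 1) i = 0")
      case True
      hence "i = b \<or> K p i = 0" using supp[of i] i by (auto simp: msupp_def)
      thus ?thesis using True by auto
    next
      case False
      hence "K p i = K (p - 1) i" using le i by (simp add: idx_le_def)
      thus ?thesis by (cases "i = b") simp_all
    qed
  qed
  with b(2) c show ?thesis using p1 pm prev by (rule that)
qed

lemma swap_monomial_same:
  assumes "p = first_level m K J" "K p = (K (p - 1))(b := c)"
  shows "swap_monomial m K J (b, c) = staircase m K K"
proof -
  have "K(p := (K (p - 1))(b := c)) = K" unfolding assms(2)[symmetric] by simp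
  thus ?thesis by (simp add: swap_monomial_def flip: assms(1))
qed

text \<open>Both monomials are staircases and so have the same coefficient; their values differ in
  the single factor at level \<open>p\<close>.\<close>

lemma chow_vec_swap_monomial:
  assumes K: "chain d m K" and p: "p = first_level m K J" and Kp: "K p = (K (p - 1))(b := c)"
    and b: "b \<in> J" "c \<in> {1..d}" and J: "J \<subseteq> {1..m}" and p1: "1 \<le> p" "p \<le> m"
    and prev: "msupp m (K (p - 1)) \<inter> J = {}" and v: "l \<in> J" "k \<in> {1..d}"
  shows "chow_vec d m x (swap_monomial m K J (l, k)) * x (b, c) = chow_vec d m x (staircase m K K) * x (l, k)"
proof -
  have Kj: "K j \<in> multi_idx d m" "mdeg m (K j) = j" if "j \<le> m" for j using K that by (auto simp: chain_def)
  have bl: "b \<in> {1..m}" "l \<in> {1..m}" using b(1) v(1) J by auto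
  have "b \<notin> msupp m (K (p - 1))" "l \<notin> msupp m (K (p - 1))" using prev b(1) v(1) by auto
  hence z: "K (p - 1) b = 0" "K (p - 1) l = 0" using bl by (simp_all add: msupp_def)
  define k' where "k' = (K (p - 1))(l := k)"
  have k': "k' \<in> multi_idx d m" "mdeg m k' = p"
    unfolding k'_def using Kj[of "p - 1"] p1 bl v mdeg_upd[of l m "K (p - 1)" k, OF bl(2) z(2)] by (auto intro!: multi_idx_upd)
  have cs: "chow_coeff d m (staircase m K (K(p := k'))) = stair_sign m"
    by (rule chow_coeff_staircase) (use Kj k' in auto)
  have cK: "chow_coeff d m (staircase m K K) = stair_sign m"
    by (rule chow_coeff_staircase) (use Kj in auto)
  have v1: "mval m x (K p) = mval m x (K (p - 1)) * x (b, c)" unfolding Kp by (rule mval_upd[of b m "K (p - 1)" c, OF bl(1) z(1)]) (use b in simp)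
  have v2: "mval m x k' = mval m x (K (p - 1)) * x (l, k)" unfolding k'_def by (rule mval_upd[of l m "K (p - 1)" k, OF bl(2) z(2)]) (use v in simp)
  have split: "(\<Prod>i<m. f (Suc i)) = f p * (\<Prod>i\<in>{..<m} - {p - 1}. f (Suc i))" for f :: "nat \<Rightarrow> complex"
    using p1 prod.remove[of "{..<m}" "p - 1" "\<lambda>i. f (Suc i)"] by simp
  have rest: "(\<Prod>i\<in>{..<m} - {p - 1}. mval m x ((K(p := k')) (Suc i))) = (\<Prod>i\<in>{..<m} - {p - 1}. mval m x (K (Suc i)))"
    by (rule prod.cong) auto
  have "(\<Prod>i<m. mval m x ((K(p := k')) (Suc i))) * x (b, c) = (\<Prod>i<m. mval m x (K (Suc i))) * x (l, k)"
    unfolding split[of "\<lambda>j. mval m x ((K(p := k')) j)"] split[of "\<lambda>j. mval m x (K j)"] rest by (simp add: v1 v2)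
  moreover have "swap_monomial m K J (l, k) = staircase m K (K(p := k'))"
    by (simp add: swap_monomial_def k'_def flip: p)
  ultimately show ?thesis
    by (simp add: chow_vec_def cs cK mon_eval_staircase[of m _ _ "mval m x"])
qed

section \<open>From limits of Chow points back to the blow-up\<close>

lemma LM_index_setD:
  assumes "I \<in> LM_index_sets n"
  shows "I - {n} \<subseteq> {1..n-1}" "I - {n} \<noteq> {}"
proof -
  have I: "I \<subset> {1..n}" "2 \<le> card I" using assms by (auto simp: LM_index_sets_def)
  thus "I - {n} \<subseteq> {1..n-1}" by force
  show "I - {n} \<noteq> {}"
  proof
    assume "I - {n} = {}"
    hence "card I \<le> card {n}" by (intro card_mono) auto
    thus False using I(2) by simp
  qed
qed

lemma finite_LM_index_sets: "finite (LM_index_sets n)"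
  by (rule finite_subset[of _ "Pow {1..n}"]) (auto simp: LM_index_sets_def)

lemma peval_LM_gen: "peval (LM_gen n s) x = (\<Prod>I\<in>LM_index_sets n. x (s I))"
  by (simp add: LM_gen_def peval_prod)

lemma in_zariski_closureI:
  assumes "p \<in> pspace UNIV" "\<And>U. p \<in> U \<Longrightarrow> openin zariski U \<Longrightarrow> \<exists>q\<in>S. q \<in> U"
  shows "p \<in> zariski closure_of S"
  unfolding in_closure_of topspace_zariski using assms(1) assms(2)[unfolded Bex_def] by simp

definition LM_vec :: "nat \<Rightarrow> nat \<Rightarrow> (nat \<times> nat \<Rightarrow> complex) \<Rightarrow> (nat \<times> nat) \<times> (nat set \<Rightarrow> nat \<times> nat) \<Rightarrow> complex" where
  "LM_vec d n x = (\<lambda>(v, s). if s \<in> LM_choices d n then x v * peval (LM_gen n s) x else 0)"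

lemma LM_over_eq: "LM_over d n x = hclass (LM_vec d n x)"
  by (simp add: LM_over_def blowup_point_def LM_vec_def)

text \<open>The blow-up sits in a Segre product: one factor for \<open>x\<close> itself, whose
  coordinates are recovered with \<open>J = {1..n-1}\<close>, and one choice of coordinate for each
  blown-up locus, recovered with \<open>J = I - {n}\<close>. Zero entries do not disturb the common
  degree.\<close>

definition inverse_form :: "nat \<Rightarrow> nat \<Rightarrow> (nat \<Rightarrow> nat \<Rightarrow> nat) \<Rightarrow> (nat \<times> nat) \<times> (nat set \<Rightarrow> nat \<times> nat) \<Rightarrow>
    ((bool \<times> (nat \<Rightarrow> nat)) \<Rightarrow>\<^sub>0 nat) cpoly" where
  "inverse_form d n K = (\<lambda>(v, s). if v \<in> LM_coords d n \<and> s \<in> LM_choices d n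
     then Var (swap_monomial (n - 1) K {1..n-1} v) *
       (\<Prod>I\<in>LM_index_sets n. Var (swap_monomial (n - 1) K (I - {n}) (s I))) else 0)"

lemma homogeneous_inverse_form: "homogeneous (1 + card (LM_index_sets n)) (inverse_form d n K a)"
proof -
  obtain v s where a: "a = (v, s)" by (cases a)
  have "homogeneous (1 + (\<Sum>I\<in>LM_index_sets n. 1)) (Var (swap_monomial (n - 1) K {1..n-1} v) *
       (\<Prod>I\<in>LM_index_sets n. Var (swap_monomial (n - 1) K (I - {n}) (s I))))"
    by (intro homogeneous_mult homogeneous_prod homogeneous_Var)
  thus ?thesis by (simp add: a inverse_form_def)
qed

lemma generic_mval_nonzero: "generic d m x \<Longrightarrow> k \<in> multi_idx d m \<Longrightarrow> mval m x k \<noteq> 0"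
  by (rule mval_nonzero[where d = d]) (simp_all add: generic_def)

lemma chow_vec_chain_nonzero:
  assumes "chain d m K" "generic d m x"
  shows "chow_vec d m x (staircase m K K) \<noteq> 0"
proof -
  have K: "K j \<in> multi_idx d m" "mdeg m (K j) = j" if "j \<le> m" for j using assms(1) that by (auto simp: chain_def)
  have "chow_coeff d m (staircase m K K) = stair_sign m" by (rule chow_coeff_staircase) (use K in auto)
  moreover have "mval m x (K j) \<noteq> 0" if "j \<le> m" for j by (rule generic_mval_nonzero[OF assms(2) K(1)[OF that]])
  ultimately show ?thesis
    by (simp add: chow_vec_def mon_eval_staircase[of m _ _ "mval m x"] stair_sign_nonzero)
qed

text \<open>The factor depends on \<open>J\<close> but not on the entry, so the swaps recover the
  coordinates over \<open>J\<close> as a point of projective space.\<close>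

lemma ex_swap_ratio:
  assumes K: "chain d m K" and J: "J \<subseteq> {1..m}" "J \<noteq> {}" and x: "generic d m x"
  shows "\<exists>\<rho>. \<rho> \<noteq> 0 \<and> (\<forall>v\<in>J \<times> {1..d}. chow_vec d m x (swap_monomial m K J v) = \<rho> * x v)"
proof -
  define p where "p = first_level m K J"
  obtain b c where bc: "b \<in> J" "c \<in> {1..d}" "K p = (K (p - 1))(b := c)" "1 \<le> p" "p \<le> m"
    "msupp m (K (p - 1)) \<inter> J = {}" by (rule chain_first_level[OF K J p_def])
  have xb: "x (b, c) \<noteq> 0" using x bc(1,2) J(1) by (auto simp: generic_def)
  define \<rho> where "\<rho> = chow_vec d m x (staircase m K K) / x (b, c)"
  have "\<rho> \<noteq> 0" using chow_vec_chain_nonzero[OF K x] xb by (simp add: \<rho>_def)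
  moreover have "chow_vec d m x (swap_monomial m K J v) = \<rho> * x v" if v: "v \<in> J \<times> {1..d}" for v
  proof -
    obtain l k where lk: "v = (l, k)" "l \<in> J" "k \<in> {1..d}" using v by auto
    show ?thesis
      using chow_vec_swap_monomial[OF K p_def bc(3,1,2) J(1) bc(4,5,6) lk(2,3), of x] xb
      by (simp add: \<rho>_def lk(1) field_simps)
  qed
  ultimately show ?thesis by blast
qed

text \<open>Swapping in the entry that the chain itself has at its first level of \<open>J\<close>
  changes nothing. This keeps the recovered coordinates from vanishing simultaneously wherever the
  chain coordinate is nonzero.\<close>

lemma ex_neutral_swap:
  assumes K: "chain d m K" and J: "J \<subseteq> {1..m}" "J \<noteq> {}"
  shows "\<exists>v\<in>J \<times> {1..d}. swap_monomial m K J v = staircase m K K"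
proof -
  define p where "p = first_level m K J"
  obtain b c where bc: "b \<in> J" "c \<in> {1..d}" "K p = (K (p - 1))(b := c)" "1 \<le> p" "p \<le> m"
    "msupp m (K (p - 1)) \<inter> J = {}" by (rule chain_first_level[OF K J p_def])
  show ?thesis using swap_monomial_same[OF p_def bc(3)] bc(1,2) by blast
qed

lemma inverse_form_chow_vec:
  assumes K: "chain d (n - 1) K" and x: "generic d (n - 1) x" and n: "n \<ge> 2"
  shows "\<exists>C. C \<noteq> 0 \<and> (\<forall>a. peval (inverse_form d n K a) (chow_vec d (n - 1) x) = C * LM_vec d n x a)"
proof -
  let ?m = "n - 1"
  have ne: "{1..?m} \<noteq> {}" using n by simp
  obtain \<rho>0 where \<rho>0: "\<rho>0 \<noteq> 0" "\<forall>v\<in>{1..?m} \<times> {1..d}. chow_vec d ?m x (swap_monomial ?m K {1..?m} v) = \<rho>0 * x v"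
    using ex_swap_ratio[OF K order_refl ne x] by (elim exE conjE) (rule that)
  have "\<forall>I\<in>LM_index_sets n. \<exists>\<rho>. \<rho> \<noteq> 0 \<and> (\<forall>v\<in>(I - {n}) \<times> {1..d}. chow_vec d ?m x (swap_monomial ?m K (I - {n}) v) = \<rho> * x v)"
    by (intro ballI ex_swap_ratio[OF K LM_index_setD x])
  from bchoice[OF this] obtain \<rho> where \<rho>: "\<forall>I\<in>LM_index_sets n. \<rho> I \<noteq> 0 \<and>
     (\<forall>v\<in>(I - {n}) \<times> {1..d}. chow_vec d ?m x (swap_monomial ?m K (I - {n}) v) = \<rho> I * x v)" ..
  define C where "C = \<rho>0 * (\<Prod>I\<in>LM_index_sets n. \<rho> I)"
  have "C \<noteq> 0" using \<rho>0(1) \<rho> by (simp add: C_def finite_LM_index_sets)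
  moreover have "peval (inverse_form d n K a) (chow_vec d ?m x) = C * LM_vec d n x a" for a
  proof -
    obtain v s where a: "a = (v, s)" by (cases a)
    show ?thesis
    proof (cases "v \<in> LM_coords d n \<and> s \<in> LM_choices d n")
      case True
      have "(\<Prod>I\<in>LM_index_sets n. chow_vec d ?m x (swap_monomial ?m K (I - {n}) (s I))) =
          (\<Prod>I\<in>LM_index_sets n. \<rho> I * x (s I))"
      proof (rule prod.cong[OF refl])
        fix I assume I: "I \<in> LM_index_sets n"
        have "s I \<in> (I - {n}) \<times> {1..d}" using True I by (auto simp: LM_choices_def)
        thus "chow_vec d ?m x (swap_monomial ?m K (I - {n}) (s I)) = \<rho> I * x (s I)"
          by (rule bspec[OF conjunct2[OF bspec[OF \<rho> I]]])
      qed
      moreover have "chow_vec d ?m x (swap_monomial ?m K {1..?m} v) = \<rho>0 * x v"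
        by (rule bspec[OF \<rho>0(2)]) (use True in \<open>simp add: LM_coords_def\<close>)
      ultimately show ?thesis
        using True by (simp add: a inverse_form_def LM_vec_def peval_mult peval_prod peval_LM_gen C_def prod.distrib)
    next
      case False
      moreover have "x v = 0" if "v \<notin> LM_coords d n" using x that unfolding generic_def supported_def LM_coords_def by blast
      ultimately show ?thesis by (auto simp: a inverse_form_def LM_vec_def)
    qed
  qed
  ultimately show ?thesis by blast
qed

lemma inverse_form_nonzero:
  assumes K: "chain d (n - 1) K" and n: "n \<ge> 2" and y: "y (staircase (n - 1) K K) \<noteq> 0"
  shows "(\<lambda>a. peval (inverse_form d n K a) y) \<noteq> (\<lambda>_. 0)"
proof -
  let ?m = "n - 1"
  have ne: "{1..?m} \<noteq> {}" using n by simp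
  obtain v where v: "v \<in> {1..?m} \<times> {1..d}" "swap_monomial ?m K {1..?m} v = staircase ?m K K"
    using ex_neutral_swap[OF K order_refl ne] by (elim bexE) (rule that)
  have "\<forall>I\<in>LM_index_sets n. \<exists>w. w \<in> (I - {n}) \<times> {1..d} \<and> swap_monomial ?m K (I - {n}) w = staircase ?m K K"
  proof
    fix I assume "I \<in> LM_index_sets n"
    from ex_neutral_swap[OF K LM_index_setD[OF this]]
    show "\<exists>w. w \<in> (I - {n}) \<times> {1..d} \<and> swap_monomial ?m K (I - {n}) w = staircase ?m K K" by blast
  qed
  from bchoice[OF this] obtain s where s: "\<forall>I\<in>LM_index_sets n. s I \<in> (I - {n}) \<times> {1..d} \<and>
    swap_monomial ?m K (I - {n}) (s I) = staircase ?m K K" ..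
  define s' where "s' = restrict s (LM_index_sets n)"
  have "s' \<in> LM_choices d n" using s unfolding LM_choices_def s'_def by auto
  moreover have "(\<Prod>I\<in>LM_index_sets n. y (swap_monomial ?m K (I - {n}) (s' I))) = (\<Prod>I\<in>LM_index_sets n. y (staircase ?m K K))"
    by (rule prod.cong) (use s in \<open>auto simp: s'_def\<close>)
  ultimately have "peval (inverse_form d n K (v, s')) y = y (staircase ?m K K) * (\<Prod>I\<in>LM_index_sets n. y (staircase ?m K K))"
    using v by (simp add: inverse_form_def LM_coords_def peval_mult peval_prod del: prod_constant)
  hence nz: "peval (inverse_form d n K (v, s')) y \<noteq> 0" using y by simp
  show ?thesis
  proof
    assume "(\<lambda>a. peval (inverse_form d n K a) y) = (\<lambda>_. 0)"
    from fun_cong[OF this, of "(v, s')"] nz show False by simp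
  qed
qed

lemma hclass_eq_if_proportional:
  assumes "\<And>a b. A a * B b = A b * B a" "A \<noteq> (\<lambda>_. 0)" "B \<noteq> (\<lambda>_. 0)"
  shows "hclass A = hclass B"
proof -
  obtain b where b: "B b \<noteq> 0" using assms(3) by auto
  obtain a where a: "A a \<noteq> 0" using assms(2) by auto
  have Aeq: "A = (\<lambda>i. A b / B b * B i)"
  proof
    fix i show "A i = A b / B b * B i" using assms(1)[of i b] b by (simp add: field_simps)
  qed
  have "A b \<noteq> 0"
  proof
    assume "A b = 0"
    hence "A a * B b = 0" using assms(1)[of a b] by simp
    thus False using a b by simp
  qed
  thus ?thesis using hclass_scale[of "A b / B b" B] b Aeq by simp
qed

text \<open>At generic vectors both charts give multiples of the same \<open>LM_vec\<close>, so all
  cross products vanish; being homogeneous relations, they vanish at \<open>y\<close> too.\<close>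

lemma inverse_form_independent:
  assumes y: "chow_limit d (n - 1) y" and n: "n \<ge> 2"
    and K: "chain d (n - 1) K" "y (staircase (n - 1) K K) \<noteq> 0"
    and K': "chain d (n - 1) K'" "y (staircase (n - 1) K' K') \<noteq> 0"
  shows "hclass (\<lambda>a. peval (inverse_form d n K a) y) = hclass (\<lambda>a. peval (inverse_form d n K' a) y)"
proof (rule hclass_eq_if_proportional)
  fix a b
  let ?e = "1 + card (LM_index_sets n)"
  let ?F = "inverse_form d n K a * inverse_form d n K' b - inverse_form d n K b * inverse_form d n K' a"
  have "peval ?F y = 0"
  proof (rule chow_limitD[OF y])
    show "homogeneous (?e + ?e) ?F" by (intro homogeneous_diff homogeneous_mult homogeneous_inverse_form)
    fix x assume x: "generic d (n - 1) x"
    obtain C where C: "\<forall>a. peval (inverse_form d n K a) (chow_vec d (n - 1) x) = C * LM_vec d n x a"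
      using inverse_form_chow_vec[OF K(1) x n] by blast
    obtain C' where C': "\<forall>a. peval (inverse_form d n K' a) (chow_vec d (n - 1) x) = C' * LM_vec d n x a"
      using inverse_form_chow_vec[OF K'(1) x n] by blast
    show "peval ?F (chow_vec d (n - 1) x) = 0" by (simp only: peval_diff peval_mult spec[OF C] spec[OF C']) simp
  qed
  thus "peval (inverse_form d n K a) y * peval (inverse_form d n K' b) y =
      peval (inverse_form d n K b) y * peval (inverse_form d n K' a) y" by (simp add: peval_diff peval_mult)
qed (rule inverse_form_nonzero[where y = y, OF K(1) n K(2)], rule inverse_form_nonzero[where y = y, OF K'(1) n K'(2)])

lemma LM_over_in_T_LM:
  assumes x: "supported (LM_coords d n) x" "\<And>i. i \<in> {1..n-1} \<Longrightarrow> \<exists>k\<in>{1..d}. x (i, k) \<noteq> 0" and n: "n \<ge> 2"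
  shows "LM_over d n x \<in> T_LM d n" "LM_vec d n x \<noteq> (\<lambda>_. 0)"
    "LM_over d n x \<in> {blowup_point (LM_choices d n) (LM_gen n) x | x. x \<noteq> (\<lambda>_. 0) \<and> supported (LM_coords d n) x \<and>
        (\<exists>j\<in>LM_choices d n. peval (LM_gen n j) x \<noteq> 0)}"
proof -
  have "\<forall>I\<in>LM_index_sets n. \<exists>w. w \<in> (I - {n}) \<times> {1..d} \<and> x w \<noteq> 0"
  proof
    fix I assume I: "I \<in> LM_index_sets n"
    obtain i where i: "i \<in> I - {n}" using LM_index_setD(2)[OF I] by blast
    then obtain k where "k \<in> {1..d}" "x (i, k) \<noteq> 0" using x(2) LM_index_setD(1)[OF I] by blast
    thus "\<exists>w. w \<in> (I - {n}) \<times> {1..d} \<and> x w \<noteq> 0" using i by (intro exI[of _ "(i, k)"]) auto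
  qed
  from bchoice[OF this] obtain s where s: "\<forall>I\<in>LM_index_sets n. s I \<in> (I - {n}) \<times> {1..d} \<and> x (s I) \<noteq> 0" ..
  define s' where "s' = restrict s (LM_index_sets n)"
  have s': "s' \<in> LM_choices d n" using s unfolding LM_choices_def s'_def by auto
  have g: "peval (LM_gen n s') x \<noteq> 0" using s by (simp add: peval_LM_gen s'_def finite_LM_index_sets)
  have "1 \<in> {1..n-1}" using n by simp
  then obtain k where k: "x (1, k) \<noteq> 0" using x(2) by blast
  have "LM_vec d n x ((1, k), s') \<noteq> 0" using s' g k by (simp add: LM_vec_def)
  thus nz: "LM_vec d n x \<noteq> (\<lambda>_. 0)" by (intro notI) simp
  have "x \<noteq> (\<lambda>_. 0)" using k by auto
  thus mem: "LM_over d n x \<in> {blowup_point (LM_choices d n) (LM_gen n) x | x. x \<noteq> (\<lambda>_. 0) \<and> supported (LM_coords d n) x \<and>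
        (\<exists>j\<in>LM_choices d n. peval (LM_gen n j) x \<noteq> 0)}"
    using x(1) s' g unfolding LM_over_def by blast
  have "LM_over d n x \<in> topspace zariski"
    unfolding topspace_zariski LM_over_eq by (rule hclass_in_pspace[OF nz])
  thus "LM_over d n x \<in> T_LM d n"
    using mem unfolding T_LM_def blowup_def in_closure_of by blast
qed

lemma generic_coords:
  assumes "generic d (n - 1) x" "d \<ge> 1"
  shows "supported (LM_coords d n) x" "\<And>i. i \<in> {1..n-1} \<Longrightarrow> \<exists>k\<in>{1..d}. x (i, k) \<noteq> 0"
  using assms by (auto simp: generic_def LM_coords_def intro!: bexI[of _ 1])

text \<open>A homogeneous polynomial that does not vanish at the image pulls back to one that does
  not vanish at \<open>y\<close>. By the definition of a limit it is nonzero at some generic vector,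
  which the chart sends to a point over the dense torus of configurations.\<close>

lemma inverse_form_in_T_LM:
  assumes y: "chow_limit d (n - 1) y" and n: "n \<ge> 2" and d: "d \<ge> 1"
    and K: "chain d (n - 1) K" "y (staircase (n - 1) K K) \<noteq> 0"
  shows "hclass (\<lambda>a. peval (inverse_form d n K a) y) \<in> T_LM d n"
proof -
  let ?p = "hclass (\<lambda>a. peval (inverse_form d n K a) y)"
  let ?S = "{blowup_point (LM_choices d n) (LM_gen n) x | x. x \<noteq> (\<lambda>_. 0) \<and> supported (LM_coords d n) x \<and>
        (\<exists>j\<in>LM_choices d n. peval (LM_gen n j) x \<noteq> 0)}"
  have "\<exists>q\<in>?S. q \<in> U" if U: "?p \<in> U" "openin zariski U" for U
  proof -
    from zariski_open_basis[OF U(2,1)] obtain e F where F: "homogeneous e F" "\<not> pvanish F ?p"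
      "{q \<in> pspace UNIV. \<not> pvanish F q} \<subseteq> U" .
    have hom: "homogeneous ((1 + card (LM_index_sets n)) * e) (psubst F (inverse_form d n K))"
      by (rule homogeneous_psubst[OF F(1) homogeneous_inverse_form])
    have "peval (psubst F (inverse_form d n K)) y \<noteq> 0" using F(2) pvanish_hclass[OF F(1)] by (simp add: peval_psubst)
    hence "\<exists>x. generic d (n - 1) x \<and> peval (psubst F (inverse_form d n K)) (chow_vec d (n - 1) x) \<noteq> 0"
    proof (rule contrapos_np)
      assume none: "\<not> (\<exists>x. generic d (n - 1) x \<and> peval (psubst F (inverse_form d n K)) (chow_vec d (n - 1) x) \<noteq> 0)"
      show "peval (psubst F (inverse_form d n K)) y = 0"
        by (rule chow_limitD[OF y hom]) (use none in simp)
    qed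
    then obtain x where x: "generic d (n - 1) x" "peval (psubst F (inverse_form d n K)) (chow_vec d (n - 1) x) \<noteq> 0" by auto
    obtain C where C: "C \<noteq> 0" "\<forall>a. peval (inverse_form d n K a) (chow_vec d (n - 1) x) = C * LM_vec d n x a"
      using inverse_form_chow_vec[OF K(1) x(1) n] by (elim exE conjE) (rule that)
    have "peval F (\<lambda>a. C * LM_vec d n x a) \<noteq> 0" using x(2) unfolding peval_psubst by (simp only: spec[OF C(2)]) simp
    hence "peval F (LM_vec d n x) \<noteq> 0" using peval_scale[OF F(1), of C "LM_vec d n x"] by (intro notI) simp
    hence "\<not> pvanish F (LM_over d n x)" using pvanish_hclass[OF F(1)] by (simp add: LM_over_eq)
    moreover note L = LM_over_in_T_LM[OF generic_coords[OF x(1) d] n]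
    moreover have "LM_over d n x \<in> pspace UNIV" unfolding LM_over_eq by (rule hclass_in_pspace[OF L(2)])
    ultimately have "LM_over d n x \<in> U" using F(3) by auto
    thus ?thesis by (rule bexI[OF _ L(3)])
  qed
  moreover have "?p \<in> pspace UNIV"
    by (rule hclass_in_pspace[OF inverse_form_nonzero[where y = y, OF K(1) n K(2)]])
  ultimately show ?thesis unfolding T_LM_def blowup_def by (intro in_zariski_closureI)
qed

text \<open>Representative and chart are picked by choice; independence of both is what makes the
  map locally polynomial.\<close>

definition chow_inverse :: "nat \<Rightarrow> nat \<Rightarrow> chow_pt \<Rightarrow> LM_point" where
  "chow_inverse d n q = (let y = SOME y. y \<in> q;
      K = SOME K. chain d (n - 1) K \<and> y (staircase (n - 1) K K) \<noteq> 0
    in hclass (\<lambda>a. peval (inverse_form d n K a) y))"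

text \<open>Another representative changes the form values by a common power of the scalar, another
  chain does not change the point.\<close>

lemma chow_inverse_eq:
  assumes y: "chow_limit d (n - 1) y" and n: "n \<ge> 2" and K: "chain d (n - 1) K" "y (staircase (n - 1) K K) \<noteq> 0"
  shows "chow_inverse d n (hclass y) = hclass (\<lambda>a. peval (inverse_form d n K a) y)"
proof -
  define y' where "y' = (SOME y'. y' \<in> hclass y)"
  have "y' \<in> hclass y" unfolding y'_def by (rule someI[of "\<lambda>y'. y' \<in> hclass y" y]) (rule self_in_hclass)
  then obtain c where c: "y' = (\<lambda>M. c * y M)" "c \<noteq> 0" by (rule hclassE)
  define K' where "K' = (SOME K. chain d (n - 1) K \<and> y' (staircase (n - 1) K K) \<noteq> 0)"
  have ex: "\<exists>K. chain d (n - 1) K \<and> y' (staircase (n - 1) K K) \<noteq> 0" using K c by auto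
  have K': "chain d (n - 1) K' \<and> y' (staircase (n - 1) K' K') \<noteq> 0" unfolding K'_def by (rule someI_ex[OF ex])
  have "chow_inverse d n (hclass y) = hclass (\<lambda>a. peval (inverse_form d n K' a) y')"
    unfolding chow_inverse_def Let_def y'_def[symmetric] K'_def[symmetric] by (rule refl)
  also have "\<dots> = hclass (\<lambda>a. c ^ (1 + card (LM_index_sets n)) * peval (inverse_form d n K' a) y)"
    unfolding c(1) by (simp only: peval_scale[OF homogeneous_inverse_form])
  also have "\<dots> = hclass (\<lambda>a. peval (inverse_form d n K' a) y)" by (rule hclass_scale) (use c(2) in simp)
  also have "\<dots> = hclass (\<lambda>a. peval (inverse_form d n K a) y)"
    by (rule inverse_form_independent[OF y n _ _ K]) (use K' c in auto)
  finally show ?thesis .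
qed

lemma chow_inverse_morphism:
  assumes n: "n \<ge> 2" and d: "d \<ge> 1" and Y: "Y \<subseteq> pspace UNIV" and lim: "\<And>q y. q \<in> Y \<Longrightarrow> y \<in> q \<Longrightarrow> chow_limit d (n - 1) y"
  shows "morphism Y (T_LM d n) (chow_inverse d n)"
proof (rule morphism_if_locally_polynomial[OF Y])
  have m: "n - 1 \<ge> 1" using n by simp
  show "T_LM d n \<subseteq> pspace UNIV"
    unfolding T_LM_def blowup_def using closure_of_subset_topspace[of zariski] by (simp add: topspace_zariski)
  fix q assume q: "q \<in> Y"
  obtain y where y: "y \<in> q" using q Y pspace_nonempty by blast
  have qy: "q = hclass y" using pspace_elem_hclass(1)[of q y] q Y y by blast
  obtain K where K: "chain d (n - 1) K" "y (staircase (n - 1) K K) \<noteq> 0" by (rule ex_alive_chain[OF lim[OF q y] m])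
  show "chow_inverse d n q \<in> T_LM d n"
    unfolding qy chow_inverse_eq[OF lim[OF q y] n K] by (rule inverse_form_in_T_LM[OF lim[OF q y] n d K])
  \<comment> \<open>The chain chosen at \<open>q\<close> serves as a chart wherever its coordinate
    stays nonzero.\<close>
  define W where "W = {p \<in> pspace UNIV. \<not> pvanish (Var (staircase (n - 1) K K)) p}"
  have "openin zariski W" unfolding W_def by (rule openin_nonvanishing[OF homogeneous_Var])
  moreover have "q \<in> W" using q Y pvanish_iff[OF homogeneous_Var _ y] K(2) by (auto simp: W_def)
  moreover have "\<forall>p\<in>W \<inter> Y. \<forall>z\<in>p. chow_inverse d n p = hclass (\<lambda>a. peval (inverse_form d n K a) z)"
  proof (intro ballI)
    fix p z assume p: "p \<in> W \<inter> Y" and z: "z \<in> p"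
    have pY: "p \<in> Y" "p \<in> pspace UNIV" "\<not> pvanish (Var (staircase (n - 1) K K)) p" using p by (auto simp: W_def)
    have "z (staircase (n - 1) K K) \<noteq> 0" using pvanish_iff[OF homogeneous_Var pY(2) z, of "staircase (n - 1) K K"] pY(3) by simp
    thus "chow_inverse d n p = hclass (\<lambda>a. peval (inverse_form d n K a) z)"
      unfolding pspace_elem_hclass(1)[OF pY(2) z] by (rule chow_inverse_eq[OF lim[OF pY(1) z] n K(1)])
  qed
  ultimately show "\<exists>W e G. openin zariski W \<and> q \<in> W \<and> (\<forall>a. homogeneous e (G a)) \<and>
       (\<forall>q\<in>W \<inter> Y. \<forall>y\<in>q. chow_inverse d n q = hclass (\<lambda>a. peval (G a) y))"
    using homogeneous_inverse_form
    by (intro exI[of _ W] exI[of _ "1 + card (LM_index_sets n)"] exI[of _ "inverse_form d n K"] conjI allI)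
qed

lemma chow_limit_generic:
  assumes "generic d m x" "d \<ge> 1" "m \<ge> 1"
  shows "chow_limit d m (chow_vec d m x)"
proof -
  interpret graded_forms "multi_idx d m" "mdeg m" "mval m x" m "zero_idx m"
    by (rule graded_forms_mval) (use assms in \<open>auto simp: generic_def\<close>)
  have "chow_vec d m x \<noteq> (\<lambda>_. 0)"
  proof
    assume "chow_vec d m x = (\<lambda>_. 0)"
    hence "R = 0" unfolding lookup_res_form_mval[symmetric] by (intro poly_mapping_eqI) simp
    thus False using R_nonzero by simp
  qed
  thus ?thesis using assms(1) unfolding chow_limit_def by blast
qed

lemma chow_inverse_generic:
  assumes x: "generic d (n - 1) x" and d: "d \<ge> 1" and n: "n \<ge> 2"
  shows "chow_inverse d n (hclass (chow_vec d (n - 1) x)) = LM_over d n x"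
proof -
  have m: "n - 1 \<ge> 1" using n by simp
  note lim = chow_limit_generic[OF x d m]
  obtain K where K: "chain d (n - 1) K" "chow_vec d (n - 1) x (staircase (n - 1) K K) \<noteq> 0" by (rule ex_alive_chain[OF lim m])
  obtain C where C: "C \<noteq> 0" "\<forall>a. peval (inverse_form d n K a) (chow_vec d (n - 1) x) = C * LM_vec d n x a"
    using inverse_form_chow_vec[OF K(1) x n] by blast
  have "chow_inverse d n (hclass (chow_vec d (n - 1) x)) = hclass (\<lambda>a. C * LM_vec d n x a)"
    unfolding chow_inverse_eq[OF lim n K] by (simp only: spec[OF C(2)])
  also have "\<dots> = LM_over d n x" unfolding LM_over_eq by (rule hclass_scale[OF C(1)])
  finally show ?thesis .
qed

section \<open>The group fixing the hyperplane at infinity\<close>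

lemma supported_elem:
  assumes "p \<in> pspace A" "x \<in> p"
  shows "supported A x" "x \<noteq> (\<lambda>_. 0)" "p = hclass x"
proof -
  obtain y where y: "p = hclass y" "supported A y" using assms(1) by (auto simp: pspace_def)
  obtain s where s: "x = (\<lambda>i. s * y i)" using assms(2) unfolding y(1) by (rule hclassE)
  show "supported A x" using y(2) by (simp add: s supported_def)
  have "p \<in> pspace UNIV" using assms(1) pspace_mono[of A UNIV] by blast
  from pspace_elem_hclass[OF this assms(2)] show "x \<noteq> (\<lambda>_. 0)" "p = hclass x" by auto
qed

lemma hclass_in_pspace_supported: "supported A x \<Longrightarrow> x \<noteq> (\<lambda>_. 0) \<Longrightarrow> hclass x \<in> pspace A"
  by (auto simp: pspace_def)

definition act_vec :: "nat \<Rightarrow> complex mat \<Rightarrow> (nat \<Rightarrow> complex) \<Rightarrow> nat \<Rightarrow> complex" where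
  "act_vec d g x = (\<lambda>i. if i \<le> d then \<Sum>j\<in>{0..d}. g $$ (i, j) * x j else 0)"

lemma mat_act_eq: "mat_act d g p = act_vec d g ` p"
  by (simp add: mat_act_def act_vec_def)

lemma act_vec_scale: "act_vec d g (\<lambda>i. c * x i) = (\<lambda>i. c * act_vec d g x i)"
  by (rule ext) (simp add: act_vec_def sum_distrib_left mult.left_commute)

lemma act_vec_add: "act_vec d g (\<lambda>i. x i + y i) = (\<lambda>i. act_vec d g x i + act_vec d g y i)"
  by (rule ext) (simp add: act_vec_def distrib_left sum.distrib)

lemma mat_act_hclass: "mat_act d g (hclass x) = hclass (act_vec d g x)"
  unfolding mat_act_eq
proof (intro equalityI subsetI)
  fix y assume "y \<in> act_vec d g ` hclass x"
  then obtain z where z: "y = act_vec d g z" "z \<in> hclass x" by blast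
  from z(2) obtain c where "z = (\<lambda>i. c * x i)" "c \<noteq> 0" by (rule hclassE)
  thus "y \<in> hclass (act_vec d g x)" unfolding z(1) by (auto simp: act_vec_scale hclass_def)
next
  fix y assume "y \<in> hclass (act_vec d g x)"
  then obtain c where c: "y = (\<lambda>i. c * act_vec d g x i)" "c \<noteq> 0" by (rule hclassE)
  hence "y = act_vec d g (\<lambda>i. c * x i)" by (simp add: act_vec_scale)
  moreover have "(\<lambda>i. c * x i) \<in> hclass x" using c(2) by (auto simp: hclass_def)
  ultimately show "y \<in> act_vec d g ` hclass x" by blast
qed

lemma act_vec_mult:
  assumes "g \<in> carrier_mat (d + 1) (d + 1)" "h \<in> carrier_mat (d + 1) (d + 1)"
  shows "act_vec d (h * g) x = act_vec d h (act_vec d g x)"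
proof
  fix i
  show "act_vec d (h * g) x i = act_vec d h (act_vec d g x) i"
  proof (cases "i \<le> d")
    case True
    have hg: "(h * g) $$ (i, j) = (\<Sum>k\<in>{0..d}. h $$ (i, k) * g $$ (k, j))" if "j \<le> d" for j
      using assms True that by (auto simp: scalar_prod_def atLeastLessThanSuc_atLeastAtMost intro!: sum.cong)
    have "(\<Sum>j\<in>{0..d}. (h * g) $$ (i, j) * x j) = (\<Sum>j\<in>{0..d}. \<Sum>k\<in>{0..d}. h $$ (i, k) * (g $$ (k, j) * x j))"
      by (rule sum.cong) (simp_all add: hg sum_distrib_right mult.assoc)
    also have "\<dots> = (\<Sum>k\<in>{0..d}. h $$ (i, k) * (\<Sum>j\<in>{0..d}. g $$ (k, j) * x j))"
      by (subst sum.swap) (simp add: sum_distrib_left)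
    also have "\<dots> = (\<Sum>k\<in>{0..d}. h $$ (i, k) * act_vec d g x k)"
      by (rule sum.cong) (simp_all add: act_vec_def)
    finally show ?thesis using True by (simp add: act_vec_def[of d "h * g"] act_vec_def[of d h])
  qed (simp add: act_vec_def)
qed

lemma mat_act_mult:
  assumes "g \<in> carrier_mat (d + 1) (d + 1)" "h \<in> carrier_mat (d + 1) (d + 1)"
  shows "mat_act d (h * g) p = mat_act d h (mat_act d g p)"
  unfolding mat_act_eq image_image by (simp add: act_vec_mult[OF assms])

lemma act_vec_one: "supported {0..d} x \<Longrightarrow> act_vec d (1\<^sub>m (d + 1)) x = x"
proof (rule ext)
  fix i assume x: "supported {0..d} x"
  show "act_vec d (1\<^sub>m (d + 1)) x i = x i"
  proof (cases "i \<le> d")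
    case True
    have "(\<Sum>j\<in>{0..d}. 1\<^sub>m (d + 1) $$ (i, j) * x j) = (\<Sum>j\<in>{0..d}. if j = i then x i else 0)"
      by (rule sum.cong) (use True in auto)
    thus ?thesis using True by (simp add: act_vec_def)
  qed (use x in \<open>simp add: act_vec_def supported_def\<close>)
qed

lemma mat_act_one: "p \<in> pspace {0..d} \<Longrightarrow> mat_act d (1\<^sub>m (d + 1)) p = p"
proof -
  assume p: "p \<in> pspace {0..d}"
  then obtain x where x: "p = hclass x" "supported {0..d} x" by (auto simp: pspace_def)
  show ?thesis unfolding x(1) mat_act_hclass act_vec_one[OF x(2)] by (rule refl)
qed

lemma G_groupD:
  assumes "g \<in> G_group d"
  shows "g \<in> carrier_mat (d + 1) (d + 1)" "det g = 1" "\<And>p. p \<in> hyp_H d \<Longrightarrow> mat_act d g p = p"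
  using assms by (auto simp: G_group_def)

lemma hyp_H_pspace: "p \<in> hyp_H d \<Longrightarrow> p \<in> pspace {0..d}"
  by (simp add: hyp_H_def)

lemma G_group_one: "1\<^sub>m (d + 1) \<in> G_group d"
  unfolding G_group_def mem_Collect_eq
  by (intro conjI ballI mat_act_one[OF hyp_H_pspace]) (simp_all add: det_one)

lemma G_group_mult:
  assumes g: "g \<in> G_group d" and h: "h \<in> G_group d"
  shows "h * g \<in> G_group d"
  using G_groupD[OF g] G_groupD[OF h]
  by (simp add: G_group_def mat_act_mult det_mult[of h "d + 1" g])

lemma G_group_inverse:
  assumes g: "g \<in> G_group d"
  obtains h where "h \<in> G_group d" "h * g = 1\<^sub>m (d + 1)"
proof -
  note G = G_groupD[OF g]
  have "g \<in> Units (ring_mat TYPE(complex) (d + 1) ())"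
    by (rule det_non_zero_imp_unit[OF G(1)]) (simp add: G(2))
  then obtain h where h: "h \<in> carrier_mat (d + 1) (d + 1)" "h * g = 1\<^sub>m (d + 1)"
    by (auto simp: Units_def ring_mat_def)
  have "det h * det g = 1" using det_mult[OF h(1) G(1)] h(2) by (simp add: det_one)
  hence "det h = 1" using G(2) by simp
  moreover have "mat_act d h p = p" if p: "p \<in> hyp_H d" for p
    using mat_act_mult[OF G(1) h(1), of p] G(3)[OF p] mat_act_one[OF hyp_H_pspace[OF p]] h(2) by simp
  ultimately have "h \<in> G_group d" using h(1) by (simp add: G_group_def)
  thus ?thesis using h(2) by (rule that)
qed

lemma G_orbit_act:
  assumes g: "g \<in> G_group d" and q: "\<And>i. i \<in> {1..n} \<Longrightarrow> q i \<in> pspace {0..d}"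
  shows "G_orbit d n (\<lambda>i\<in>{1..n}. mat_act d g (q i)) = G_orbit d n q"
proof (intro equalityI subsetI)
  fix p assume "p \<in> G_orbit d n (\<lambda>i\<in>{1..n}. mat_act d g (q i))"
  then obtain h where h: "h \<in> G_group d" "p = (\<lambda>i\<in>{1..n}. mat_act d h ((\<lambda>i\<in>{1..n}. mat_act d g (q i)) i))"
    unfolding G_orbit_def by blast
  have "p = (\<lambda>i\<in>{1..n}. mat_act d (h * g) (q i))"
    unfolding h(2) by (rule restrict_ext) (simp add: mat_act_mult[OF G_groupD(1)[OF g] G_groupD(1)[OF h(1)]])
  thus "p \<in> G_orbit d n q" unfolding G_orbit_def using G_group_mult[OF g h(1)] by blast
next
  fix p assume "p \<in> G_orbit d n q"
  then obtain h where h: "h \<in> G_group d" "p = (\<lambda>i\<in>{1..n}. mat_act d h (q i))"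
    unfolding G_orbit_def by blast
  obtain g' where g': "g' \<in> G_group d" "g' * g = 1\<^sub>m (d + 1)" using g by (rule G_group_inverse)
  have "p = (\<lambda>i\<in>{1..n}. mat_act d (h * g') ((\<lambda>i\<in>{1..n}. mat_act d g (q i)) i))"
    unfolding h(2)
  proof (rule restrict_ext)
    fix i assume i: "i \<in> {1..n}"
    have "mat_act d g' (mat_act d g (q i)) = q i"
      using mat_act_mult[OF G_groupD(1)[OF g] G_groupD(1)[OF g'(1)], of "q i"] mat_act_one[OF q[OF i]] g'(2) by simp
    thus "mat_act d h (q i) = mat_act d (h * g') ((\<lambda>i\<in>{1..n}. mat_act d g (q i)) i)"
      using i by (simp add: mat_act_mult[OF G_groupD(1)[OF g'(1)] G_groupD(1)[OF h(1)]])
  qed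
  thus "p \<in> G_orbit d n (\<lambda>i\<in>{1..n}. mat_act d g (q i))" unfolding G_orbit_def using G_group_mult[OF g'(1) h(1)] by blast
qed

lemma self_in_G_orbit:
  assumes "q \<in> extensional {1..n}" "\<And>i. i \<in> {1..n} \<Longrightarrow> q i \<in> pspace {0..d}"
  shows "q \<in> G_orbit d n q"
proof -
  have "q = (\<lambda>i\<in>{1..n}. mat_act d (1\<^sub>m (d + 1)) (q i))"
    by (rule extensionalityI[OF assms(1) restrict_extensional]) (use mat_act_one[OF assms(2)] in simp)
  thus ?thesis unfolding G_orbit_def using G_group_one by blast
qed

definition unit_fn :: "nat \<Rightarrow> nat \<Rightarrow> complex" where
  "unit_fn k = (\<lambda>i. if i = k then 1 else 0)"

lemma act_vec_unit: "k \<le> d \<Longrightarrow> act_vec d g (unit_fn k) = (\<lambda>i. if i \<le> d then g $$ (i, k) else 0)"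
  by (rule ext) (simp add: act_vec_def unit_fn_def if_distrib[of "\<lambda>x. _ * x"] cong: if_cong)

lemma G_group_fixes:
  assumes g: "g \<in> G_group d" and w: "supported {0..d} w" "w 0 = 0" "w \<noteq> (\<lambda>_. 0)"
  obtains c where "c \<noteq> 0" "act_vec d g w = (\<lambda>i. c * w i)"
proof -
  have w0: "\<forall>x\<in>hclass w. x 0 = 0"
  proof
    fix x assume "x \<in> hclass w"
    then obtain s where "x = (\<lambda>i. s * w i)" by (rule hclassE)
    thus "x 0 = 0" using w(2) by simp
  qed
  have "hclass w \<in> hyp_H d"
    unfolding hyp_H_def using hclass_in_pspace_supported[OF w(1,3)] w0 by simp
  hence "hclass (act_vec d g w) = hclass w" using G_groupD(3)[OF g] mat_act_hclass by metis
  hence "act_vec d g w \<in> hclass w" using self_in_hclass by metis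
  then obtain c where "act_vec d g w = (\<lambda>i. c * w i)" "c \<noteq> 0" by (rule hclassE)
  thus ?thesis using that by blast
qed

text \<open>An element fixing all points at infinity acts there by a scalar: compare its eigenvalues on
  \<open>e\<^sub>1\<close>, \<open>e\<^sub>k\<close> and \<open>e\<^sub>1 + e\<^sub>k\<close>.\<close>

lemma G_group_scalar_at_infinity:
  assumes g: "g \<in> G_group d" and d: "d \<ge> 1"
  obtains c where "c \<noteq> 0" "\<forall>i\<le>d. \<forall>k\<in>{1..d}. g $$ (i, k) = (if i = k then c else 0)"
proof -
  have ev: "\<exists>c. c \<noteq> 0 \<and> (\<forall>i\<le>d. g $$ (i, k) = (if i = k then c else 0))" if k: "1 \<le> k" "k \<le> d" for k
  proof -
    have u: "supported {0..d} (unit_fn k)" "unit_fn k 0 = 0" "unit_fn k \<noteq> (\<lambda>_. 0)"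
      using k by (auto simp: supported_def unit_fn_def fun_eq_iff)
    obtain c where c: "c \<noteq> 0" "act_vec d g (unit_fn k) = (\<lambda>i. c * unit_fn k i)" using G_group_fixes[OF g u] .
    have "g $$ (i, k) = (if i = k then c else 0)" if "i \<le> d" for i
      using fun_cong[OF c(2), of i] that unfolding act_vec_unit[OF k(2)] by (simp add: unit_fn_def split: if_splits)
    thus ?thesis using c(1) by blast
  qed
  obtain c where c: "c \<noteq> 0" "\<forall>i\<le>d. g $$ (i, 1) = (if i = 1 then c else 0)" using ev[OF order_refl d] by blast
  have "g $$ (i, k) = (if i = k then c else 0)" if k: "1 \<le> k" "k \<le> d" and i: "i \<le> d" for i k
  proof (cases "k = 1")
    case False
    obtain c' where c': "\<forall>i\<le>d. g $$ (i, k) = (if i = k then c' else 0)" using ev[OF k] by blast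
    define w where "w = (\<lambda>i. unit_fn 1 i + unit_fn k i)"
    have w: "supported {0..d} w" "w 0 = 0" using k by (auto simp: supported_def unit_fn_def w_def)
    have w1: "w 1 = 1" "w k = 1" using False by (auto simp: w_def unit_fn_def)
    have "w \<noteq> (\<lambda>_. 0)" using w1(1) by (intro notI) simp
    then obtain s where s: "act_vec d g w = (\<lambda>i. s * w i)" using G_group_fixes[OF g w] by blast
    have act: "act_vec d g w i = g $$ (i, 1) + g $$ (i, k)" if "i \<le> d" for i
      unfolding w_def act_vec_add act_vec_unit[OF d] act_vec_unit[OF k(2)] using that by simp
    have "s = c" using fun_cong[OF s, of 1] act[OF d] c(2) c' w1 d False by simp
    moreover have "s = c'" using fun_cong[OF s, of k] act[OF k(2)] c(2) c' w1 k False by simp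
    ultimately show ?thesis using c' i by simp
  qed (use c i in simp)
  hence "\<forall>i\<le>d. \<forall>k\<in>{1..d}. g $$ (i, k) = (if i = k then c else 0)" by simp
  with c(1) show ?thesis by (rule that)
qed

section \<open>Generic orbit closures\<close>

text \<open>A homogeneous parameter for the torus orbit: \<open>s = 0\<close> and
  \<open>t = 0\<close> give its two end points, which belong to the closure only.\<close>

definition line_vec :: "nat \<Rightarrow> (nat \<times> nat \<Rightarrow> complex) \<Rightarrow> complex \<Rightarrow> complex \<Rightarrow> nat \<Rightarrow> nat \<Rightarrow> complex" where
  "line_vec d x s t i = (\<lambda>k. if k = 0 then s else if k \<le> d then t * x (i, k) else 0)"

lemma e_zero_eq: "e_zero = hclass (unit_fn 0)"
  by (simp add: e_zero_def unit_fn_def)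

lemma configuration_eq:
  "configuration d n x = (\<lambda>i\<in>{1..n}. if i = n then e_zero else hclass (line_vec d x 1 1 i))"
  by (simp add: configuration_def line_vec_def cong: if_cong)

lemma line_vec_supported: "supported {0..d} (line_vec d x s t i)"
  by (simp add: supported_def line_vec_def)

lemma line_pt_in_pspace: "s \<noteq> 0 \<Longrightarrow> hclass (line_vec d x s t i) \<in> pspace {0..d}"
  by (rule hclass_in_pspace_supported[OF line_vec_supported]) (auto simp: line_vec_def fun_eq_iff)

lemma e_zero_in_pspace: "e_zero \<in> pspace {0..d}"
  unfolding e_zero_eq by (rule hclass_in_pspace_supported) (auto simp: supported_def unit_fn_def fun_eq_iff)

lemma configuration_in_pspace: "i \<in> {1..n} \<Longrightarrow> configuration d n x i \<in> pspace {0..d}"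
  by (simp add: configuration_eq e_zero_in_pspace line_pt_in_pspace)

definition dilation :: "nat \<Rightarrow> complex mat \<Rightarrow> complex \<Rightarrow> complex \<Rightarrow> bool" where
  "dilation d g a c \<longleftrightarrow> (\<forall>i\<le>d. \<forall>j\<le>d. g $$ (i, j) = (if i = j then (if j = 0 then a else c) else 0))"

lemma act_vec_diag:
  assumes "dilation d g a c"
  shows "act_vec d g v = (\<lambda>i. if i \<le> d then (if i = 0 then a else c) * v i else 0)"
proof
  fix i
  show "act_vec d g v i = (if i \<le> d then (if i = 0 then a else c) * v i else 0)"
  proof (cases "i \<le> d")
    case True
    have "(\<Sum>j\<in>{0..d}. g $$ (i, j) * v j) = (\<Sum>j\<in>{0..d}. if j = i then (if i = 0 then a else c) * v i else 0)"
      by (rule sum.cong) (use assms True in \<open>auto simp: dilation_def\<close>)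
    thus ?thesis using True by (simp add: act_vec_def)
  qed (simp add: act_vec_def)
qed

lemma act_vec_diag_line:
  assumes "dilation d g a c" "a \<noteq> 0"
  shows "hclass (act_vec d g (line_vec d x 1 1 i)) = hclass (line_vec d x 1 (c / a) i)"
proof -
  have "act_vec d g (line_vec d x 1 1 i) = (\<lambda>k. a * line_vec d x 1 (c / a) i k)"
    unfolding act_vec_diag[OF assms(1)] using assms(2) by (auto simp: line_vec_def fun_eq_iff)
  thus ?thesis using hclass_scale[OF assms(2)] by simp
qed

text \<open>Determinant one forces \<open>a = 1 / c ^ d\<close>, so the ratio \<open>c / a\<close>
  equals \<open>c ^ Suc d\<close>; a root of this order of \<open>t\<close> has to be
  extracted.\<close>

lemma ex_diag_in_G_group:
  assumes "t \<noteq> 0"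
  obtains g a c where "g \<in> G_group d" "a \<noteq> 0" "c / a = t"
    "dilation d g a c"
proof -
  have "degree (monom 1 (Suc d) + [:- t:]) = Suc d" by (simp add: degree_add_eq_left degree_monom_eq)
  hence "\<not> constant (poly (monom 1 (Suc d) + [:- t:]))" by (simp add: constant_degree)
  then obtain c where "poly (monom 1 (Suc d) + [:- t:]) c = 0" using fundamental_theorem_of_algebra[of "monom 1 (Suc d) + [:- t:]"] by auto
  hence c: "c ^ Suc d = t" by (simp add: poly_monom)
  hence c0: "c \<noteq> 0" using assms by auto
  define a where "a = 1 / c ^ d"
  have a0: "a \<noteq> 0" using c0 by (simp add: a_def)
  have ca: "c / a = t" using c by (simp add: a_def mult.commute)
  define g where "g = mat (d + 1) (d + 1) (\<lambda>(i, j). if i = j then (if j = 0 then a else c) else 0)"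
  have g: "dilation d g a c" by (simp add: dilation_def g_def)
  have gc: "g \<in> carrier_mat (d + 1) (d + 1)" by (simp add: g_def)
  have "det g = prod_list (diag_mat g)"
    by (rule det_lower_triangular[OF _ gc]) (auto simp: g_def)
  also have "\<dots> = (\<Prod>i\<in>{0..<Suc d}. if i = 0 then a else c)"
    unfolding prod_list_diag_prod by (rule prod.cong) (auto simp: g_def)
  also have "\<dots> = a * (\<Prod>i\<in>{0..<d}. c)"
    unfolding prod.atLeast0_lessThan_Suc_shift by simp
  also have "\<dots> = 1" using c0 by (simp add: a_def)
  finally have det: "det g = 1" .
  have "mat_act d g p = p" if p: "p \<in> hyp_H d" for p
  proof -
    have ps: "p \<in> pspace {0..d}" by (rule hyp_H_pspace[OF p])
    then obtain y where y: "p = hclass y" "supported {0..d} y" by (auto simp: pspace_def)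
    have "y 0 = 0" using p self_in_hclass[of y] by (auto simp: hyp_H_def y(1))
    hence "act_vec d g y = (\<lambda>i. c * y i)"
      unfolding act_vec_diag[OF g] using y(2) by (auto simp: supported_def fun_eq_iff)
    thus ?thesis unfolding y(1) mat_act_hclass using hclass_scale[OF c0] by simp
  qed
  hence "g \<in> G_group d" using gc det by (simp add: G_group_def)
  thus ?thesis using a0 ca g by (rule that)
qed

lemma diag_if_fixes_e_zero:
  assumes g: "g \<in> G_group d" and d: "d \<ge> 1" and e: "mat_act d g e_zero = e_zero"
  obtains a c where "a \<noteq> 0" "c \<noteq> 0"
    "dilation d g a c"
proof -
  obtain c where c0: "c \<noteq> 0" and c: "\<forall>i\<le>d. \<forall>k\<in>{1..d}. g $$ (i, k) = (if i = k then c else 0)"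
    by (rule G_group_scalar_at_infinity[OF g d])
  have "act_vec d g (unit_fn 0) \<in> hclass (unit_fn 0)"
    using e self_in_hclass[of "act_vec d g (unit_fn 0)"] by (simp add: e_zero_eq mat_act_hclass)
  then obtain a where a: "act_vec d g (unit_fn 0) = (\<lambda>i. a * unit_fn 0 i)" "a \<noteq> 0" by (rule hclassE)
  have "g $$ (i, 0) = (if i = 0 then a else 0)" if "i \<le> d" for i
    using fun_cong[OF a(1), of i] that by (simp add: act_vec_unit) (simp add: unit_fn_def)
  hence "g $$ (i, j) = (if i = j then (if j = 0 then a else c) else 0)" if "i \<le> d" "j \<le> d" for i j
    using that c by (cases "j = 0") auto
  hence "dilation d g a c" by (simp add: dilation_def)
  with a(2) c0 show ?thesis by (rule that)
qed

definition line_tuple :: "nat \<Rightarrow> nat \<Rightarrow> (nat \<times> nat \<Rightarrow> complex) \<Rightarrow> complex \<Rightarrow> complex \<Rightarrow> ptuple" where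
  "line_tuple d m x s t = (\<lambda>i\<in>{1..m}. hclass (line_vec d x s t i))"

lemma line_tuple_upd:
  "n \<ge> 2 \<Longrightarrow> (line_tuple d (n - 1) x 1 t)(n := e_zero) = (\<lambda>i\<in>{1..n}. if i = n then e_zero else hclass (line_vec d x 1 t i))"
  by (rule ext) (auto simp: line_tuple_def)

lemma line_tuple_in_V_space:
  assumes x: "generic d (n - 1) x" and d: "d \<ge> 1" and t: "t \<noteq> 0"
  shows "line_tuple d (n - 1) x 1 t \<in> V_space d n"
proof -
  let ?p = "line_tuple d (n - 1) x 1 t"
  have "?p \<in> prod_space d (n - 1)"
    by (auto simp: prod_space_def line_tuple_def intro: line_pt_in_pspace)
  moreover have "inj_on ?p {1..n-1}"
  proof (rule inj_onI)
    fix i j assume ij: "i \<in> {1..n-1}" "j \<in> {1..n-1}" "?p i = ?p j"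
    hence "line_vec d x 1 t i \<in> hclass (line_vec d x 1 t j)"
      using self_in_hclass[of "line_vec d x 1 t i"] by (simp add: line_tuple_def)
    then obtain s where s: "line_vec d x 1 t i = (\<lambda>k. s * line_vec d x 1 t j k)" by (rule hclassE)
    have "s = 1" using fun_cong[OF s, of 0] by (simp add: line_vec_def)
    hence "x (i, 1) = x (j, 1)" using fun_cong[OF s, of 1] d t by (simp add: line_vec_def)
    thus "i = j" using x ij by (auto simp: generic_def inj_on_def)
  qed
  moreover have "?p i \<notin> hyp_H d \<and> ?p i \<noteq> e_zero" if i: "i \<in> {1..n-1}" for i
  proof
    show "?p i \<notin> hyp_H d"
    proof
      assume "?p i \<in> hyp_H d"
      hence "line_vec d x 1 t i 0 = 0"
        using i self_in_hclass[of "line_vec d x 1 t i"] by (auto simp: hyp_H_def line_tuple_def)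
      thus False by (simp add: line_vec_def)
    qed
    show "?p i \<noteq> e_zero"
    proof
      assume "?p i = e_zero"
      hence "line_vec d x 1 t i \<in> hclass (unit_fn 0)"
        using i self_in_hclass[of "line_vec d x 1 t i"] by (simp add: line_tuple_def e_zero_eq)
      then obtain s where s: "line_vec d x 1 t i = (\<lambda>k. s * unit_fn 0 k)" by (rule hclassE)
      have "t * x (i, 1) = 0" using fun_cong[OF s, of 1] d by (simp add: line_vec_def unit_fn_def)
      thus False using x i d t by (auto simp: generic_def)
    qed
  qed
  ultimately show ?thesis by (simp add: V_space_def U_space_def)
qed

text \<open>The last point of both configurations is \<open>e_zero\<close>, so the group element
  relating them fixes it and is a dilation. Conversely every nonzero ratio is realised by a dilation
  in the group.\<close>

lemma orbit_fibre:
  assumes x: "generic d (n - 1) x" and d: "d \<ge> 1" and n: "n \<ge> 2"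
  shows "{p \<in> V_space d n. psi d n p = G_orbit d n (configuration d n x)} = {line_tuple d (n - 1) x 1 t | t. t \<noteq> 0}"
proof (intro equalityI subsetI)
  fix p assume "p \<in> {line_tuple d (n - 1) x 1 t | t. t \<noteq> 0}"
  then obtain t where t: "t \<noteq> 0" "p = line_tuple d (n - 1) x 1 t" by blast
  obtain g a c where g: "g \<in> G_group d" "a \<noteq> 0" "c / a = t"
    "dilation d g a c"
    by (rule ex_diag_in_G_group[OF t(1)])
  have e0: "mat_act d g e_zero = e_zero"
  proof -
    have "act_vec d g (unit_fn 0) = (\<lambda>i. a * unit_fn 0 i)"
      unfolding act_vec_diag[OF g(4)] by (auto simp: unit_fn_def fun_eq_iff)
    thus ?thesis unfolding e_zero_eq mat_act_hclass using hclass_scale[OF g(2)] by simp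
  qed
  have pe: "p(n := e_zero) = (\<lambda>i\<in>{1..n}. mat_act d g (configuration d n x i))"
    unfolding t(2) line_tuple_upd[OF n]
  proof (rule restrict_ext)
    fix i assume i: "i \<in> {1..n}"
    show "(if i = n then e_zero else hclass (line_vec d x 1 t i)) = mat_act d g (configuration d n x i)"
      using i by (simp add: configuration_eq mat_act_hclass e0 act_vec_diag_line[OF g(4) g(2), of x i] g(3))
  qed
  have "psi d n p = G_orbit d n (configuration d n x)"
    unfolding psi_def pe by (rule G_orbit_act[OF g(1)]) (rule configuration_in_pspace)
  thus "p \<in> {p \<in> V_space d n. psi d n p = G_orbit d n (configuration d n x)}"
    using line_tuple_in_V_space[OF x d t(1)] t(2) by simp
next
  fix p assume "p \<in> {p \<in> V_space d n. psi d n p = G_orbit d n (configuration d n x)}"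
  hence "p \<in> V_space d n \<and> psi d n p = G_orbit d n (configuration d n x)" by (rule CollectD)
  hence p: "p \<in> V_space d n" "G_orbit d n (p(n := e_zero)) = G_orbit d n (configuration d n x)"
    unfolding psi_def by (rule conjunct1, rule conjunct2)
  have pp: "p \<in> prod_space d (n - 1)" using p(1) by (simp add: V_space_def U_space_def)
  have "p(n := e_zero) \<in> G_orbit d n (p(n := e_zero))"
  proof (rule self_in_G_orbit)
    have "(p(n := e_zero)) i = undefined" if "i \<notin> {1..n}" for i
    proof -
      have "i \<noteq> n" "i \<notin> {1..n-1}" using that n by auto
      thus ?thesis using pp unfolding prod_space_def PiE_iff extensional_def by simp
    qed
    thus "p(n := e_zero) \<in> extensional {1..n}" unfolding extensional_def by blast
    fix i assume i: "i \<in> {1..n}"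
    show "(p(n := e_zero)) i \<in> pspace {0..d}"
    proof (cases "i = n")
      case False
      hence "i \<in> {1..n-1}" using i by auto
      hence "p i \<in> pspace {0..d}" using pp unfolding prod_space_def PiE_iff by blast
      thus ?thesis using False by simp
    qed (simp add: e_zero_in_pspace)
  qed
  hence "p(n := e_zero) \<in> G_orbit d n (configuration d n x)" unfolding p(2) .
  then obtain g where g: "g \<in> G_group d" "p(n := e_zero) = (\<lambda>i\<in>{1..n}. mat_act d g (configuration d n x i))"
    unfolding G_orbit_def mem_Collect_eq by (elim exE conjE) (rule that)
  have "mat_act d g e_zero = e_zero" using fun_cong[OF g(2), of n] n by (simp add: configuration_eq)
  then obtain a c where ac: "a \<noteq> 0" "c \<noteq> 0"
    "dilation d g a c"
    by (rule diag_if_fixes_e_zero[OF g(1) d])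
  have "p = line_tuple d (n - 1) x 1 (c / a)"
  proof (rule extensionalityI[of _ "{1..n-1}"])
    show "p \<in> extensional {1..n-1}" using pp by (simp add: prod_space_def PiE_iff)
    show "line_tuple d (n - 1) x 1 (c / a) \<in> extensional {1..n-1}" by (simp add: line_tuple_def)
    fix i assume i: "i \<in> {1..n-1}"
    have "i \<noteq> n" "i \<in> {1..n}" using i n by auto
    hence "p i = mat_act d g (configuration d n x i)" using fun_cong[OF g(2), of i] by simp
    also have "\<dots> = hclass (line_vec d x 1 (c / a) i)"
      using \<open>i \<noteq> n\<close> \<open>i \<in> {1..n}\<close> by (simp add: configuration_eq mat_act_hclass act_vec_diag_line[OF ac(3) ac(1), of x i])
    finally show "p i = line_tuple d (n - 1) x 1 (c / a) i" using i by (simp add: line_tuple_def)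
  qed
  moreover have "c / a \<noteq> 0" using ac by simp
  ultimately show "p \<in> {line_tuple d (n - 1) x 1 t | t. t \<noteq> 0}" by blast
qed

section \<open>Segre coordinates of an orbit closure\<close>

definition seg_vec :: "nat \<Rightarrow> nat \<Rightarrow> (nat \<times> nat \<Rightarrow> complex) \<Rightarrow> complex \<Rightarrow> complex \<Rightarrow> (nat \<Rightarrow> nat) \<Rightarrow> complex" where
  "seg_vec d m x s t = (\<lambda>k. if k \<in> multi_idx d m then mval m x k * s ^ (m - mdeg m k) * t ^ mdeg m k else 0)"

lemma prod_line_vec:
  assumes "k \<in> multi_idx d m"
  shows "(\<Prod>i\<in>{1..m}. line_vec d x s t i (k i)) = mval m x k * s ^ (m - mdeg m k) * t ^ mdeg m k"
proof -
  have "msupp m k \<subseteq> {1..m}" by (auto simp: msupp_def)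
  hence card: "card ({1..m} - msupp m k) = m - card (msupp m k)"
    by (subst card_Diff_subset) (auto intro: finite_subset)
  have "line_vec d x s t i (k i) = (if k i = 0 then 1 else x (i, k i)) * ((if k i = 0 then s else 1) * (if k i = 0 then 1 else t))"
    if "i \<in> {1..m}" for i
    using assms that by (auto simp: line_vec_def multi_idx_def PiE_iff)
  hence "(\<Prod>i\<in>{1..m}. line_vec d x s t i (k i)) =
      mval m x k * ((\<Prod>i\<in>{1..m}. if k i = 0 then s else 1) * (\<Prod>i\<in>{1..m}. if k i = 0 then 1 else t))"
    by (simp add: mval_def prod.distrib)
  also have "(\<Prod>i\<in>{1..m}. if k i = 0 then 1 else t) = (\<Prod>i\<in>msupp m k. t)"
    by (rule prod.mono_neutral_cong_right) (auto simp: msupp_def)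
  also have "(\<Prod>i\<in>{1..m}. if k i = 0 then s else 1) = (\<Prod>i\<in>{1..m} - msupp m k. s)"
    by (rule prod.mono_neutral_cong_right) (auto simp: msupp_def)
  finally show ?thesis unfolding prod_constant card mdeg_def by (simp only: mult_ac)
qed

text \<open>The embedding picks a representative in every factor by choice; the scalars by which
  these differ from \<open>line_vec\<close> multiply to one nonzero scalar.\<close>

lemma segre_line_tuple: "segre d m (line_tuple d m x s t) = hclass (seg_vec d m x s t)"
proof -
  have "\<forall>i. \<exists>c. c \<noteq> 0 \<and> (SOME y. y \<in> hclass (line_vec d x s t i)) = (\<lambda>k. c * line_vec d x s t i k)"
  proof
    fix i
    have "(SOME y. y \<in> hclass (line_vec d x s t i)) \<in> hclass (line_vec d x s t i)"
      by (rule someI[of "\<lambda>y. y \<in> hclass (line_vec d x s t i)"]) (rule self_in_hclass)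
    then obtain c where "(SOME y. y \<in> hclass (line_vec d x s t i)) = (\<lambda>k. c * line_vec d x s t i k)" "c \<noteq> 0"
      by (rule hclassE)
    thus "\<exists>c. c \<noteq> 0 \<and> (SOME y. y \<in> hclass (line_vec d x s t i)) = (\<lambda>k. c * line_vec d x s t i k)" by blast
  qed
  from choice[OF this] obtain c where c: "\<forall>i. c i \<noteq> 0 \<and> (SOME y. y \<in> hclass (line_vec d x s t i)) = (\<lambda>k. c i * line_vec d x s t i k)" ..
  define C where "C = (\<Prod>i\<in>{1..m}. c i)"
  have C: "C \<noteq> 0" using c by (simp add: C_def)
  have eq: "(\<Prod>i\<in>{1..m}. (SOME y. y \<in> line_tuple d m x s t i) (k i)) = C * (\<Prod>i\<in>{1..m}. line_vec d x s t i (k i))" for k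
    unfolding C_def prod.distrib[symmetric] by (rule prod.cong) (use c in \<open>simp_all add: line_tuple_def\<close>)
  have "segre d m (line_tuple d m x s t) = hclass (\<lambda>k. C * seg_vec d m x s t k)"
    unfolding segre_def seg_vec_def
  proof (intro arg_cong[where f = hclass] ext)
    fix k
    show "(if k \<in> multi_idx d m then \<Prod>i\<in>{1..m}. (SOME y. y \<in> line_tuple d m x s t i) (k i) else 0) =
        C * (if k \<in> multi_idx d m then mval m x k * s ^ (m - mdeg m k) * t ^ mdeg m k else 0)"
      unfolding eq using prod_line_vec[of k d m x s t] by simp
  qed
  thus ?thesis using hclass_scale[OF C] by simp
qed

lemma seg_vec_nonzero:
  assumes x: "generic d m x" and st: "s \<noteq> 0 \<or> t \<noteq> 0" and d: "d \<ge> 1"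
  shows "seg_vec d m x s t \<noteq> (\<lambda>_. 0)"
proof -
  have "\<exists>j\<le>m. s ^ (m - j) * t ^ j \<noteq> 0"
    using st by (cases "s = 0") (auto intro: exI[of _ m] exI[of _ 0])
  then obtain j where j: "j \<le> m" "s ^ (m - j) * t ^ j \<noteq> 0" by blast
  have "j \<in> mdeg m ` multi_idx d m" using j(1) unfolding mdeg_image[OF d] by simp
  then obtain k where k: "mdeg m k = j" "k \<in> multi_idx d m" by (elim imageE) (rule that, simp)
  have "mval m x k \<noteq> 0" by (rule mval_nonzero[where d = d]) (use x k in \<open>auto simp: generic_def\<close>)
  hence "seg_vec d m x s t k \<noteq> 0" using k j(2) by (simp add: seg_vec_def)
  thus ?thesis by (intro notI) simp
qed

text \<open>The relations are quadratic equations of the rational normal curve. If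
  \<open>z 0\<close> is nonzero they make \<open>z\<close> geometric with ratio
  \<open>z 1 / z 0\<close>. If it is zero, squares force every entry but the last to vanish, which
  is the point at infinity.\<close>

lemma rational_normal_curve:
  fixes z :: "nat \<Rightarrow> complex"
  assumes rel: "\<And>i j. i < m \<Longrightarrow> 1 \<le> j \<Longrightarrow> j \<le> m \<Longrightarrow> z i * z j = z (Suc i) * z (j - 1)"
    and nz: "\<exists>j\<le>m. z j \<noteq> 0" and m: "m \<ge> 1"
  obtains \<sigma> s t where "\<sigma> \<noteq> 0" "s \<noteq> 0 \<or> t \<noteq> 0" "\<forall>j\<le>m. z j = \<sigma> * (s ^ (m - j) * t ^ j)"
proof (cases "z 0 = 0")
  case False
  have E: "z j = z 0 * (z 1 / z 0) ^ j" if "j \<le> m" for j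
    using that
  proof (induction j)
    case (Suc j)
    have "z 0 * z (Suc j) = z 1 * z j" using rel[of 0 "Suc j"] Suc.prems m by simp
    hence "z (Suc j) = z 1 / z 0 * z j" using False by (simp add: eq_divide_eq mult.commute)
    thus ?case using Suc.IH Suc.prems by simp
  qed simp
  have "\<forall>j\<le>m. z j = z 0 * (1 ^ (m - j) * (z 1 / z 0) ^ j)"
    unfolding power_one mult_1_left by (intro allI impI) (rule E)
  from that[OF False disjI1[OF one_neq_zero] this] show ?thesis .
next
  case True
  have zero: "z j = 0" if "j < m" for j
    using that
  proof (induction j)
    case (Suc j)
    have "z (Suc j) * z (Suc j) = z (Suc (Suc j)) * z j" using rel[of "Suc j" "Suc j"] Suc.prems by simp
    thus ?case using Suc by simp
  qed (use True in simp)
  have "z m \<noteq> 0"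
  proof -
    obtain j where "j \<le> m" "z j \<noteq> 0" using nz by (elim exE conjE) (rule that)
    thus ?thesis using zero[of j] by (cases "j = m") simp_all
  qed
  have E: "z j = z m * (0 ^ (m - j) * 1 ^ j)" if "j \<le> m" for j
    using zero[of j] that by (cases "j = m") simp_all
  have "\<forall>j\<le>m. z j = z m * (0 ^ (m - j) * 1 ^ j)" by (intro allI impI) (rule E)
  from that[OF \<open>z m \<noteq> 0\<close> disjI2[OF one_neq_zero] this] show ?thesis .
qed

text \<open>Coordinates of equal weight are proportional along the orbit, and their normalised
  values satisfy the equations of a rational normal curve; both survive in the closure and leave
  only points of the curve. Conversely the end points are limits, since a form that is nonzero there
  is nonzero somewhere on the orbit.\<close>

lemma segre_orbit_closure:
  assumes x: "generic d (n - 1) x" and d: "d \<ge> 1" and n: "n \<ge> 2"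
  shows "segre d (n - 1) ` orbit_closure d n (G_orbit d n (configuration d n x)) =
    {hclass (seg_vec d (n - 1) x s t) | s t. s \<noteq> 0 \<or> t \<noteq> 0}"
proof -
  define m where "m = n - 1"
  have m: "m \<ge> 1" using n by (simp add: m_def)
  have x: "generic d m x" using x by (simp add: m_def)
  define T where "T = prod_zariski d m"
  have topT: "topspace T = {p \<in> prod_space d m. segre d m p \<in> pspace UNIV}"
    by (auto simp: T_def prod_zariski_def topspace_pullback_topology topspace_zariski)
  have openT: "openin T V \<longleftrightarrow> (\<exists>U. openin zariski U \<and> V = segre d m -` U \<inter> prod_space d m)" for V
    by (simp add: T_def prod_zariski_def openin_pullback_topology)
  define S where "S = {line_tuple d m x 1 t | t. t \<noteq> 0}"
  have oc: "orbit_closure d n (G_orbit d n (configuration d n x)) = T closure_of S"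
    unfolding orbit_closure_def S_def T_def m_def orbit_fibre[OF x[unfolded m_def] d n] by (rule refl)
  have S_prod: "p \<in> prod_space d m" if "p \<in> S" for p
    using that by (auto simp: S_def line_tuple_def prod_space_def line_pt_in_pspace)
  have mv: "mval m x k \<noteq> 0" if "k \<in> multi_idx d m" for k
    by (rule mval_nonzero[where d = d, OF _ that]) (use x in \<open>auto simp: generic_def\<close>)
  \<comment> \<open>Homogeneous polynomials that vanish along the orbit vanish on its closure; all
    equations below are obtained from this.\<close>
  have van: "peval F y = 0"
    if p: "p \<in> T closure_of S" and y: "y \<in> segre d m p" and F: "homogeneous e F"
      and FS: "\<And>t. t \<noteq> 0 \<Longrightarrow> peval F (seg_vec d m x 1 t) = 0" for p y e F
  proof (rule ccontr)
    assume nz: "peval F y \<noteq> 0"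
    have pT: "p \<in> prod_space d m" "segre d m p \<in> pspace UNIV"
      using p closure_of_subset_topspace[of T S] topT by auto
    define U where "U = {q \<in> pspace UNIV. \<not> pvanish F q}"
    have "openin T (segre d m -` U \<inter> prod_space d m)"
      unfolding openT by (rule exI[of _ U]) (use openin_nonvanishing[OF F] in \<open>simp add: U_def\<close>)
    moreover have "p \<in> segre d m -` U \<inter> prod_space d m"
      using pT pvanish_iff[OF F pT(2) y] nz by (simp add: U_def)
    ultimately have "\<exists>q. q \<in> S \<and> q \<in> segre d m -` U \<inter> prod_space d m"
      using p unfolding in_closure_of by (elim conjE allE impE) (rule conjI, assumption+)
    then obtain q where q: "q \<in> S" "q \<in> segre d m -` U \<inter> prod_space d m" by (elim exE conjE) (rule that)
    obtain t where t0: "t \<noteq> 0" "q = line_tuple d m x 1 t"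
      using q(1) unfolding S_def mem_Collect_eq by (elim exE conjE) (rule that)
    hence t: "t \<noteq> 0" "segre d m (line_tuple d m x 1 t) \<in> U" using q(2) by simp_all
    hence "\<not> pvanish F (hclass (seg_vec d m x 1 t))" by (simp add: segre_line_tuple U_def)
    thus False using FS[OF t(1)] pvanish_hclass[OF F] by simp
  qed
  have "segre d m ` (T closure_of S) = {hclass (seg_vec d m x s t) | s t. s \<noteq> 0 \<or> t \<noteq> 0}"
  proof (intro equalityI subsetI)
    fix q assume "q \<in> segre d m ` (T closure_of S)"
    then obtain p where p: "p \<in> T closure_of S" "q = segre d m p" by blast
    have qp: "q \<in> pspace UNIV" using p closure_of_subset_topspace[of T S] topT by auto
    obtain y where y: "y \<in> q" using pspace_nonempty[OF qp] unfolding ex_in_conv[symmetric] by (elim exE) (rule that)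
    have qy: "q = hclass y" "y \<noteq> (\<lambda>_. 0)" using pspace_elem_hclass[OF qp y] by simp_all
    note V = van[OF p(1) y[unfolded p(2)]]
    have "\<forall>j\<in>{..m}. \<exists>k. k \<in> multi_idx d m \<and> mdeg m k = j"
    proof
      fix j assume "j \<in> {..m}"
      hence "j \<in> mdeg m ` multi_idx d m" unfolding mdeg_image[OF d] .
      then obtain k where "j = mdeg m k" "k \<in> multi_idx d m" by (rule imageE)
      thus "\<exists>k. k \<in> multi_idx d m \<and> mdeg m k = j" by (intro exI[of _ k] conjI) simp_all
    qed
    from bchoice[OF this] obtain kk where kk: "\<forall>j\<in>{..m}. kk j \<in> multi_idx d m \<and> mdeg m (kk j) = j" ..
    \<comment> \<open>Dividing by the value at \<open>x\<close> leaves, for each weight, what should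
      be \<open>s ^ (m - j) * t ^ j\<close> up to a common scalar.\<close>
    define z where "z j = y (kk j) / mval m x (kk j)" for j
    have y0: "y k = 0" if "k \<notin> multi_idx d m" for k
      using V[OF homogeneous_Var[of k]] that by (simp add: seg_vec_def)
    have yk: "y k = mval m x k * z (mdeg m k)" if k: "k \<in> multi_idx d m" for k
    proof -
      define l where "l = kk (mdeg m k)"
      have l: "l \<in> multi_idx d m" "mdeg m l = mdeg m k" using kk mdeg_le[of m k] by (auto simp: l_def)
      have "peval (Poly_Mapping.single 0 (mval m x l) * Var k - Poly_Mapping.single 0 (mval m x k) * Var l) y = 0"
        by (rule V[of 1]) (simp_all add: homogeneous_diff homogeneous_const_mult homogeneous_Var[unfolded One_nat_def] peval_diff peval_mult seg_vec_def k l)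
      hence "mval m x l * y k = mval m x k * y l" by (simp add: peval_diff peval_mult)
      hence "y k = mval m x k * y l / mval m x l" using mv[OF l(1)] by (simp add: eq_divide_eq mult.commute)
      thus ?thesis by (simp only: z_def l_def[symmetric] times_divide_eq_right)
    qed
    have rel: "z i * z j = z (Suc i) * z (j - 1)" if ij: "i < m" "1 \<le> j" "j \<le> m" for i j
    proof -
      have K: "kk i \<in> multi_idx d m" "mdeg m (kk i) = i" "kk j \<in> multi_idx d m" "mdeg m (kk j) = j"
        "kk (Suc i) \<in> multi_idx d m" "mdeg m (kk (Suc i)) = Suc i" "kk (j - 1) \<in> multi_idx d m" "mdeg m (kk (j - 1)) = j - 1"
        by (rule kk[THEN bspec, THEN conjunct1] kk[THEN bspec, THEN conjunct2], use ij in simp)+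
      let ?F = "Poly_Mapping.single 0 (mval m x (kk (Suc i)) * mval m x (kk (j - 1))) * (Var (kk i) * Var (kk j)) -
         Poly_Mapping.single 0 (mval m x (kk i) * mval m x (kk j)) * (Var (kk (Suc i)) * Var (kk (j - 1)))"
      have "peval ?F y = 0"
      proof (rule V)
        show "homogeneous (1 + 1) ?F" by (intro homogeneous_diff homogeneous_const_mult homogeneous_mult homogeneous_Var)
        fix t :: complex
        have "i + j = Suc i + (j - 1)" using ij by simp
        hence T: "t ^ i * t ^ j = t ^ Suc i * t ^ (j - 1)" by (simp only: power_add[symmetric])
        have v: "seg_vec d m x 1 t (kk i) = mval m x (kk i) * t ^ i" "seg_vec d m x 1 t (kk j) = mval m x (kk j) * t ^ j"
          "seg_vec d m x 1 t (kk (Suc i)) = mval m x (kk (Suc i)) * t ^ Suc i"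
          "seg_vec d m x 1 t (kk (j - 1)) = mval m x (kk (j - 1)) * t ^ (j - 1)"
          by (simp_all only: seg_vec_def K power_one mult_1_right if_True)
        have AC: "a * b * (c * p * (e * q)) = c * e * (a * r * (b * s))" if "p * q = r * s" for a b c e p q r s :: complex
        proof -
          have "a * b * (c * p * (e * q)) = a * b * c * e * (p * q)" by (simp only: mult_ac)
          also have "\<dots> = c * e * (a * r * (b * s))" unfolding that by (simp only: mult_ac)
          finally show ?thesis .
        qed
        show "peval ?F (seg_vec d m x 1 t) = 0"
          unfolding peval_diff peval_mult peval_const peval_Var v right_minus_eq by (rule AC[OF T])
      qed
      hence Y: "mval m x (kk (Suc i)) * mval m x (kk (j - 1)) * (y (kk i) * y (kk j)) =
          mval m x (kk i) * mval m x (kk j) * (y (kk (Suc i)) * y (kk (j - 1)))" unfolding peval_diff peval_mult peval_const peval_Var right_minus_eq .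
      have G: "p / A = q / B" if "B * p = A * q" "A \<noteq> 0" "B \<noteq> 0" for p q A B :: complex
        unfolding frac_eq_eq[OF that(2,3)] using that(1) by (simp only: mult.commute[of p] mult.commute[of q])
      show ?thesis unfolding z_def times_divide_times_eq by (rule G[OF Y]) (use mv[OF K(1)] mv[OF K(3)] mv[OF K(5)] mv[OF K(7)] in simp_all)
    qed
    have nz: "\<exists>j\<le>m. z j \<noteq> 0"
    proof (rule ccontr)
      assume none: "\<not> (\<exists>j\<le>m. z j \<noteq> 0)"
      have "y k = 0" for k using y0[of k] yk[of k] none mdeg_le[of m k] by (cases "k \<in> multi_idx d m") auto
      hence "y = (\<lambda>_. 0)" by (rule ext)
      thus False using qy(2) by (rule notE[rotated])
    qed
    obtain \<sigma> s t where st: "\<sigma> \<noteq> 0" "s \<noteq> 0 \<or> t \<noteq> 0" "\<forall>j\<le>m. z j = \<sigma> * (s ^ (m - j) * t ^ j)"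
      by (rule rational_normal_curve[OF rel nz m])
    have "y = (\<lambda>k. \<sigma> * seg_vec d m x s t k)"
    proof
      fix k show "y k = \<sigma> * seg_vec d m x s t k"
      proof (cases "k \<in> multi_idx d m")
        case True
        have "z (mdeg m k) = \<sigma> * (s ^ (m - mdeg m k) * t ^ mdeg m k)" using st(3) mdeg_le[of m k] by blast
        thus ?thesis unfolding yk[OF True] seg_vec_def if_P[OF True] by (simp only: mult_ac)
      qed (use y0[of k] in \<open>simp add: seg_vec_def\<close>)
    qed
    hence "q = hclass (seg_vec d m x s t)" using qy(1) hclass_scale[OF st(1)] by simp
    thus "q \<in> {hclass (seg_vec d m x s t) | s t. s \<noteq> 0 \<or> t \<noteq> 0}" using st(2) by blast
  next
    fix q assume "q \<in> {hclass (seg_vec d m x s t) | s t. s \<noteq> 0 \<or> t \<noteq> 0}"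
    then obtain s t where q: "q = hclass (seg_vec d m x s t)" and st: "s \<noteq> 0 \<or> t \<noteq> 0" by blast
    define p where "p = line_tuple d m x s t"
    have "hclass (line_vec d x s t i) \<in> pspace {0..d}" if i: "i \<in> {1..m}" for i
    proof (rule hclass_in_pspace_supported[OF line_vec_supported])
      have "x (i, 1) \<noteq> 0" using x i d by (simp add: generic_def)
      hence "line_vec d x s t i 0 \<noteq> 0 \<or> line_vec d x s t i 1 \<noteq> 0" using st d by (auto simp: line_vec_def)
      thus "line_vec d x s t i \<noteq> (\<lambda>_. 0)" by (intro notI) simp
    qed
    hence pp: "p \<in> prod_space d m" by (simp add: p_def line_tuple_def prod_space_def)
    have sp: "segre d m p = q" by (simp add: p_def q segre_line_tuple)
    have qp: "q \<in> pspace UNIV" unfolding q by (rule hclass_in_pspace[OF seg_vec_nonzero[OF x st d]])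
    have "\<exists>r. r \<in> S \<and> r \<in> V" if V: "p \<in> V" "openin T V" for V
    proof -
      obtain U where U: "openin zariski U" "V = segre d m -` U \<inter> prod_space d m" using V(2) unfolding openT by (elim exE conjE) (rule that)
      have "q \<in> U" using V(1) U(2) sp by auto
      from zariski_open_basis[OF U(1) this] obtain e F where F: "homogeneous e F" "\<not> pvanish F q"
        "{q \<in> pspace UNIV. \<not> pvanish F q} \<subseteq> U" .
      \<comment> \<open>The parameters \<open>(s, t)\<close> are varied together. Where both are
        nonzero the point is, up to scaling by \<open>w 0 ^ m\<close>, on the orbit itself, so
        density in the parameter plane reaches the end points.\<close>
      define f where "f w = peval F (seg_vec d m x (w 0) (w 1))" for w :: "nat \<Rightarrow> complex"
      have lpf: "line_poly f" unfolding f_def seg_vec_def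
        by (intro line_poly_peval line_poly_if line_poly_mult line_poly_power line_poly_const line_poly_coord)
      have lpd: "line_poly (\<lambda>w :: nat \<Rightarrow> complex. w 0 * w 1)" by (intro line_poly_mult line_poly_coord)
      have "\<exists>t. t \<noteq> 0 \<and> peval F (seg_vec d m x 1 t) \<noteq> 0"
      proof (rule ccontr)
        assume none: "\<not> (\<exists>t. t \<noteq> 0 \<and> peval F (seg_vec d m x 1 t) \<noteq> 0)"
        have "f w = 0" if w: "w 0 * w 1 \<noteq> 0" for w
        proof -
          have w0: "w 0 \<noteq> 0" and w1: "w 1 / w 0 \<noteq> 0" using w by auto
          have "seg_vec d m x (w 0) (w 1) = (\<lambda>k. w 0 ^ m * seg_vec d m x 1 (w 1 / w 0) k)"
          proof
            fix k
            have "w 0 ^ m = w 0 ^ (m - mdeg m k) * w 0 ^ mdeg m k" using mdeg_le[of m k] by (simp flip: power_add)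
            thus "seg_vec d m x (w 0) (w 1) k = w 0 ^ m * seg_vec d m x 1 (w 1 / w 0) k"
              using w0 by (simp add: seg_vec_def power_divide)
          qed
          moreover have "peval F (seg_vec d m x 1 (w 1 / w 0)) = 0" using none w1 by blast
          ultimately show ?thesis unfolding f_def by (simp only: peval_scale[OF F(1)] mult_zero_right)
        qed
        from line_poly_dense[OF lpf lpd, of "\<lambda>_. 1", OF _ this]
        have "f (\<lambda>i. if i = 0 then s else t) = 0" by simp
        hence "peval F (seg_vec d m x s t) = 0" by (simp add: f_def)
        thus False using F(2) pvanish_hclass[OF F(1)] by (simp add: q)
      qed
      then obtain t' where t': "t' \<noteq> 0" "peval F (seg_vec d m x 1 t') \<noteq> 0" by blast
      define r where "r = line_tuple d m x 1 t'"
      have rS: "r \<in> S" using t'(1) by (auto simp: S_def r_def)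
      have "hclass (seg_vec d m x 1 t') \<in> pspace UNIV"
        by (rule hclass_in_pspace[OF seg_vec_nonzero[OF x _ d]]) simp
      moreover have "\<not> pvanish F (hclass (seg_vec d m x 1 t'))" using t'(2) pvanish_hclass[OF F(1)] by simp
      ultimately have "segre d m r \<in> U" using F(3) by (auto simp: r_def segre_line_tuple)
      hence "r \<in> V" using S_prod[OF rS] U(2) by simp
      with rS show ?thesis by blast
    qed
    moreover have "p \<in> topspace T" using pp qp sp by (simp add: topT)
    ultimately have "p \<in> T closure_of S" unfolding in_closure_of by simp
    thus "q \<in> segre d m ` (T closure_of S)" using sp by blast
  qed
  thus ?thesis unfolding oc by (simp add: m_def)
qed

section \<open>The Chow form of a generic orbit closure\<close>

lemma seg_vec_section:
  "(\<Sum>k\<in>multi_idx d m. u (b, k) * seg_vec d m x s t k) =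
   (\<Sum>k\<in>multi_idx d m. mval m x k * u (b, k) * (s ^ (m - mdeg m k) * t ^ mdeg m k))"
  by (rule sum.cong) (simp_all add: seg_vec_def)

text \<open>Dehomogenising by \<open>s\<close> turns common points of the curve and the two
  hyperplanes into common roots of the sections; the point with \<open>s = 0\<close> accounts for
  the simultaneous vanishing of the top coefficients.\<close>

lemma common_point_iff:
  assumes x: "generic d m x" and d: "d \<ge> 1" and m: "m \<ge> 1"
  shows "(\<exists>p\<in>{hclass (seg_vec d m x s t) | s t. s \<noteq> 0 \<or> t \<noteq> 0}.
      \<forall>y\<in>p. \<forall>b. (\<Sum>k\<in>multi_idx d m. u (b, k) * y k) = 0) \<longleftrightarrow>
    peval (res_form (multi_idx d m) (mdeg m) (mval m x) m) u = 0"
proof -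
  interpret graded_forms "multi_idx d m" "mdeg m" "mval m x" m "zero_idx m"
    by (rule graded_forms_mval) (use assms in \<open>auto simp: generic_def\<close>)
  define H where "H b s t = (\<Sum>k\<in>multi_idx d m. mval m x k * u (b, k) * (s ^ (m - mdeg m k) * t ^ mdeg m k))" for b s t
  have cls: "(\<forall>y\<in>hclass (seg_vec d m x s t). \<forall>b. (\<Sum>k\<in>multi_idx d m. u (b, k) * y k) = 0) \<longleftrightarrow> (\<forall>b. H b s t = 0)" for s t
  proof
    assume *: "\<forall>y\<in>hclass (seg_vec d m x s t). \<forall>b. (\<Sum>k\<in>multi_idx d m. u (b, k) * y k) = 0"
    show "\<forall>b. H b s t = 0" using bspec[OF * self_in_hclass] by (simp add: seg_vec_section H_def)
  next
    assume *: "\<forall>b. H b s t = 0"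
    show "\<forall>y\<in>hclass (seg_vec d m x s t). \<forall>b. (\<Sum>k\<in>multi_idx d m. u (b, k) * y k) = 0"
    proof (intro ballI allI)
      fix y b assume "y \<in> hclass (seg_vec d m x s t)"
      then obtain c where c: "y = (\<lambda>k. c * seg_vec d m x s t k)" by (rule hclassE)
      have "(\<Sum>k\<in>multi_idx d m. u (b, k) * y k) = c * H b s t"
        unfolding H_def seg_vec_section[symmetric] c sum_distrib_left by (simp add: mult_ac)
      thus "(\<Sum>k\<in>multi_idx d m. u (b, k) * y k) = 0" using * by simp
    qed
  qed
  have H1: "H b s t = s ^ m * poly (P u b) (t / s)" if "s \<noteq> 0" for b s t
    unfolding H_def poly_section_poly sum_distrib_left
  proof (rule sum.cong[OF refl])
    fix k
    have "s ^ m = s ^ (m - mdeg m k) * s ^ mdeg m k" using mdeg_le[of m k] by (simp flip: power_add)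
    thus "mval m x k * u (b, k) * (s ^ (m - mdeg m k) * t ^ mdeg m k) = s ^ m * (mval m x k * u (b, k) * (t / s) ^ mdeg m k)"
      using that by (simp add: power_divide)
  qed
  have H0: "H b 0 t = t ^ m * coeff (P u b) m" for b t
  proof -
    have "H b 0 t = (\<Sum>k\<in>multi_idx d m. t ^ m * (if mdeg m k = m then mval m x k * u (b, k) else 0))"
      unfolding H_def by (rule sum.cong) (use mdeg_le[of m] in \<open>auto simp: power_0_left le_antisym\<close>)
    thus ?thesis by (simp add: section_poly_def coeff_sum sum_distrib_left)
  qed
  have "(\<exists>p\<in>{hclass (seg_vec d m x s t) | s t. s \<noteq> 0 \<or> t \<noteq> 0}.
      \<forall>y\<in>p. \<forall>b. (\<Sum>k\<in>multi_idx d m. u (b, k) * y k) = 0) \<longleftrightarrow> (\<exists>s t. (s \<noteq> 0 \<or> t \<noteq> 0) \<and> (\<forall>b. H b s t = 0))"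
    (is "?L \<longleftrightarrow> ?M")
  proof
    assume ?L
    then obtain s t where "s \<noteq> 0 \<or> t \<noteq> 0"
      "\<forall>y\<in>hclass (seg_vec d m x s t). \<forall>b. (\<Sum>k\<in>multi_idx d m. u (b, k) * y k) = 0" by blast
    thus ?M unfolding cls by blast
  next
    assume ?M
    then obtain s t where st: "s \<noteq> 0 \<or> t \<noteq> 0" "\<forall>b. H b s t = 0" by blast
    have "hclass (seg_vec d m x s t) \<in> {hclass (seg_vec d m x s t) | s t. s \<noteq> 0 \<or> t \<noteq> 0}" using st(1) by blast
    thus ?L by (rule bexI[rotated]) (use st(2) cls in simp)
  qed
  also have "\<dots> \<longleftrightarrow> (\<exists>t. \<forall>b. poly (P u b) t = 0) \<or> (\<forall>b. coeff (P u b) m = 0)"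
  proof
    assume ?M
    then obtain s t where st: "s \<noteq> 0 \<or> t \<noteq> 0" "\<forall>b. H b s t = 0" by blast
    show "(\<exists>t. \<forall>b. poly (P u b) t = 0) \<or> (\<forall>b. coeff (P u b) m = 0)"
    proof (cases "s = 0")
      case True
      thus ?thesis using st H0 by simp
    next
      case False
      hence "\<forall>b. poly (P u b) (t / s) = 0" using st(2) H1 by simp
      thus ?thesis by blast
    qed
  next
    assume "(\<exists>t. \<forall>b. poly (P u b) t = 0) \<or> (\<forall>b. coeff (P u b) m = 0)"
    thus ?M
    proof
      assume "\<exists>t. \<forall>b. poly (P u b) t = 0"
      then obtain t where "\<forall>b. poly (P u b) t = 0" ..
      hence "\<forall>b. H b 1 t = 0" by (simp add: H1)
      thus ?M by (intro exI[of _ 1] exI[of _ t]) simp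
    next
      assume "\<forall>b. coeff (P u b) m = 0"
      hence "\<forall>b. H b 0 1 = 0" by (simp add: H0)
      thus ?M by (intro exI[of _ 0] exI[of _ 1]) simp
    qed
  qed
  also have "\<dots> \<longleftrightarrow> peval R u = 0"
    unfolding R_eq_0_iff by (simp add: all_bool_eq conj_commute)
  finally show ?thesis .
qed

text \<open>The resultant is one admissible Chow form, so the choice returns an admissible one; any
  other has the same zeros on supported arguments and is therefore a scalar multiple of the
  resultant.\<close>

lemma chow_form_generic:
  assumes x: "generic d m x" and d: "d \<ge> 1" and m: "m \<ge> 1"
    and C: "C = {hclass (seg_vec d m x s t) | s t. s \<noteq> 0 \<or> t \<noteq> 0}"
  obtains c where "c \<noteq> 0" "chow_form (multi_idx d m) C =
    Poly_Mapping.single 0 c * res_form (multi_idx d m) (mdeg m) (mval m x) m"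
proof -
  interpret graded_forms "multi_idx d m" "mdeg m" "mval m x" m "zero_idx m"
    by (rule graded_forms_mval) (use assms in \<open>auto simp: generic_def\<close>)
  have "is_chow_form (multi_idx d m) C R"
    unfolding is_chow_form_def C
    using irreducible_R poly_vars_res_form[OF fin] common_point_iff[OF x d m] by simp
  hence Q: "is_chow_form (multi_idx d m) C (chow_form (multi_idx d m) C)"
    unfolding chow_form_def by (rule someI[of "is_chow_form (multi_idx d m) C"])
  let ?Q = "chow_form (multi_idx d m) C"
  have van: "peval ?Q u = 0" if u: "poly (P u False) t = 0" "poly (P u True) t = 0" for u t
  proof -
    \<comment> \<open>Admissibility speaks only of supported coefficient vectors, so
      \<open>u\<close> is cut off; neither the sections nor the Chow form see the
      difference.\<close>
    define u' where "u' v = (if v \<in> UNIV \<times> multi_idx d m then u v else 0)" for v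
    have "P u' b = P u b" for b unfolding section_poly_def by (rule sum.cong) (simp_all add: u'_def)
    hence "peval R u' = 0" using u by (intro R_vanishes[of u' t]) simp_all
    hence "\<exists>p\<in>C. \<forall>y\<in>p. \<forall>b. (\<Sum>k\<in>multi_idx d m. u' (b, k) * y k) = 0"
      unfolding C common_point_iff[OF x d m] .
    moreover have "supported (UNIV \<times> multi_idx d m) u'" by (simp add: supported_def u'_def)
    ultimately have "peval ?Q u' = 0" using Q unfolding is_chow_form_def by simp
    moreover have "peval ?Q u' = peval ?Q u"
      by (rule peval_cong) (use Q in \<open>auto simp: is_chow_form_def u'_def\<close>)
    ultimately show ?thesis by simp
  qed
  have "irreducible ?Q" using Q by (simp add: is_chow_form_def)
  then obtain c where "c \<noteq> 0" "?Q = Poly_Mapping.single 0 c * R"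
    by (rule associated_if_irreducible_vanishing[OF _ van])
  thus ?thesis by (rule that)
qed

lemma lookup_const_mult: "Poly_Mapping.lookup (Poly_Mapping.single 0 c * F) M = c * Poly_Mapping.lookup F M"
  for F :: "'v cpoly"
proof -
  have "Poly_Mapping.single 0 c * F = Poly_Mapping.map ((*) c) F"
  proof (rule cpoly_eqI)
    fix u
    have "Poly_Mapping.keys (Poly_Mapping.map ((*) c) F) \<subseteq> Poly_Mapping.keys F" by (auto simp: in_keys_iff map.rep_eq when_def)
    hence "peval (Poly_Mapping.map ((*) c) F) u = (\<Sum>m\<in>Poly_Mapping.keys F. Poly_Mapping.lookup (Poly_Mapping.map ((*) c) F) m * mon_eval m u)"
      by (intro peval_superset) auto
    also have "\<dots> = (\<Sum>m\<in>Poly_Mapping.keys F. c * (Poly_Mapping.lookup F m * mon_eval m u))"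
      by (rule sum.cong) (auto simp: map.rep_eq when_def in_keys_iff)
    finally show "peval (Poly_Mapping.single 0 c * F) u = peval (Poly_Mapping.map ((*) c) F) u"
      by (simp add: peval_mult peval_def[of F] sum_distrib_left)
  qed
  thus ?thesis by (simp add: map.rep_eq when_def)
qed

theorem rho_open_generic:
  assumes x: "generic d (n - 1) x" and d: "d \<ge> 1" and n: "n \<ge> 2"
  shows "rho_open d n (G_orbit d n (configuration d n x)) = hclass (chow_vec d (n - 1) x)"
proof -
  have m: "n - 1 \<ge> 1" using n by simp
  let ?C = "orbit_closure d n (G_orbit d n (configuration d n x))"
  obtain c where c: "c \<noteq> 0" "chow_form (multi_idx d (n - 1)) (segre d (n - 1) ` ?C) =
     Poly_Mapping.single 0 c * res_form (multi_idx d (n - 1)) (mdeg (n - 1)) (mval (n - 1) x) (n - 1)"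
    by (rule chow_form_generic[OF x d m segre_orbit_closure[OF x d n]])
  have "rho_open d n (G_orbit d n (configuration d n x)) =
      hclass (Poly_Mapping.lookup (chow_form (multi_idx d (n - 1)) (segre d (n - 1) ` ?C)))"
    by (simp add: rho_open_def chow_point_def)
  also have "\<dots> = hclass (\<lambda>M. c * chow_vec d (n - 1) x M)"
    unfolding c(2) lookup_res_form_mval[symmetric] by (intro arg_cong[where f = hclass] ext) (rule lookup_const_mult)
  also have "\<dots> = hclass (chow_vec d (n - 1) x)" by (rule hclass_scale[OF c(1)])
  finally show ?thesis .
qed

section \<open>Density of the generic configurations\<close>

lemma G_group_act_inverse:
  assumes "g \<in> G_group d"
  obtains h where "h \<in> G_group d" "\<forall>p\<in>pspace {0..d}. mat_act d h (mat_act d g p) = p"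
    "\<forall>x. supported {0..d} x \<longrightarrow> act_vec d h (act_vec d g x) = x"
proof -
  obtain h where h: "h \<in> G_group d" "h * g = 1\<^sub>m (d + 1)" by (rule G_group_inverse[OF assms])
  note c = G_groupD(1)[OF assms] G_groupD(1)[OF h(1)]
  show ?thesis
  proof (rule that[OF h(1)])
    show "\<forall>p\<in>pspace {0..d}. mat_act d h (mat_act d g p) = p"
      unfolding mat_act_mult[OF c, symmetric] h(2) by (rule ballI) (rule mat_act_one)
    show "\<forall>x. supported {0..d} x \<longrightarrow> act_vec d h (act_vec d g x) = x"
      unfolding act_vec_mult[OF c, symmetric] h(2) by (intro allI impI) (rule act_vec_one)
  qed
qed

lemma mat_act_in_pspace:
  assumes g: "g \<in> G_group d" and p: "p \<in> pspace {0..d}"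
  shows "mat_act d g p \<in> pspace {0..d}"
proof -
  obtain h where h: "\<forall>x. supported {0..d} x \<longrightarrow> act_vec d h (act_vec d g x) = x"
    by (rule G_group_act_inverse[OF g]) (rule that)
  obtain x where x: "p = hclass x" "x \<noteq> (\<lambda>_. 0)" "supported {0..d} x"
    using p unfolding pspace_def mem_Collect_eq by (elim exE conjE) (rule that)
  show ?thesis unfolding x(1) mat_act_hclass
  proof (rule hclass_in_pspace_supported)
    show "supported {0..d} (act_vec d g x)" by (simp add: supported_def act_vec_def)
    show "act_vec d g x \<noteq> (\<lambda>_. 0)"
    proof
      assume 0: "act_vec d g x = (\<lambda>_. 0)"
      have "x = act_vec d h (act_vec d g x)" by (rule h[rule_format, OF x(3), symmetric])
      also have "\<dots> = (\<lambda>_. 0)" unfolding 0 by (rule ext) (simp add: act_vec_def)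
      finally show False using x(2) by (rule notE[rotated])
    qed
  qed
qed

lemma U_space_memD:
  assumes "q \<in> U_space d n" "i \<in> {1..n}"
  shows "q i \<in> pspace {0..d}" "q i \<notin> hyp_H d"
proof -
  have "q \<in> prod_space d n" using assms(1) by (simp add: U_space_def)
  thus "q i \<in> pspace {0..d}" unfolding prod_space_def by (rule PiE_mem) (rule assms(2))
  have "\<forall>i\<in>{1..n}. q i \<notin> hyp_H d" using assms(1) unfolding U_space_def mem_Collect_eq by (elim conjE)
  thus "q i \<notin> hyp_H d" using assms(2) by (rule bspec)
qed

lemma G_action_U_space:
  assumes g: "g \<in> G_group d" and q: "q \<in> U_space d n"
  shows "(\<lambda>i\<in>{1..n}. mat_act d g (q i)) \<in> U_space d n"
proof -
  obtain h where h: "h \<in> G_group d" "\<forall>p\<in>pspace {0..d}. mat_act d h (mat_act d g p) = p"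
    by (rule G_group_act_inverse[OF g]) (rule that)
  note qp = U_space_memD[OF q]
  have "mat_act d g (q i) \<notin> hyp_H d" if i: "i \<in> {1..n}" for i
  proof
    assume H: "mat_act d g (q i) \<in> hyp_H d"
    have "q i = mat_act d h (mat_act d g (q i))" by (rule bspec[OF h(2) qp(1)[OF i], symmetric])
    also have "\<dots> = mat_act d g (q i)" by (rule G_groupD(3)[OF h(1) H])
    finally show False using H qp(2)[OF i] by simp
  qed
  moreover have "inj_on (\<lambda>i\<in>{1..n}. mat_act d g (q i)) {1..n}"
  proof (rule inj_onI)
    fix i j assume ij: "i \<in> {1..n}" "j \<in> {1..n}"
      "(\<lambda>i\<in>{1..n}. mat_act d g (q i)) i = (\<lambda>i\<in>{1..n}. mat_act d g (q i)) j"
    hence E: "mat_act d g (q i) = mat_act d g (q j)" by simp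
    have "q i = mat_act d h (mat_act d g (q i))" by (rule bspec[OF h(2) qp(1)[OF ij(1)], symmetric])
    also have "\<dots> = q j" unfolding E by (rule bspec[OF h(2) qp(1)[OF ij(2)]])
    finally have "q i = q j" .
    moreover have "inj_on q {1..n}" using q by (simp add: U_space_def)
    ultimately show "i = j" using ij(1,2) by (intro inj_onD[of q "{1..n}" i j])
  qed
  moreover have "(\<lambda>i\<in>{1..n}. mat_act d g (q i)) \<in> prod_space d n"
    unfolding prod_space_def by (rule restrict_PiE_iff[THEN iffD2], rule ballI, rule mat_act_in_pspace[OF g], rule qp(1))
  ultimately show ?thesis by (simp add: U_space_def)
qed

lemma ex_affine_representative:
  assumes p: "p \<in> pspace {0..d}" "p \<notin> hyp_H d"
  shows "\<exists>y. p = hclass y \<and> supported {0..d} y \<and> y 0 = 1"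
proof -
  have "\<exists>x\<in>p. x 0 \<noteq> 0" using p unfolding hyp_H_def by simp
  then obtain x where x: "x \<in> p" "x 0 \<noteq> 0" by (elim bexE) (rule that)
  note S = supported_elem[OF p(1) x(1)]
  have "1 / x 0 \<noteq> 0" using x(2) by simp
  hence "p = hclass (\<lambda>i. 1 / x 0 * x i)" unfolding S(3) by (rule hclass_scale[symmetric])
  moreover have "supported {0..d} (\<lambda>i. 1 / x 0 * x i)" using S(1) by (simp add: supported_def)
  moreover have "1 / x 0 * x 0 = 1" using x(2) by simp
  ultimately show ?thesis by (intro exI[of _ "\<lambda>i. 1 / x 0 * x i"] conjI)
qed

text \<open>A translation of the affine chart: the unipotent matrix with first column
  \<open>1, - y 1, ..., - y d\<close> fixes the hyperplane at infinity pointwise.\<close>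

lemma ex_translation_in_G_group:
  assumes y: "supported {0..d} y" "y 0 = 1"
  obtains g where "g \<in> G_group d" "act_vec d g y = unit_fn 0"
proof -
  define g where "g = mat (d + 1) (d + 1) (\<lambda>(i, j). if i = j then 1 else if j = 0 then - y i else 0)"
  have gc: "g \<in> carrier_mat (d + 1) (d + 1)" by (simp add: g_def)
  have act: "act_vec d g x i = x i - (if i = 0 then 0 else y i * x 0)" if x: "supported {0..d} x" for x i
  proof (cases "i \<le> d")
    case True
    have "(\<Sum>j\<in>{0..d}. g $$ (i, j) * x j) =
        (\<Sum>j\<in>{0..d}. (if j = i then x i else 0) + (if j = 0 then (if i = 0 then 0 else - y i * x 0) else 0))"
      by (rule sum.cong) (use True in \<open>auto simp: g_def\<close>)
    thus ?thesis using True by (simp add: act_vec_def sum.distrib)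
  next
    case False
    thus ?thesis using x y(1) by (simp add: act_vec_def supported_def)
  qed
  have "det g = prod_list (diag_mat g)" by (rule det_lower_triangular[OF _ gc]) (auto simp: g_def)
  also have "\<dots> = 1" unfolding prod_list_diag_prod by (rule prod.neutral) (simp add: g_def)
  finally have det: "det g = 1" .
  have "mat_act d g p = p" if p: "p \<in> hyp_H d" for p
  proof -
    obtain x where x: "p = hclass x" "supported {0..d} x"
      using hyp_H_pspace[OF p] unfolding pspace_def mem_Collect_eq by (elim exE conjE) (rule that)
    have "x 0 = 0" using p self_in_hclass[of x] by (simp add: hyp_H_def x(1))
    hence "act_vec d g x = x" by (intro ext) (simp add: act[OF x(2)])
    thus ?thesis unfolding x(1) mat_act_hclass by simp
  qed
  hence "g \<in> G_group d" using gc det by (simp add: G_group_def)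
  moreover have "act_vec d g y = unit_fn 0"
    by (rule ext) (simp add: act[OF y(1)] y(2) unit_fn_def)
  ultimately show ?thesis by (rule that)
qed

text \<open>Translate the last point to \<open>e_zero\<close> and normalise the zeroth coordinate of
  the others to 1; the remaining affine coordinates form \<open>x\<close>.\<close>

lemma T_open_normal_form:
  assumes \<omega>: "\<omega> \<in> T_open d n" and n: "n \<ge> 2"
  obtains x where "supported (LM_coords d n) x" "configuration d n x \<in> U_space d n"
    "\<omega> = G_orbit d n (configuration d n x)"
proof -
  obtain q where q: "q \<in> U_space d n" "\<omega> = G_orbit d n q" using \<omega> unfolding T_open_def by (elim imageE) (rule that)
  note qp = U_space_memD[OF q(1)]
  have nn: "n \<in> {1..n}" using n by simp
  obtain y where y: "q n = hclass y" "supported {0..d} y" "y 0 = 1"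
    using ex_affine_representative[OF qp[OF nn]] by (elim exE conjE) (rule that)
  obtain g where g: "g \<in> G_group d" "act_vec d g y = unit_fn 0" by (rule ex_translation_in_G_group[OF y(2,3)])
  define q' where "q' = (\<lambda>i\<in>{1..n}. mat_act d g (q i))"
  have q'U: "q' \<in> U_space d n" unfolding q'_def by (rule G_action_U_space[OF g(1) q(1)])
  have orb: "G_orbit d n q' = \<omega>" unfolding q'_def q(2) by (rule G_orbit_act[OF g(1)]) (rule qp(1))
  have q'n: "q' n = e_zero" using nn by (simp add: q'_def y(1) mat_act_hclass g(2) e_zero_eq)
  have "\<forall>i\<in>{1..n}. \<exists>z. q' i = hclass z \<and> supported {0..d} z \<and> z 0 = 1"
  proof
    fix i assume i: "i \<in> {1..n}"
    show "\<exists>z. q' i = hclass z \<and> supported {0..d} z \<and> z 0 = 1"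
      by (rule ex_affine_representative[OF U_space_memD[OF q'U i]])
  qed
  from bchoice[OF this] obtain z where z: "\<forall>i\<in>{1..n}. q' i = hclass (z i) \<and> supported {0..d} (z i) \<and> z i 0 = 1" ..
  define x where "x = (\<lambda>(i, k). if (i, k) \<in> LM_coords d n then z i k else 0)"
  have cfg: "configuration d n x = q'"
  proof (rule extensionalityI[of _ "{1..n}"])
    show "configuration d n x \<in> extensional {1..n}" by (simp add: configuration_def)
    show "q' \<in> extensional {1..n}" by (simp add: q'_def)
    fix i assume i: "i \<in> {1..n}"
    show "configuration d n x i = q' i"
    proof (cases "i = n")
      case False
      have zi: "q' i = hclass (z i)" "supported {0..d} (z i)" "z i 0 = 1" using z i by simp_all
      have "line_vec d x 1 1 i = z i"
        by (rule ext) (use zi(2,3) i False in \<open>auto simp: line_vec_def x_def LM_coords_def supported_def\<close>)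
      thus ?thesis using i False zi(1) by (simp add: configuration_eq)
    qed (use nn in \<open>simp add: configuration_eq q'n\<close>)
  qed
  have "supported (LM_coords d n) x" unfolding supported_def x_def by (intro allI impI) (simp add: case_prod_beta)
  thus ?thesis
  proof (rule that)
    show "configuration d n x \<in> U_space d n" unfolding cfg by (rule q'U)
    show "\<omega> = G_orbit d n (configuration d n x)" unfolding cfg by (rule orb[symmetric])
  qed
qed

text \<open>Otherwise the point \<open>i\<close> would coincide with the last point
  \<open>e_zero\<close>.\<close>

lemma configuration_coords_nonzero:
  assumes U: "configuration d n x \<in> U_space d n" and i: "i \<in> {1..n-1}"
  shows "\<exists>k\<in>{1..d}. x (i, k) \<noteq> 0"
proof (rule ccontr)
  assume none: "\<not> (\<exists>k\<in>{1..d}. x (i, k) \<noteq> 0)"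
  have i': "i \<in> {1..n}" "n \<in> {1..n}" "i \<noteq> n" using i by auto
  have "line_vec d x 1 1 i = unit_fn 0"
    by (rule ext) (use none in \<open>auto simp: line_vec_def unit_fn_def\<close>)
  hence "configuration d n x i = configuration d n x n" using i' by (simp add: configuration_eq e_zero_eq)
  moreover have "inj_on (configuration d n x) {1..n}" using U by (simp add: U_space_def)
  ultimately show False using i' by (simp add: inj_on_eq_iff)
qed

lemma configuration_generic_in_U_space:
  assumes x: "generic d (n - 1) x" and d: "d \<ge> 1" and n: "n \<ge> 2"
  shows "configuration d n x \<in> U_space d n"
proof -
  let ?p = "line_tuple d (n - 1) x 1 1" and ?q = "configuration d n x"
  have V: "?p \<in> V_space d n" by (rule line_tuple_in_V_space[OF x d one_neq_zero])
  have pe: "?q i = ?p i" if "i \<in> {1..n-1}" for i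
    using that by (auto simp: configuration_eq line_tuple_def)
  have qn: "?q n = e_zero" using n by (simp add: configuration_eq)
  have split: "{1..n} = insert n {1..n-1}" using n by auto
  have pV: "inj_on ?p {1..n-1}" "\<And>i. i \<in> {1..n-1} \<Longrightarrow> ?p i \<notin> hyp_H d" "\<And>i. i \<in> {1..n-1} \<Longrightarrow> ?p i \<noteq> e_zero"
    using V by (simp_all add: V_space_def U_space_def)
  have "e_zero \<notin> hyp_H d"
  proof
    assume "e_zero \<in> hyp_H d"
    hence "\<forall>x\<in>hclass (unit_fn 0). x 0 = 0" by (simp add: hyp_H_def e_zero_eq)
    from bspec[OF this self_in_hclass] show False by (simp add: unit_fn_def)
  qed
  hence "?q i \<notin> hyp_H d" if "i \<in> {1..n}" for i
    using that pV(2)[of i] pe[of i] qn unfolding split by (cases "i = n") simp_all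
  moreover have "inj_on ?q {1..n}"
    unfolding split inj_on_insert
  proof
    show "inj_on ?q {1..n-1}" by (rule inj_on_cong[THEN iffD2, OF pe pV(1)])
    show "?q n \<notin> ?q ` ({1..n-1} - {n})"
    proof
      assume "?q n \<in> ?q ` ({1..n-1} - {n})"
      then obtain i where "e_zero = ?q i" "i \<in> {1..n-1} - {n}" unfolding qn by (rule imageE)
      thus False using pe[of i] pV(3)[of i] by simp
    qed
  qed
  moreover have "?q \<in> prod_space d n"
    unfolding prod_space_def
    by (rule PiE_I, rule configuration_in_pspace, assumption)
       (simp only: configuration_def restrict_apply if_False)
  ultimately show ?thesis by (simp add: U_space_def)
qed

section \<open>Density of generic points in the blow-up\<close>

lemma in_zariski_closureD:
  "p \<in> zariski closure_of S \<Longrightarrow> openin zariski U \<Longrightarrow> p \<in> U \<Longrightarrow> \<exists>q. q \<in> S \<and> q \<in> U"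
  unfolding in_closure_of by simp

lemma T_LM_subset_pspace: "T_LM d n \<subseteq> pspace UNIV"
  unfolding T_LM_def blowup_def using closure_of_subset_topspace[of zariski] by (simp add: topspace_zariski)

lemma line_poly_LM_vec:
  assumes "\<And>v. line_poly (\<lambda>x. r x v)"
  shows "line_poly (\<lambda>x. LM_vec d n (r x) a)"
proof (cases a)
  case (Pair v s)
  show ?thesis unfolding Pair LM_vec_def peval_LM_gen prod.case
    by (intro line_poly_if line_poly_mult line_poly_prod line_poly_const assms)
qed

text \<open>Around a point over \<open>x0\<close> a basic open set is given by a homogeneous
  polynomial that becomes, through \<open>LM_vec\<close>, a polynomial in \<open>x\<close> nonzero
  at \<open>x0\<close>. It cannot vanish on the whole complement of the hypersurface of non-generic
  \<open>x\<close>.\<close>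

lemma generic_dense_in_T_LM:
  assumes d: "d \<ge> 1" and n: "n \<ge> 2"
  shows "T_LM d n \<subseteq> zariski closure_of {LM_over d n x | x. generic d (n - 1) x}"
  unfolding T_LM_def blowup_def
proof (rule closure_of_minimal[OF _ closedin_closure_of], rule subsetI)
  let ?S = "{LM_over d n x | x. generic d (n - 1) x}"
  fix p assume "p \<in> {blowup_point (LM_choices d n) (LM_gen n) x | x. x \<noteq> (\<lambda>_. 0) \<and> supported (LM_coords d n) x \<and>
        (\<exists>j\<in>LM_choices d n. peval (LM_gen n j) x \<noteq> 0)}"
  then obtain x0 j where x0: "p = blowup_point (LM_choices d n) (LM_gen n) x0" "x0 \<noteq> (\<lambda>_. 0)" "supported (LM_coords d n) x0"
    and j: "j \<in> LM_choices d n" "peval (LM_gen n j) x0 \<noteq> 0"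
    unfolding mem_Collect_eq by (elim exE conjE bexE) (rule that)
  have p: "p = hclass (LM_vec d n x0)" using x0(1) LM_over_eq[of d n x0] by (simp add: LM_over_def)
  obtain v where "x0 v \<noteq> 0" using x0(2) by (auto simp: fun_eq_iff)
  hence "LM_vec d n x0 (v, j) \<noteq> 0" using j by (simp add: LM_vec_def)
  hence "LM_vec d n x0 \<noteq> (\<lambda>_. 0)" by (intro notI) simp
  hence pp: "p \<in> pspace UNIV" unfolding p by (rule hclass_in_pspace)
  show "p \<in> zariski closure_of ?S"
  proof (rule in_zariski_closureI[OF pp])
    fix U assume pU: "p \<in> U" and U: "openin zariski U"
    obtain e F where F: "homogeneous e F" "\<not> pvanish F p" "{q \<in> pspace UNIV. \<not> pvanish F q} \<subseteq> U"
      by (rule zariski_open_basis[OF U pU])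
    \<comment> \<open>Forces the support condition, so that all functions are defined on the full
      coordinate space and \<open>line_poly_dense\<close> applies.\<close>
    define r :: "(nat \<times> nat \<Rightarrow> complex) \<Rightarrow> nat \<times> nat \<Rightarrow> complex"
      where "r x v = (if v \<in> LM_coords d n then x v else 0)" for x v
    define f where "f x = peval F (LM_vec d n (r x))" for x
    \<comment> \<open>Nonzero only if all coordinates are nonzero and the first coordinates of the
      points are pairwise distinct.\<close>
    define \<delta> :: "(nat \<times> nat \<Rightarrow> complex) \<Rightarrow> complex" where "\<delta> x = (\<Prod>v\<in>LM_coords d n. x v) *
      (\<Prod>i\<in>{1..n-1}. \<Prod>j\<in>{1..n-1}. if i = j then 1 else x (i, 1) - x (j, 1))" for x
    have lr: "line_poly (\<lambda>x. r x v)" for v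
      unfolding r_def by (intro line_poly_if line_poly_coord line_poly_const)
    have lf: "line_poly f" unfolding f_def by (rule line_poly_peval) (rule line_poly_LM_vec[OF lr])
    have ld: "line_poly \<delta>" unfolding \<delta>_def
      by (intro line_poly_mult line_poly_prod line_poly_if line_poly_diff line_poly_coord line_poly_const)
    \<comment> \<open>The vector with entry \<open>i\<close> at every \<open>(i, k)\<close> is
      generic.\<close>
    have d0: "\<delta> (\<lambda>(i, k). of_nat i) \<noteq> 0" by (auto simp: \<delta>_def LM_coords_def)
    have fin: "finite (LM_coords d n)" by (simp add: LM_coords_def)
    have gen: "generic d (n - 1) (r x)" if "\<delta> x \<noteq> 0" for x
    proof -
      have a: "x v \<noteq> 0" if "v \<in> LM_coords d n" for v using \<open>\<delta> x \<noteq> 0\<close> that fin by (simp add: \<delta>_def)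
      have b: "x (i, 1) \<noteq> x (j, 1)" if "i \<in> {1..n-1}" "j \<in> {1..n-1}" "i \<noteq> j" for i j
      proof -
        have "(\<Prod>i\<in>{1..n-1}. \<Prod>j\<in>{1..n-1}. if i = j then 1 else x (i, 1) - x (j, 1)) \<noteq> 0"
          using \<open>\<delta> x \<noteq> 0\<close> unfolding \<delta>_def by (rule contrapos_nn) (simp only: mult_zero_right)
        hence "(if i = j then 1 else x (i, 1) - x (j, 1)) \<noteq> 0"
          unfolding prod_zero_iff[OF finite_atLeastAtMost] using that(1,2) by blast
        thus ?thesis using that(3) by simp
      qed
      have c: "(i, 1) \<in> LM_coords d n" if "i \<in> {1..n-1}" for i using that d by (simp add: LM_coords_def)
      show ?thesis unfolding generic_def
      proof (intro conjI ballI inj_onI)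
        show "supported ({1..n - 1} \<times> {1..d}) (r x)" by (simp add: supported_def r_def LM_coords_def)
        fix i k assume "i \<in> {1..n-1}" "k \<in> {1..d}"
        hence "(i, k) \<in> LM_coords d n" by (simp add: LM_coords_def)
        thus "r x (i, k) \<noteq> 0" using a by (simp add: r_def)
      next
        fix i j assume ij: "i \<in> {1..n-1}" "j \<in> {1..n-1}" "r x (i, 1) = r x (j, 1)"
        hence "x (i, 1) = x (j, 1)" unfolding r_def using c[OF ij(1)] c[OF ij(2)] by simp
        thus "i = j" using b[OF ij(1,2)] by blast
      qed
    qed
    have "\<exists>x. \<delta> x \<noteq> 0 \<and> f x \<noteq> 0"
    proof (rule ccontr)
      assume none: "\<not> (\<exists>x. \<delta> x \<noteq> 0 \<and> f x \<noteq> 0)"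
      have "f x0 = 0" by (rule line_poly_dense[OF lf ld d0]) (use none in blast)
      moreover have "r x0 = x0" by (rule ext) (use x0(3)[unfolded supported_def, rule_format] in \<open>simp add: r_def\<close>)
      ultimately show False using F(2) pvanish_hclass[OF F(1)] by (simp add: f_def p)
    qed
    then obtain x where x: "\<delta> x \<noteq> 0" "f x \<noteq> 0" by (elim exE conjE) (rule that)
    note g = gen[OF x(1)]
    have "LM_over d n (r x) \<in> pspace UNIV"
      unfolding LM_over_eq by (rule hclass_in_pspace, rule LM_over_in_T_LM(2)[OF generic_coords[OF g d] n])
    moreover have "\<not> pvanish F (LM_over d n (r x))"
      unfolding LM_over_eq pvanish_hclass[OF F(1)] using x(2) by (simp add: f_def)
    ultimately have "LM_over d n (r x) \<in> U" using F(3) by (intro subsetD[OF F(3)]) simp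
    thus "\<exists>q\<in>?S. q \<in> U"
      by (rule bexI[of _ "LM_over d n (r x)"]) (intro CollectI exI[of _ "r x"] conjI refl g)
  qed
qed

section \<open>The isomorphism\<close>

lemma rho_LM_over_generic:
  assumes ext: "extends_rho_open d n \<rho>" and x: "generic d (n - 1) x" and d: "d \<ge> 1" and n: "n \<ge> 2"
  shows "\<rho> (LM_over d n x) = hclass (chow_vec d (n - 1) x)"
  using ext generic_coords(1)[OF x d] configuration_generic_in_U_space[OF x d n]
  unfolding extends_rho_open_def rho_open_generic[OF x d n, symmetric] by simp

text \<open>Every class has a configuration in normal form, and over it \<open>\<rho>\<close> takes
  the value of \<open>rho_open\<close>; closing up inside the Chow variety gives no more than
  closing up in the ambient projective space.\<close>

lemma chow_quotient_subset_closure: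
  assumes ext: "extends_rho_open d n \<rho>" and n: "n \<ge> 2"
  shows "chow_quotient d n \<subseteq> zariski closure_of (\<rho> ` T_LM d n)"
proof -
  have sub: "rho_open d n ` T_open d n \<subseteq> \<rho> ` T_LM d n"
  proof
    fix q assume "q \<in> rho_open d n ` T_open d n"
    then obtain \<omega> where \<omega>: "q = rho_open d n \<omega>" "\<omega> \<in> T_open d n" by (rule imageE)
    obtain x where x: "supported (LM_coords d n) x" "configuration d n x \<in> U_space d n"
      "\<omega> = G_orbit d n (configuration d n x)" by (rule T_open_normal_form[OF \<omega>(2) n])
    have "LM_over d n x \<in> T_LM d n"
      by (rule LM_over_in_T_LM(1)[OF x(1) configuration_coords_nonzero[OF x(2)] n])
    moreover have "q = \<rho> (LM_over d n x)" using ext x unfolding extends_rho_open_def \<omega>(1) by simp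
    ultimately show "q \<in> \<rho> ` T_LM d n" by (rule rev_image_eqI)
  qed
  have "zariski closure_of (chow_variety d (n - 1) (orbit_class d n) \<inter> rho_open d n ` T_open d n)
      \<subseteq> zariski closure_of (\<rho> ` T_LM d n)"
    by (rule closure_of_mono[OF le_infI2[OF sub]])
  thus ?thesis unfolding chow_quotient_def closure_of_subtopology by (rule le_infI2)
qed

text \<open>Density is used twice: a neighbourhood of \<open>q\<close> contains a value of
  \<open>\<rho>\<close>, and its preimage under the continuous map \<open>\<rho>\<close>, being open
  and nonempty, contains a generic point, whose Chow point is \<open>chow_vec\<close>.\<close>

lemma chow_quotient_limit:
  assumes mor: "morphism (T_LM d n) (chow_quotient d n) \<rho>" and ext: "extends_rho_open d n \<rho>"
    and d: "d \<ge> 1" and n: "n \<ge> 2" and q: "q \<in> chow_quotient d n" and y: "y \<in> q"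
  shows "chow_limit d (n - 1) y"
proof -
  have qc: "q \<in> zariski closure_of (\<rho> ` T_LM d n)" using chow_quotient_subset_closure[OF ext n] q by (rule subsetD)
  have qp: "q \<in> pspace UNIV" using qc closure_of_subset_topspace[of zariski] unfolding topspace_zariski by (rule rev_subsetD)
  have "peval F y = 0" if F: "homogeneous e F" and van: "\<forall>x. generic d (n - 1) x \<longrightarrow> peval F (chow_vec d (n - 1) x) = 0" for e F
  proof (rule ccontr)
    assume nz: "peval F y \<noteq> 0"
    define W where "W = {p \<in> pspace UNIV. \<not> pvanish F p}"
    have W: "openin zariski W" unfolding W_def by (rule openin_nonvanishing[OF F])
    have "q \<in> W" using qp nz pvanish_iff[OF F qp y] by (simp add: W_def)
    from in_zariski_closureD[OF qc W this]
    obtain p where p: "p \<in> T_LM d n" "\<rho> p \<in> W" by (elim exE conjE imageE) (rule that, assumption, simp)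
    have "openin (zar (chow_quotient d n)) (W \<inter> chow_quotient d n)"
      unfolding openin_subtopology by (rule exI[of _ W]) (simp add: W)
    from morphism_preimage_open[OF mor T_LM_subset_pspace this]
    obtain W' where W': "openin zariski W'" "T_LM d n \<inter> \<rho> -` (W \<inter> chow_quotient d n) = W' \<inter> T_LM d n"
      unfolding openin_subtopology by (elim exE conjE) (rule that)
    have "\<rho> p \<in> chow_quotient d n" by (rule morphism_maps_to[OF mor T_LM_subset_pspace p(1)])
    hence "p \<in> T_LM d n \<inter> \<rho> -` (W \<inter> chow_quotient d n)" using p by simp
    hence pW': "p \<in> W'" unfolding W'(2) by (rule IntD1)
    have "p \<in> zariski closure_of {LM_over d n x | x. generic d (n - 1) x}" using generic_dense_in_T_LM[OF d n] p(1) by (rule subsetD)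
    from in_zariski_closureD[OF this W'(1) pW']
    obtain x where x: "generic d (n - 1) x" "LM_over d n x \<in> W'" unfolding mem_Collect_eq by (elim exE conjE) (rule that, assumption, simp)
    have "LM_over d n x \<in> T_LM d n" by (rule LM_over_in_T_LM(1)[OF generic_coords[OF x(1) d] n])
    hence "LM_over d n x \<in> W' \<inter> T_LM d n" using x(2) by simp
    hence "\<rho> (LM_over d n x) \<in> W" unfolding W'(2)[symmetric] by simp
    hence "\<not> pvanish F (hclass (chow_vec d (n - 1) x))" by (simp add: rho_LM_over_generic[OF ext x(1) d n] W_def)
    thus False using van x(1) by (simp add: pvanish_hclass[OF F])
  qed
  moreover have "y \<noteq> (\<lambda>_. 0)" by (rule pspace_elem_hclass(2)[OF qp y])
  ultimately show ?thesis unfolding chow_limit_def by (intro conjI allI impI)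
qed

theorem theorem3p18:
  fixes d n :: nat
    and \<rho> :: "LM_point \<Rightarrow> chow_pt"
    and N :: "'k ppoint set"
    and \<pi> :: "'k ppoint \<Rightarrow> chow_pt"
    and \<rho>t :: "LM_point \<Rightarrow> 'k ppoint"
  assumes "d \<ge> 1" and "n \<ge> 2"
    and "morphism (T_LM d n) (chow_quotient d n) \<rho>"
    and "extends_rho_open d n \<rho>"
    and "normalization N (chow_quotient d n) \<pi>"
    and "morphism (T_LM d n) N \<rho>t"
    and "\<forall>p\<in>T_LM d n. \<rho> p = \<pi> (\<rho>t p)"
  shows "isomorphism (T_LM d n) N \<rho>t"
proof -
  note d = assms(1) and n = assms(2) and mor = assms(3) and ext = assms(4)
  let ?S = "{LM_over d n x | x. generic d (n - 1) x}"
  have N: "variety N" "birational_morphism N (chow_quotient d n) \<pi>"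
    using assms(5) by (simp_all add: normalization_def normal_variety_def)
  note dense = chow_quotient_subset_closure[OF ext n]
  have Y: "chow_quotient d n \<subseteq> pspace UNIV"
    using order_trans[OF dense closure_of_subset_topspace] unfolding topspace_zariski .
  have g: "morphism (chow_quotient d n) (T_LM d n) (chow_inverse d n)"
    by (rule chow_inverse_morphism[OF n d Y]) (rule chow_quotient_limit[OF mor ext d n])
  have S: "?S \<subseteq> T_LM d n"
  proof
    fix p assume "p \<in> ?S"
    then obtain x where x: "p = LM_over d n x" "generic d (n - 1) x" unfolding mem_Collect_eq by (elim exE conjE) (rule that)
    show "p \<in> T_LM d n" unfolding x(1) by (rule LM_over_in_T_LM(1)[OF generic_coords[OF x(2) d] n])
  qed
  have inv_S: "chow_inverse d n (\<rho> p) = p" if p: "p \<in> ?S" for p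
  proof -
    obtain x where x: "p = LM_over d n x" "generic d (n - 1) x" using p unfolding mem_Collect_eq by (elim exE conjE) (rule that)
    show ?thesis unfolding x(1) rho_LM_over_generic[OF ext x(2) d n] by (rule chow_inverse_generic[OF x(2) d n])
  qed
  \<comment> \<open>The composite and the identity are morphisms from the blow-up to itself that
    agree at generic points; these are dense.\<close>
  have inv: "chow_inverse d n (\<rho> p) = p" if p: "p \<in> T_LM d n" for p
    by (rule morphisms_agree_if_agree_on_dense[where f = "\<lambda>p. chow_inverse d n (\<rho> p)" and g = "\<lambda>p. p" and S = ?S,
          OF morphism_compose[OF mor g T_LM_subset_pspace Y] morphism_id T_LM_subset_pspace T_LM_subset_pspace S
          generic_dense_in_T_LM[OF d n] _ p])
      (rule inv_S)
  show ?thesis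
  proof (rule lift_is_isomorphism[OF N(1) T_LM_subset_pspace Y mor assms(6) N(2) _ dense g])
    show "\<rho> p = \<pi> (\<rho>t p)" if "p \<in> T_LM d n" for p using assms(7) that by (rule bspec)
    show "chow_inverse d n (\<rho> p) = p" if "p \<in> T_LM d n" for p using that by (rule inv)
  qed
qed

end
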